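(* Consider a monotone-separable network with $\gamma(0)<a$ satisfying (IA), (AA), (SE) and (H) (all defined in the context). Put $b=\gamma(0)$. For any $x$ and for $j=1,\ldots,r$, let $\{K_{n,x}^{(j)}\}_n$ be a sequence of events such that: (i) for any $n$ and $j$, the event $K_{n,x}^{(j)}$ and the random variable $Y_{-n}^{(j)}$ are independent; (ii) for any $j$, $\mathbf{P}(K_{n,x}^{(j)})\to 1$ uniformly in $n\ge N_x$ as $x\to\infty$. For any (real) sequences $\{\eta_n^{(j)}\}_n$, $j=1,\ldots,r$, tending to $0$, put $$A_{n,x}^{(j)}=K_{n,x}^{(j)}\cap\{Y_{-n}^{(j)}>x+n(a-b+\eta_n^{(j)})\},\qquad A_x^{(j)}=\bigcup_{n=N_x}^{\infty}A_{n,x}^{(j)},\qquad A_x=\bigcup_{j=1}^r A_x^{(j)}.$$ Then, as $x\to\infty$, $$\mathbf{P}(Z>x)\sim\mathbf{P}(Z>x,A_x)\sim\sum_{j=1}^r\mathbf{P}(Z>x,A_x^{(j)})\sim\sum_{j=1}^r\sum_{n=N_x}^\infty\mathbf{P}(Z>x,A_{n,x}^{(j)}).$$ Similarly, for any random variable $\tilde Z$ such that $\tilde Z\le Z$ a.s., $$\mathbf{P}(\tilde Z>x)=\mathbf{P}(\tilde Z>x,A_x)+o(\overline{F}^s(x))=\sum_{j=1}^r\mathbf{P}(\tilde Z>x,A_x^{(j)})+o(\overline{F}^s(x))=\sum_{j=1}^r\sum_{n=N_x}^\infty\mathbf{P}(\tilde Z>x,A_{n,x}^{(j)})+o(\overline{F}^s(x)).$$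 If moreover $\mathbf{P}(\tilde Z>x)=\Theta(\overline{F}^s(x))$, then $$\mathbf{P}(\tilde Z>x)\sim\mathbf{P}(\tilde Z>x,A_x)\sim\sum_{j=1}^r\mathbf{P}(\tilde Z>x,A_x^{(j)})\sim\sum_{j=1}^r\sum_{n=N_x}^\infty\mathbf{P}(\tilde Z>x,A_{n,x}^{(j)}).$$
   Context: Asymptotic notation ($x\to\infty$): for $c>0$, $f\sim cg$ means $f(x)/g(x)\to c$; $f\sim cg$ with $c=0$ means $f(x)=o(g(x))$; $f=\Theta(g)$ means $\limsup f/g<\infty$ and $\liminf f/g>0$. Monotone-separable network. The input $N=\{T_n\}_{n\in\mathbb{Z}}$ is a nondecreasing real sequence of arrival epochs, $\tau_n=T_{n+1}-T_n$, and $\{\zeta_n\}_{n\in\mathbb{Z}}$ is a sequence with values in a measurable space $K$ (service times and routing decisions). There are measurable functions $f_l:\mathbb{R}^l\times K^l\to\mathbb{R}$, $l\ge1$, and for $m\le n$ one puts $X_{[m,n]}(N)=f_{n-m+1}\{(T_l,\zeta_l),\,m\le l\le n\}$ (the finite time of last activity when the network starts empty and is fed by $T_m,\ldots,T_n$). For all inputs $N$ and all $m\le n$ it is required that: (causality) $X_{[m,n]}(N)\ge T_n$; (external monotonicity) $X_{[m,n]}(N')\ge X_{[m,n]}(N)$ whenever $T'_k\ge T_k$ for all $k$; (homogeneity) $X_{[m,n]}(c+N)=X_{[m,n]}(N)+c$ for all $c\in\mathbb{R}$; (separability) for $m\le l<n$, if $X_{[m,l]}(N)\le T_{l+1}$ then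 $X_{[m,n]}(N)=X_{[l+1,n]}(N)$. Maximal daters: $Z_{[m,n]}(N)=X_{[m,n]}(N)-T_n$; $Z_n=Z_{[n,n]}(N)$ (which does not depend on $N$). The sequence $Z_{[-n,0]}(N)$ is nondecreasing in $n$, and $Z=Z_{(-\infty,0]}=\lim_{n\to\infty}Z_{[-n,0]}(N)$ is the stationary maximal dater. Stochastic assumptions: $\{(\tau_n,\zeta_n)\}$ is stationary and ergodic, $\mathbf{E}\tau_n=a=\lambda^{-1}<\infty$, $\mathbf{E}Z_n<\infty$. With $Q$ the degenerate input with all points equal to $0$, $\gamma(0)=\lim_n Z_{[-n,-1]}(Q)/n=\lim_n\mathbf{E}Z_{[-n,-1]}(Q)/n$ a.s. (these limits exist and are constant). Stability: $\gamma(0)<a$. (IA): the sequences $\{\zeta_n\}$ and $\{\tau_n\}$ are mutually independent and each consists of i.i.d. random variables. (AA): for all $i$, $Z_i=Y_i^{(1)}+\cdots+Y_i^{(r)}$, where the $Y_i^{(j)}$ are nonnegative, independent of the interarrival times, and the vectors $(Y_i^{(1)},\ldots,Y_i^{(r)})$ are i.i.d. in $i$ (with arbitrary dependence between the components of a vector); in addition, for all $n\le 0$, $Z_{[n,0]}(Q)\ge\max_{j}\sum_{i=n}^0Y_i^{(j)}$ a.s. (SE): $F$ is a distribution function on $\mathbb{R}^+$ such that (a) $F$ is subexponential with finite mean; (b) the integrated tail distribution $F^s$, with tail $\overline{F}^s(x)=1-F^s(x)=\min\{1,\int_x^\infty\overline{F}(u)\,du\}$, $\overline{F}=1-F$, is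 subexponential; (c) for all $j$, $\mathbf{P}(Y_1^{(j)}>x)\sim d^{(j)}\overline{F}(x)$ as $x\to\infty$, with $d^{(j)}\ge0$ and $d=\sum_jd^{(j)}>0$. (H): as $x\to\infty$, $\mathbf{P}(\sum_{j=1}^rY_1^{(j)}>x)\sim\mathbf{P}(\max_{j}Y_1^{(j)}>x)\sim\sum_{j=1}^r\mathbf{P}(Y_1^{(j)}>x)\sim\sum_{j=1}^rd^{(j)}\overline{F}(x)$. $N_x$ denotes a fixed nondecreasing integer-valued function with $N_x\to\infty$ as $x\to\infty$ such that, for every real number $c$, $\sum_{n=0}^{N_x}\overline{F}(x+nc)=o(\overline{F}^s(x))$ (such a function exists). *)

theory Defs
  imports "HOL-Probability.Probability" "HOL-Library.Landau_Symbols"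
begin

section \<open>Monotone-separable networks\<close>

text \<open>
  The input is a sequence of arrival epochs \<open>T\<close> together with a sequence of marks \<open>z\<close>.
  A vector of length \<open>l\<close> is an extensional function on \<open>{..<l}\<close>, as in \<open>Pi\<^sub>M {..<l}\<close>.
\<close>

definition last_activity ::
    "(nat \<Rightarrow> (nat \<Rightarrow> real) \<times> (nat \<Rightarrow> 'k) \<Rightarrow> real) \<Rightarrow> int \<Rightarrow> int \<Rightarrow> (int \<Rightarrow> real) \<Rightarrow> (int \<Rightarrow> 'k) \<Rightarrow> real"
  where "last_activity f m n T z =
    (let l = nat (n - m + 1)
     in f l (\<lambda>i\<in>{..<l}. T (m + int i), \<lambda>i\<in>{..<l}. z (m + int i)))"

definition measurable_network ::
    "'k measure \<Rightarrow> (nat \<Rightarrow> (nat \<Rightarrow> real) \<times> (nat \<Rightarrow> 'k) \<Rightarrow> real) \<Rightarrow> bool"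
  where "measurable_network S f \<longleftrightarrow>
    (\<forall>l\<ge>1. f l \<in> (Pi\<^sub>M {..<l} (\<lambda>_. borel) \<Otimes>\<^sub>M Pi\<^sub>M {..<l} (\<lambda>_. S)) \<rightarrow>\<^sub>M borel)"

text \<open>
  The four conjuncts are causality, external monotonicity, homogeneity and separability.
  The inputs \<open>T\<close> are arbitrary nondecreasing sequences; the marks \<open>z\<close> are kept fixed.
\<close>

definition monotone_separable ::
    "(nat \<Rightarrow> (nat \<Rightarrow> real) \<times> (nat \<Rightarrow> 'k) \<Rightarrow> real) \<Rightarrow> (int \<Rightarrow> 'k) \<Rightarrow> bool"
  where "monotone_separable f z \<longleftrightarrow>
    (\<forall>T m n. mono T \<longrightarrow> m \<le> n \<longrightarrow> last_activity f m n T z \<ge> T n) \<and>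
    (\<forall>T T' m n. mono T \<longrightarrow> mono T' \<longrightarrow> m \<le> n \<longrightarrow> (\<forall>k. T' k \<ge> T k) \<longrightarrow>
       last_activity f m n T' z \<ge> last_activity f m n T z) \<and>
    (\<forall>T c m n. mono T \<longrightarrow> m \<le> n \<longrightarrow>
       last_activity f m n (\<lambda>k. c + T k) z = last_activity f m n T z + c) \<and>
    (\<forall>T m l n. mono T \<longrightarrow> m \<le> l \<longrightarrow> l < n \<longrightarrow> last_activity f m l T z \<le> T (l + 1) \<longrightarrow>
       last_activity f m n T z = last_activity f (l + 1) n T z)"

definition maximal_dater ::
    "(nat \<Rightarrow> (nat \<Rightarrow> real) \<times> (nat \<Rightarrow> 'k) \<Rightarrow> real) \<Rightarrow> int \<Rightarrow> int \<Rightarrow> (int \<Rightarrow> real) \<Rightarrow> (int \<Rightarrow> 'k) \<Rightarrow> real"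
  where "maximal_dater f m n T z = last_activity f m n T z - T n"

text \<open>
  The sequence below is nondecreasing, so the limit always exists in the extended reals.
\<close>

definition stationary_dater ::
    "(nat \<Rightarrow> (nat \<Rightarrow> real) \<times> (nat \<Rightarrow> 'k) \<Rightarrow> real) \<Rightarrow> (int \<Rightarrow> real) \<Rightarrow> (int \<Rightarrow> 'k) \<Rightarrow> ereal"
  where "stationary_dater f T z = lim (\<lambda>n::nat. ereal (maximal_dater f (- int n) 0 T z))"

definition degenerate_input :: "int \<Rightarrow> real"
  where "degenerate_input = (\<lambda>_. 0)"

text \<open>
  The constant \<open>\<gamma>(0)\<close>, as the limit of the normalised means; by the subadditive ergodic theorem
  this is also the almost sure limit of the normalised daters.
\<close>

definition gamma0 ::
    "'a measure \<Rightarrow> (nat \<Rightarrow> (nat \<Rightarrow> real) \<times> (nat \<Rightarrow> 'k) \<Rightarrow> real) \<Rightarrow> (int \<Rightarrow> 'a \<Rightarrow> 'k) \<Rightarrow> real"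
  where "gamma0 M f \<zeta> =
    lim (\<lambda>n::nat. (\<integral>\<omega>. maximal_dater f (- int n) (-1) degenerate_input (\<lambda>k. \<zeta> k \<omega>) \<partial>M) / real n)"


section \<open>Stochastic assumptions\<close>

definition stationary_ergodic :: "'a measure \<Rightarrow> 'b measure \<Rightarrow> (int \<Rightarrow> 'a \<Rightarrow> 'b) \<Rightarrow> bool"
  where "stationary_ergodic M S X \<longleftrightarrow>
    (\<forall>n. X n \<in> M \<rightarrow>\<^sub>M S) \<and>
    (let E = Pi\<^sub>M UNIV (\<lambda>_::int. S);
         P = distr M E (\<lambda>\<omega> n. X n \<omega>);
         \<theta> = (\<lambda>x n. x (n + 1))
     in distr P E \<theta> = P \<and>
        (\<forall>B\<in>sets E. \<theta> -` B \<inter> space E = B \<longrightarrow> measure P B = 0 \<or> measure P B = 1))"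

definition iid_sequence :: "'a measure \<Rightarrow> 'b measure \<Rightarrow> (int \<Rightarrow> 'a \<Rightarrow> 'b) \<Rightarrow> bool"
  where "iid_sequence M S X \<longleftrightarrow>
    prob_space.indep_vars M (\<lambda>_. S) X UNIV \<and> (\<forall>n. distr M S (X n) = distr M S (X 0))"

text \<open>
  The library's \<open>indep_var\<close> forces both random variables to take values in the same type.
\<close>

definition indep_rvs ::
    "'a measure \<Rightarrow> 'b measure \<Rightarrow> ('a \<Rightarrow> 'b) \<Rightarrow> 'c measure \<Rightarrow> ('a \<Rightarrow> 'c) \<Rightarrow> bool"
  where "indep_rvs M S X S' X' \<longleftrightarrow>
    X \<in> M \<rightarrow>\<^sub>M S \<and> X' \<in> M \<rightarrow>\<^sub>M S' \<and>
    prob_space.indep_set M (sets (vimage_algebra (space M) X S)) (sets (vimage_algebra (space M) X' S'))"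

definition assumption_IA ::
    "'a measure \<Rightarrow> 'k measure \<Rightarrow> (int \<Rightarrow> 'a \<Rightarrow> 'k) \<Rightarrow> (int \<Rightarrow> 'a \<Rightarrow> real) \<Rightarrow> bool"
  where "assumption_IA M S \<zeta> \<tau> \<longleftrightarrow>
    iid_sequence M S \<zeta> \<and> iid_sequence M borel \<tau> \<and>
    indep_rvs M (Pi\<^sub>M UNIV (\<lambda>_. S)) (\<lambda>\<omega> n. \<zeta> n \<omega>) (Pi\<^sub>M UNIV (\<lambda>_. borel)) (\<lambda>\<omega> n. \<tau> n \<omega>)"

text \<open>
  \<open>Y j i\<close> is the \<open>j\<close>-th component at index \<open>i\<close>. The value \<open>maximal_dater f i i T z\<close> does not
  depend on the input \<open>T\<close>, by homogeneity; it is evaluated here at the degenerate one.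
\<close>

definition assumption_AA ::
    "'a measure \<Rightarrow> (nat \<Rightarrow> (nat \<Rightarrow> real) \<times> (nat \<Rightarrow> 'k) \<Rightarrow> real) \<Rightarrow> (int \<Rightarrow> 'a \<Rightarrow> 'k) \<Rightarrow>
      (int \<Rightarrow> 'a \<Rightarrow> real) \<Rightarrow> nat \<Rightarrow> (nat \<Rightarrow> int \<Rightarrow> 'a \<Rightarrow> real) \<Rightarrow> bool"
  where "assumption_AA M f \<zeta> \<tau> r Y \<longleftrightarrow>
    (\<forall>i. AE \<omega> in M. maximal_dater f i i degenerate_input (\<lambda>k. \<zeta> k \<omega>) = (\<Sum>j=1..r. Y j i \<omega>)) \<and>
    (\<forall>j\<in>{1..r}. \<forall>i. AE \<omega> in M. 0 \<le> Y j i \<omega>) \<and>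
    indep_rvs M (Pi\<^sub>M UNIV (\<lambda>_. Pi\<^sub>M {1..r} (\<lambda>_. borel))) (\<lambda>\<omega> i. \<lambda>j\<in>{1..r}. Y j i \<omega>)
                (Pi\<^sub>M UNIV (\<lambda>_. borel)) (\<lambda>\<omega> n. \<tau> n \<omega>) \<and>
    iid_sequence M (Pi\<^sub>M {1..r} (\<lambda>_. borel)) (\<lambda>i \<omega>. \<lambda>j\<in>{1..r}. Y j i \<omega>) \<and>
    (\<forall>n\<le>0. AE \<omega> in M. maximal_dater f n 0 degenerate_input (\<lambda>k. \<zeta> k \<omega>)
                       \<ge> Max ((\<lambda>j. \<Sum>i=n..0. Y j i \<omega>) ` {1..r}))"


section \<open>Subexponential distributions\<close>

definition distribution_function_Rplus :: "(real \<Rightarrow> real) \<Rightarrow> bool"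
  where "distribution_function_Rplus F \<longleftrightarrow>
    mono F \<and> (\<forall>x. continuous (at_right x) F) \<and> (\<forall>x<0. F x = 0) \<and> (F \<longlongrightarrow> 1) at_top"

definition tail :: "(real \<Rightarrow> real) \<Rightarrow> real \<Rightarrow> real"
  where "tail F x = 1 - F x"

definition subexponential :: "(real \<Rightarrow> real) \<Rightarrow> bool"
  where "subexponential F \<longleftrightarrow>
    distribution_function_Rplus F \<and> (\<forall>x. tail F x > 0) \<and>
    ((\<lambda>x. measure (interval_measure F \<star> interval_measure F) {x<..} / tail F x) \<longlongrightarrow> 2) at_top"

text \<open>
  The case distinction makes this a distribution function on the nonnegative reals: for a mean
  below 1, the integral is less than 1 also at some negative arguments.
\<close>

definition integrated_tail :: "(real \<Rightarrow> real) \<Rightarrow> real \<Rightarrow> real"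
  where "integrated_tail F x =
    (if x < 0 then 0 else 1 - min 1 (LINT u:{x..}|lborel. tail F u))"

text \<open>
  As \<open>tail F\<close> is positive, convergence of the quotient to \<open>d j\<close> also covers \<open>d j = 0\<close>,
  where it says that the numerator is \<open>o(tail F)\<close>.
\<close>

definition assumption_SE ::
    "'a measure \<Rightarrow> nat \<Rightarrow> (nat \<Rightarrow> int \<Rightarrow> 'a \<Rightarrow> real) \<Rightarrow> (real \<Rightarrow> real) \<Rightarrow> (nat \<Rightarrow> real) \<Rightarrow> bool"
  where "assumption_SE M r Y F d \<longleftrightarrow>
    subexponential F \<and> integrable (interval_measure F) (\<lambda>x. x) \<and>
    subexponential (integrated_tail F) \<and>
    (\<forall>j\<in>{1..r}. 0 \<le> d j \<and> ((\<lambda>x. \<P>(\<omega> in M. Y j 1 \<omega> > x) / tail F x) \<longlongrightarrow> d j) at_top) \<and>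
    (\<Sum>j=1..r. d j) > 0"

definition assumption_H ::
    "'a measure \<Rightarrow> nat \<Rightarrow> (nat \<Rightarrow> int \<Rightarrow> 'a \<Rightarrow> real) \<Rightarrow> (real \<Rightarrow> real) \<Rightarrow> (nat \<Rightarrow> real) \<Rightarrow> bool"
  where "assumption_H M r Y F d \<longleftrightarrow>
    (\<lambda>x. \<P>(\<omega> in M. (\<Sum>j=1..r. Y j 1 \<omega>) > x))
      \<sim>[at_top] (\<lambda>x. \<P>(\<omega> in M. Max ((\<lambda>j. Y j 1 \<omega>) ` {1..r}) > x)) \<and>
    (\<lambda>x. \<P>(\<omega> in M. Max ((\<lambda>j. Y j 1 \<omega>) ` {1..r}) > x))
      \<sim>[at_top] (\<lambda>x. \<Sum>j=1..r. \<P>(\<omega> in M. Y j 1 \<omega> > x)) \<and>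
    (\<lambda>x. \<Sum>j=1..r. \<P>(\<omega> in M. Y j 1 \<omega> > x))
      \<sim>[at_top] (\<lambda>x. \<Sum>j=1..r. d j * tail F x)"

definition admissible_threshold :: "(real \<Rightarrow> real) \<Rightarrow> (real \<Rightarrow> int) \<Rightarrow> bool"
  where "admissible_threshold F N \<longleftrightarrow>
    mono N \<and> filterlim N at_top at_top \<and>
    (\<forall>c. (\<lambda>x. \<Sum>n=0..N x. tail F (x + of_int n * c)) \<in> o(tail (integrated_tail F)))"

end

theory Submission
  imports Defs
begin

text \<open>
  Group the customers into blocks of length \<open>L\<close> and delay all arrivals of a block to its end. This
  bounds \<open>Z\<close> by \<open>Z'\<close>, the supremum of a random walk whose increments are the dater of a block minus
  the time span of a block; its drift is \<open>L(b\<^sub>L - a)\<close>, where \<open>b\<^sub>L \<ge> b\<close> tends to \<open>b\<close>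
  by subadditivity. With \<open>F'\<close> the integrated tail, Veraverbeke's bound gives
  \<open>P(Z' > x) \<le> (d/(a - b\<^sub>L) + o(1)) F'(x)\<close>. Conversely, by the law of large numbers almost every
  big jump of \<open>A\<^sub>x\<close> pushes the same walk above \<open>x\<close>, and different big jumps rarely occur together, so
  \<open>P(Z' > x, A\<^sub>x) \<ge> (d/(a - b) - o(1)) F'(x)\<close>. Since
  \<open>P(Z > x, A\<^sub>x\<^sup>c) \<le> P(Z' > x) - P(Z' > x, A\<^sub>x)\<close> for every \<open>L\<close>, letting \<open>L\<close> grow shows that
  this probability is \<open>o(F'(x))\<close>; the unions can be replaced by sums since
  the overlaps are \<open>o(F'(x))\<close> too.
\<close>

section \<open>Subexponential tails\<close>

text \<open>Blocks are needed because stability only says b < a, while the mean of a single dater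
  may exceed \<open>a\<close>; b_L = \<open>e L / real L\<close> falls below \<open>a\<close> once
  \<open>L\<close> is large. The constants arise as follows. A block dater is at most a sum of
  \<open>L\<close> single daters, so its tail is at most about L d times that of \<open>F\<close>;
  division by the drift L(a - b_L) gives d/(a - b_L). A jump n arrivals back has to exceed about x +
  n(a - b), and summing d times the tail of \<open>F\<close> along this line gives d/(a - b). Both
  estimates concern the bounding walk. For \<open>Z\<close> itself only a lower bound of the order
  of the integrated tail is needed, to turn an error that is small compared with it into asymptotic
  equivalence. The events \<open>K\<close> may depend on everything but the one \<open>Y\<close>
  with the same index, so they enter only through P(Y > y, not K) = P(Y > y) P(not K). A further
  obstacle is that the \<open>Y\<close> need not be functions of the marks: a large \<open>Y\<close>
  is exchanged for a large single dater, and this for a large window dater.\<close>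

locale nonneg_distribution =
  fixes F :: "real \<Rightarrow> real"
  assumes df: "distribution_function_Rplus F"
begin

lemma F_mono: "x \<le> y \<Longrightarrow> F x \<le> F y"
  using df by (auto simp: distribution_function_Rplus_def mono_def)

lemma F_neg: "x < 0 \<Longrightarrow> F x = 0"
  using df by (auto simp: distribution_function_Rplus_def)

lemma F_at_top: "(F \<longlongrightarrow> 1) at_top"
  using df by (auto simp: distribution_function_Rplus_def)

lemma F_right_cont: "continuous (at_right x) F"
  using df by (auto simp: distribution_function_Rplus_def)

lemma F_at_bot: "(F \<longlongrightarrow> 0) at_bot"
  by (rule tendsto_eventually) (auto simp: eventually_at_bot_dense F_neg intro!: exI[of _ 0])

sublocale real_distribution "interval_measure F"
  by (rule real_distribution_interval_measure[OF F_mono F_right_cont F_at_bot F_at_top])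

lemma measure_Iic: "measure (interval_measure F) {..x} = F x"
  by (rule measure_interval_measure_Iic[OF F_mono F_right_cont F_at_bot])

lemma measure_Ioi: "measure (interval_measure F) {x<..} = tail F x"
proof -
  have "{x<..} = UNIV - {..x}" by auto
  then show ?thesis
    using prob_compl[of "{..x}"] by (simp add: measure_Iic tail_def)
qed

lemma emeasure_Ioi: "emeasure (interval_measure F) {x<..} = ennreal (tail F x)"
  by (simp add: emeasure_eq_measure measure_Ioi)

lemma emeasure_Iic: "emeasure (interval_measure F) {..x} = ennreal (F x)"
  by (simp add: emeasure_eq_measure measure_Iic)

lemma emeasure_Ioc: "x \<le> y \<Longrightarrow> emeasure (interval_measure F) {x<..y} = ennreal (tail F x - tail F y)"
proof -
  assume "x \<le> y"
  have "{x<..y} = {..y} - {..x}" by auto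
  then have "measure (interval_measure F) {x<..y} = F y - F x"
    using \<open>x \<le> y\<close> finite_measure_Diff[of "{..y}" "{..x}"] by (auto simp: measure_Iic)
  then show ?thesis by (simp add: emeasure_eq_measure tail_def)
qed

lemma tail_antimono: "x \<le> y \<Longrightarrow> tail F y \<le> tail F x"
  by (simp add: tail_def F_mono)

lemma tail_nonneg: "0 \<le> tail F x"
  using measure_Ioi[of x] measure_nonneg by metis

lemma tail_le_1: "tail F x \<le> 1"
  using measure_Ioi[of x] prob_le_1 by metis

lemma tail_neg: "x < 0 \<Longrightarrow> tail F x = 1"
  by (simp add: tail_def F_neg)

lemma F_nonneg: "0 \<le> F x"
  using measure_Iic[of x] measure_nonneg by metis

lemma tail_at_top: "(tail F \<longlongrightarrow> 0) at_top"
  unfolding tail_def using tendsto_diff[OF tendsto_const F_at_top, of 1] by simp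

lemma tail_less: "e > 0 \<Longrightarrow> \<forall>\<^sub>F x in at_top. tail F x < e"
  using order_tendstoD(2)[OF tail_at_top] by simp

lemma AE_nonneg: "AE y in interval_measure F. 0 \<le> y"
proof -
  have "emeasure (interval_measure F) {..<0} = 0"
  proof -
    have "{..<0::real} = (\<Union>n. {..- (1 / real (Suc n))})"
    proof (intro set_eqI iffI)
      fix x :: real assume "x \<in> {..<0}"
      then obtain n where "1 / real (Suc n) < -x"
        using nat_approx_posE[of "-x"] by (metis lessThan_iff neg_0_less_iff_less)
      then show "x \<in> (\<Union>n. {..- (1 / real (Suc n))})" by (auto intro!: exI[of _ n])
    next
      fix x :: real assume "x \<in> (\<Union>n. {..- (1 / real (Suc n))})"
      then obtain n where "x \<le> - (1 / real (Suc n))" by auto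
      then show "x \<in> {..<0}" by (smt (verit) lessThan_iff of_nat_0_less_iff zero_less_Suc zero_less_divide_1_iff)
    qed
    also have "emeasure (interval_measure F) \<dots> = 0"
      by (rule emeasure_UN_eq_0) (auto simp: emeasure_Iic F_neg)
    finally show ?thesis .
  qed
  then show ?thesis by (intro AE_I[of _ _ "{..<0}"]) auto
qed

lemma tail_measurable[measurable]: "tail F \<in> borel_measurable borel"
proof -
  have "mono (\<lambda>x. - tail F x)" by (auto simp: mono_def tail_antimono)
  from borel_measurable_mono[OF this] have "(\<lambda>x. - (- tail F x)) \<in> borel_measurable borel"
    by (rule borel_measurable_uminus)
  then show ?thesis by simp
qed

lemma emeasure_convolution_tail:
  "emeasure (interval_measure F \<star> interval_measure F) {x<..}
     = (\<integral>\<^sup>+y. ennreal (tail F (x - y)) \<partial>interval_measure F)"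
proof -
  have "emeasure (interval_measure F \<star> interval_measure F) {x<..}
      = (\<integral>\<^sup>+y. emeasure (interval_measure F) {a. a + y \<in> {x<..}} \<partial>interval_measure F)"
    by (rule convolution_emeasure) (auto intro: finite_measure_axioms)
  also have "\<dots> = (\<integral>\<^sup>+y. ennreal (tail F (x - y)) \<partial>interval_measure F)"
  proof (rule nn_integral_cong)
    fix y
    have "{a. a + y \<in> {x<..}} = {x - y<..}" by auto
    then show "emeasure (interval_measure F) {a. a + y \<in> {x<..}} = ennreal (tail F (x - y))"
      by (simp add: emeasure_Ioi)
  qed
  finally show ?thesis .
qed

lemma nn_integral_tail_le_1: "(\<integral>\<^sup>+y. ennreal (tail F (g y)) \<partial>interval_measure F) \<le> 1"
proof -
  have "(\<integral>\<^sup>+y. ennreal (tail F (g y)) \<partial>interval_measure F) \<le> (\<integral>\<^sup>+y. 1 \<partial>interval_measure F)"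
    by (rule nn_integral_mono) (simp add: tail_le_1)
  then show ?thesis using emeasure_space_1 by simp
qed

end

locale subexponential_distribution =
  fixes F :: "real \<Rightarrow> real"
  assumes subexp: "subexponential F"
begin

sublocale nonneg_distribution F
  using subexp by unfold_locales (simp add: subexponential_def)

lemma tail_pos: "0 < tail F x"
  using subexp by (simp add: subexponential_def)

text \<open>Only the upper half of the defining limit, moved to nonnegative integrals. The estimates
  below subtract from it the explicit contributions of parts of the range of
  \<open>y\<close>.\<close>

lemma convolution_upper:
  assumes "c > 2"
  shows "\<forall>\<^sub>F x in at_top. (\<integral>\<^sup>+y. ennreal (tail F (x - y)) \<partial>interval_measure F) \<le> ennreal (c * tail F x)"
proof -
  have "((\<lambda>x. measure (interval_measure F \<star> interval_measure F) {x<..} / tail F x) \<longlongrightarrow> 2) at_top"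
    using subexp by (simp add: subexponential_def)
  from order_tendstoD(2)[OF this assms]
  show ?thesis
  proof eventually_elim
    case (elim x)
    \<comment> \<open>\<open>measure\<close> is 0 on sets of infinite \<open>emeasure\<close>, so
      the bound can be carried back only after finiteness is known.\<close>
    have fin: "emeasure (interval_measure F \<star> interval_measure F) {x<..} \<noteq> \<infinity>"
      unfolding emeasure_convolution_tail
      using nn_integral_tail_le_1[of "\<lambda>y. x - y"] by (auto simp: top_unique)
    have "measure (interval_measure F \<star> interval_measure F) {x<..} \<le> c * tail F x"
      using elim tail_pos[of x] by (simp add: field_simps)
    then show ?case
      using fin emeasure_eq_ennreal_measure[of "interval_measure F \<star> interval_measure F" "{x<..}"]
      unfolding emeasure_convolution_tail[symmetric] by (auto simp: ennreal_leI)
  qed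
qed

text \<open>On [0, B] the integrand is at least \<open>tail F x\<close>, which uses up
  \<open>F B * tail F x\<close> of the convolution bound; 2 + e - F B is the factor 1 + tail F B +
  e.\<close>

lemma integral_Ioi_upper:
  assumes "B \<ge> 0" "e > 0"
  shows "\<forall>\<^sub>F x in at_top. (\<integral>\<^sup>+y\<in>{B<..}. ennreal (tail F (x - y)) \<partial>interval_measure F)
           \<le> ennreal ((1 + tail F B + e) * tail F x)"
proof -
  have "2 + e > 2" using assms by simp
  from convolution_upper[OF this] show ?thesis
  proof eventually_elim
    case (elim x)
    let ?I = "\<integral>\<^sup>+y\<in>{B<..}. ennreal (tail F (x - y)) \<partial>interval_measure F"
    have "ennreal (F B * tail F x) + ?I
        = (\<integral>\<^sup>+y. ennreal (tail F x) * indicator {..B} y + ennreal (tail F (x - y)) * indicator {B<..} y \<partial>interval_measure F)"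
      by (subst nn_integral_add)
         (auto simp: nn_integral_cmult emeasure_Iic ennreal_mult F_nonneg tail_nonneg mult.commute)
    also have "\<dots> \<le> (\<integral>\<^sup>+y. ennreal (tail F (x - y)) \<partial>interval_measure F)"
      using AE_nonneg
      by (intro nn_integral_mono_AE) (auto elim!: eventually_mono simp: indicator_def intro!: ennreal_leI tail_antimono)
    also have "\<dots> \<le> ennreal ((2 + e) * tail F x)" by (rule elim)
    finally have *: "ennreal (F B * tail F x) + ?I \<le> ennreal ((2 + e) * tail F x)" .
    then have "?I \<noteq> \<infinity>" by (auto simp: top_unique)
    then obtain i where i: "?I = ennreal i" "i \<ge> 0" by (cases ?I) auto
    have "F B * tail F x + i \<le> (2 + e) * tail F x"
      using * i tail_pos[of x] F_nonneg[of B] assms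
      by (simp add: ennreal_plus[symmetric] del: ennreal_plus)
    then show ?case unfolding i by (intro ennreal_leI) (simp add: tail_def algebra_simps)
  qed
qed

text \<open>Beyond \<open>x\<close> the integrand is 1, so that part contributes exactly
  \<open>tail F x\<close> and removes the 1 from the factor.\<close>

lemma integral_Ioc_upper:
  assumes "B \<ge> 0" "e > 0"
  shows "\<forall>\<^sub>F x in at_top. (\<integral>\<^sup>+y\<in>{B<..x}. ennreal (tail F (x - y)) \<partial>interval_measure F)
           \<le> ennreal ((tail F B + e) * tail F x)"
  using integral_Ioi_upper[OF assms] eventually_ge_at_top[of B]
proof eventually_elim
  case (elim x)
  let ?I = "\<integral>\<^sup>+y\<in>{B<..x}. ennreal (tail F (x - y)) \<partial>interval_measure F"
  have "ennreal (tail F x) + ?I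
      = (\<integral>\<^sup>+y. indicator {x<..} y + ennreal (tail F (x - y)) * indicator {B<..x} y \<partial>interval_measure F)"
    by (subst nn_integral_add) (auto simp: emeasure_Ioi)
  also have "\<dots> \<le> (\<integral>\<^sup>+y\<in>{B<..}. ennreal (tail F (x - y)) \<partial>interval_measure F)"
    using elim by (intro nn_integral_mono) (auto simp: indicator_def tail_neg)
  also have "\<dots> \<le> ennreal ((1 + tail F B + e) * tail F x)" by (rule elim)
  finally have *: "ennreal (tail F x) + ?I \<le> ennreal ((1 + tail F B + e) * tail F x)" .
  then have "?I \<noteq> \<infinity>" by (auto simp: top_unique)
  then obtain i where i: "?I = ennreal i" "i \<ge> 0" by (cases ?I) auto
  have "tail F x + i \<le> (1 + tail F B + e) * tail F x"
    using * i tail_pos[of x] tail_nonneg[of B] assms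
    by (simp add: ennreal_plus[symmetric] del: ennreal_plus)
  then show ?case unfolding i by (intro ennreal_leI) (simp add: algebra_simps)
qed

text \<open>The integral is the probability that two independent \<open>F\<close>-variables both
  exceed \<open>B\<close> and their sum exceeds \<open>x\<close>. For y > x the truncation lowers
  the integrand from 1 to \<open>tail F B\<close>, a gain of \<open>F B * tail F x\<close>, and 1 +
  tail F B - F B = 2 * tail F B: joint largeness becomes rare as \<open>B\<close> grows.\<close>

lemma integral_both_large_upper:
  assumes "B \<ge> 0" "e > 0"
  shows "\<forall>\<^sub>F x in at_top. (\<integral>\<^sup>+y\<in>{B<..}. ennreal (tail F (max B (x - y))) \<partial>interval_measure F)
           \<le> ennreal ((2 * tail F B + e) * tail F x)"
  using integral_Ioi_upper[OF assms] eventually_ge_at_top[of B]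
proof eventually_elim
  case (elim x)
  let ?I = "\<integral>\<^sup>+y\<in>{B<..}. ennreal (tail F (max B (x - y))) \<partial>interval_measure F"
  have "ennreal (F B * tail F x) + ?I
      = (\<integral>\<^sup>+y. ennreal (F B) * indicator {x<..} y + ennreal (tail F (max B (x - y))) * indicator {B<..} y \<partial>interval_measure F)"
    by (subst nn_integral_add) (auto simp: nn_integral_cmult emeasure_Ioi ennreal_mult F_nonneg tail_nonneg)
  also have "\<dots> \<le> (\<integral>\<^sup>+y\<in>{B<..}. ennreal (tail F (x - y)) \<partial>interval_measure F)"
  proof (rule nn_integral_mono)
    fix y
    show "ennreal (F B) * indicator {x<..} y + ennreal (tail F (max B (x - y))) * indicator {B<..} y
        \<le> ennreal (tail F (x - y)) * indicator {B<..} y"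
    proof (cases "x < y")
      case True
      then have "tail F (x - y) = 1" "max B (x - y) = B" using assms by (auto simp: tail_neg)
      then show ?thesis using True elim F_nonneg[of B] tail_nonneg[of B]
        by (simp add: indicator_def ennreal_plus[symmetric] tail_def del: ennreal_plus)
    next
      case False
      then show ?thesis by (auto simp: indicator_def intro!: ennreal_leI tail_antimono)
    qed
  qed
  also have "\<dots> \<le> ennreal ((1 + tail F B + e) * tail F x)" by (rule elim)
  finally have *: "ennreal (F B * tail F x) + ?I \<le> ennreal ((1 + tail F B + e) * tail F x)" .
  then have "?I \<noteq> \<infinity>" by (auto simp: top_unique)
  then obtain i where i: "?I = ennreal i" "i \<ge> 0" by (cases ?I) auto
  have "F B * tail F x + i \<le> (1 + tail F B + e) * tail F x"
    using * i tail_pos[of x] tail_nonneg[of B] F_nonneg[of B] assms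
    by (simp add: ennreal_plus[symmetric] del: ennreal_plus)
  then show ?case unfolding i by (intro ennreal_leI) (simp add: tail_def algebra_simps)
qed

text \<open>Splitting the convolution at \<open>y0\<close> and \<open>x\<close> bounds it from below
  by \<open>tail F x * F y0\<close>, plus \<open>tail F (x - y0)\<close> times the mass of (y0, x],
  plus \<open>tail F x\<close>. As the total is at most about 2 * tail F x, this forces
  \<open>tail F (x - y0)\<close> close to \<open>tail F x\<close>.\<close>

lemma long_tailed:
  assumes "c > 1"
  shows "\<forall>\<^sub>F x in at_top. tail F (x - y) \<le> c * tail F x"
proof -
  define y0 where "y0 = max y 0"
  \<comment> \<open>With this choice \<open>c * tail F y0\<close> equals
    \<open>tail F y0 + 2 * e\<close>: one \<open>e\<close> pays for the error in the convolution
    bound, the other for \<open>c * tail F x\<close>.\<close>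
  define e where "e = (c - 1) * tail F y0 / 2"
  have e: "e > 0" using assms tail_pos[of y0] by (simp add: e_def)
  have "2 + e > 2" using e by simp
  moreover have "e / c > 0" using e assms by simp
  ultimately have ev: "\<forall>\<^sub>F x in at_top. (\<integral>\<^sup>+y. ennreal (tail F (x - y)) \<partial>interval_measure F) \<le> ennreal ((2 + e) * tail F x)"
    "\<forall>\<^sub>F x in at_top. tail F x < e / c"
    by (auto intro: convolution_upper tail_less)
  show ?thesis
    using ev eventually_ge_at_top[of y0]
  proof eventually_elim
    case (elim x)
    have 0: "0 \<le> y0" by (simp add: y0_def)
    have "ennreal (tail F x * F y0 + tail F (x - y0) * (tail F y0 - tail F x) + tail F x)
       = (\<integral>\<^sup>+y. ennreal (tail F x) * indicator {..y0} y
          + (ennreal (tail F (x - y0)) * indicator {y0<..x} y + indicator {x<..} y) \<partial>interval_measure F)"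
      using elim(3)
      by (simp add: nn_integral_add nn_integral_cmult emeasure_Iic emeasure_Ioi emeasure_Ioc ennreal_mult''
           tail_nonneg F_nonneg tail_antimono ennreal_plus add.assoc)
    also have "\<dots> \<le> (\<integral>\<^sup>+y. ennreal (tail F (x - y)) \<partial>interval_measure F)"
      using AE_nonneg 0 elim(3)
      by (intro nn_integral_mono_AE) (auto elim!: eventually_mono simp: indicator_def tail_neg intro!: ennreal_leI tail_antimono)
    also have "\<dots> \<le> ennreal ((2 + e) * tail F x)" by (rule elim)
    finally have "tail F x * F y0 + tail F (x - y0) * (tail F y0 - tail F x) + tail F x \<le> (2 + e) * tail F x"
      by (subst (asm) ennreal_le_iff) (use e tail_nonneg in auto)
    then have "tail F (x - y0) * (tail F y0 - tail F x) \<le> (tail F y0 + e) * tail F x"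
      by (simp add: tail_def algebra_simps)
    also have "\<dots> \<le> (c * (tail F y0 - tail F x)) * tail F x"
    proof (rule mult_right_mono)
      have "c * tail F x \<le> e" using elim(2) assms by (auto simp: field_simps)
      moreover have "c * tail F y0 = tail F y0 + 2 * e" by (simp add: e_def field_simps)
      ultimately show "tail F y0 + e \<le> c * (tail F y0 - tail F x)"
        by (simp add: right_diff_distrib)
    qed (rule tail_nonneg)
    finally have *: "tail F (x - y0) * (tail F y0 - tail F x) \<le> (c * tail F x) * (tail F y0 - tail F x)"
      by (simp add: mult_ac)
    have "tail F x < tail F y0"
    proof -
      have "tail F x < e / c" by (rule elim)
      also have "e / c \<le> tail F y0"
        using assms tail_pos[of y0] by (simp add: e_def field_simps)
      finally show ?thesis .
    qed
    then have "tail F (x - y0) \<le> c * tail F x"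
      using * by (simp add: mult_le_cancel_right)
    moreover have "tail F (x - y) \<le> tail F (x - y0)"
      by (rule tail_antimono) (simp add: y0_def)
    ultimately show ?case by simp
  qed
qed

end


section \<open>Sums of independent variables with subexponential tails\<close>

lemma eventually_at_top_shift:
  fixes P :: "real \<Rightarrow> bool"
  assumes "eventually P at_top"
  shows "\<forall>\<^sub>F x in at_top. P (x + A)"
proof -
  obtain x0 where "\<And>x. x \<ge> x0 \<Longrightarrow> P x" using assms by (auto simp: eventually_at_top_linorder)
  then show ?thesis by (auto simp: eventually_at_top_linorder intro!: exI[of _ "x0 - A"])
qed

text \<open>The product probability that both coordinates exceed \<open>B\<close> and their sum
  exceeds \<open>x\<close>, as an iterated integral: in this form a tail bound for the inner measure
  passes through directly, and symmetry gives the same for the outer one.\<close>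

definition both_large :: "real measure \<Rightarrow> real measure \<Rightarrow> real \<Rightarrow> real \<Rightarrow> ennreal" where
  "both_large P Q B x = (\<integral>\<^sup>+y\<in>{B<..}. emeasure Q {max B (x - y)<..} \<partial>P)"

lemma sets_both_large:
  assumes "sets P = sets borel" "sets Q = sets borel"
  shows "{(y::real, z::real). B < y \<and> B < z \<and> x < y + z} \<in> sets (P \<Otimes>\<^sub>M Q)"
proof -
  have "open {p::real \<times> real. B < fst p \<and> B < snd p \<and> x < fst p + snd p}"
    by (intro open_Collect_conj open_Collect_less continuous_intros)
  then have "{(y::real, z::real). B < y \<and> B < z \<and> x < y + z} \<in> sets (borel \<Otimes>\<^sub>M borel)"
    unfolding borel_prod by (simp add: case_prod_beta')
  then show ?thesis using sets_pair_measure_cong[OF assms] by simp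
qed

lemma both_large_eq_pair:
  assumes "finite_measure P" "finite_measure Q" "sets P = sets borel" "sets Q = sets borel"
  shows "both_large P Q B x = emeasure (P \<Otimes>\<^sub>M Q) {(y, z). B < y \<and> B < z \<and> x < y + z}"
proof -
  interpret Q: finite_measure Q by fact
  have "emeasure (P \<Otimes>\<^sub>M Q) {(y, z). B < y \<and> B < z \<and> x < y + z}
     = (\<integral>\<^sup>+y. emeasure Q (Pair y -` {(y, z). B < y \<and> B < z \<and> x < y + z}) \<partial>P)"
    by (rule Q.emeasure_pair_measure_alt[OF sets_both_large[OF assms(3,4)]])
  also have "\<dots> = both_large P Q B x"
    unfolding both_large_def
  proof (rule nn_integral_cong)
    fix y
    have "Pair y -` {(y, z). B < y \<and> B < z \<and> x < y + z} = (if B < y then {max B (x - y)<..} else {})"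
      by auto
    then show "emeasure Q (Pair y -` {(y, z). B < y \<and> B < z \<and> x < y + z})
       = emeasure Q {max B (x - y)<..} * indicator {B<..} y" by simp
  qed
  finally show ?thesis by simp
qed

lemma both_large_commute:
  assumes "finite_measure P" "finite_measure Q" "sets P = sets borel" "sets Q = sets borel"
  shows "both_large P Q B x = both_large Q P B x"
proof -
  interpret P: finite_measure P by fact
  interpret Q: finite_measure Q by fact
  interpret pair_sigma_finite P Q ..
  have sp: "space P = UNIV" "space Q = UNIV"
    using assms(3,4)[THEN sets_eq_imp_space_eq] by simp_all
  have "emeasure (P \<Otimes>\<^sub>M Q) {(y, z). B < y \<and> B < z \<and> x < y + z}
      = emeasure (Q \<Otimes>\<^sub>M P) ((\<lambda>(y, z). (z, y)) -` {(y, z). B < y \<and> B < z \<and> x < y + z} \<inter> space (Q \<Otimes>\<^sub>M P))"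
    by (subst distr_pair_swap) (rule emeasure_distr[OF measurable_pair_swap' sets_both_large[OF assms(3,4)]])
  also have "(\<lambda>(y::real, z::real). (z, y)) -` {(y, z). B < y \<and> B < z \<and> x < y + z} \<inter> space (Q \<Otimes>\<^sub>M P)
      = {(y, z). B < y \<and> B < z \<and> x < y + z}"
    by (auto simp: space_pair_measure sp add.commute)
  finally show ?thesis
    using assms by (simp add: both_large_eq_pair)
qed

text \<open>The inner measure is evaluated only on half-lines that start at or beyond
  \<open>B\<close>, so a comparison of tails there suffices. Combined with
  \<open>both_large_commute\<close>, both arguments can be replaced by a dominating tail, one after
  the other.\<close>

lemma both_large_mono:
  assumes "\<And>y. y \<ge> B \<Longrightarrow> emeasure Q {y<..} \<le> ennreal C * emeasure Q' {y<..}"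
    and [measurable_cong]: "sets P = sets borel" and meas: "(\<lambda>y. emeasure Q' {max B (x - y)<..}) \<in> borel_measurable borel"
  shows "both_large P Q B x \<le> ennreal C * both_large P Q' B x"
proof -
  have [measurable]: "(\<lambda>y. emeasure Q' {max B (x - y)<..} * indicator {B<..} y) \<in> borel_measurable P"
    using meas by measurable
  have "both_large P Q B x \<le> (\<integral>\<^sup>+y. ennreal C * (emeasure Q' {max B (x - y)<..} * indicator {B<..} y) \<partial>P)"
    unfolding both_large_def
    by (intro nn_integral_mono) (auto simp: indicator_def intro!: assms(1))
  also have "\<dots> = ennreal C * both_large P Q' B x"
    unfolding both_large_def by (rule nn_integral_cmult) measurable
  finally show ?thesis .
qed

lemma (in prob_space) prob_both_large:
  assumes "indep_var borel X borel Y"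
  shows "emeasure M {\<omega>\<in>space M. B < X \<omega> \<and> B < Y \<omega> \<and> x < X \<omega> + Y \<omega>}
       = both_large (distr M borel X) (distr M borel Y) B x"
proof -
  have [measurable]: "X \<in> borel_measurable M" "Y \<in> borel_measurable M"
    using assms by (auto dest: indep_var_rv1 indep_var_rv2)
  have "both_large (distr M borel X) (distr M borel Y) B x
      = emeasure (distr M borel X \<Otimes>\<^sub>M distr M borel Y) {(y, z). B < y \<and> B < z \<and> x < y + z}"
  proof (rule both_large_eq_pair)
    show "finite_measure (distr M borel X)" "finite_measure (distr M borel Y)"
      by (rule prob_space.finite_measure, rule prob_space_distr, measurable)+
  qed simp_all
  also have "distr M borel X \<Otimes>\<^sub>M distr M borel Y = distr M (borel \<Otimes>\<^sub>M borel) (\<lambda>\<omega>. (X \<omega>, Y \<omega>))"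
    using assms by (simp add: indep_var_distribution_eq)
  also have "emeasure \<dots> {(y, z). B < y \<and> B < z \<and> x < y + z} = emeasure M {\<omega>\<in>space M. B < X \<omega> \<and> B < Y \<omega> \<and> x < X \<omega> + Y \<omega>}"
  proof (subst emeasure_distr)
    show "{(y, z). B < y \<and> B < z \<and> x < y + z} \<in> sets (borel \<Otimes>\<^sub>M borel)"
      by (rule sets_both_large) simp_all
    show "emeasure M ((\<lambda>\<omega>. (X \<omega>, Y \<omega>)) -` {(y, z). B < y \<and> B < z \<and> x < y + z} \<inter> space M)
        = emeasure M {\<omega>\<in>space M. B < X \<omega> \<and> B < Y \<omega> \<and> x < X \<omega> + Y \<omega>}"
      by (rule arg_cong[where f="emeasure M"]) auto
  qed measurable
  finally show ?thesis by simp
qed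

context subexponential_distribution
begin

lemma both_large_measurable:
  fixes Q :: "real measure"
  assumes "finite_measure Q" "sets Q = sets borel"
  shows "(\<lambda>y. emeasure Q {max B (x - y)<..}) \<in> borel_measurable borel"
proof -
  interpret Q: finite_measure Q by fact
  have "mono (\<lambda>y. measure Q {max B (x - y)<..})"
  proof (rule monoI)
    fix y y' :: real assume "y \<le> y'"
    then show "measure Q {max B (x - y)<..} \<le> measure Q {max B (x - y')<..}"
      by (intro Q.finite_measure_mono) (auto simp: assms(2))
  qed
  from borel_measurable_mono[OF this] show ?thesis
    by (simp add: Q.emeasure_eq_measure)
qed

text \<open>States limsup P(X > x) / tail F x \<le> c without a quotient; the quantifier over
  \<open>c'\<close> lets errors be absorbed by slightly larger constants.\<close>

definition tail_at_most :: "'a measure \<Rightarrow> ('a \<Rightarrow> real) \<Rightarrow> real \<Rightarrow> bool" where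
  "tail_at_most M X c \<longleftrightarrow> (\<forall>c'>c. \<forall>\<^sub>F x in at_top. measure M {\<omega>\<in>space M. X \<omega> > x} \<le> c' * tail F x)"

lemma tail_at_mostD:
  "tail_at_most M X c \<Longrightarrow> c < c' \<Longrightarrow> \<forall>\<^sub>F x in at_top. measure M {\<omega>\<in>space M. X \<omega> > x} \<le> c' * tail F x"
  by (auto simp: tail_at_most_def)

lemma tail_at_most_shift:
  assumes "tail_at_most M X c" "c \<ge> 0" "c < c'"
  shows "\<forall>\<^sub>F x in at_top. measure M {\<omega>\<in>space M. X \<omega> > x - B} \<le> c' * tail F x"
proof -
  define c1 where "c1 = (c + c') / 2"
  have c1: "c < c1" "c1 < c'" "c1 > 0" using assms by (auto simp: c1_def)
  have "\<forall>\<^sub>F x in at_top. measure M {\<omega>\<in>space M. X \<omega> > x - B} \<le> c1 * tail F (x - B)"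
    using eventually_at_top_shift[OF tail_at_mostD[OF assms(1) c1(1)], of "- B"] by simp
  moreover have "c' / c1 > 1" using c1 by simp
  note long_tailed[OF this, of B]
  ultimately show ?thesis
  proof eventually_elim
    case (elim x)
    have "c1 * tail F (x - B) \<le> c1 * (c' / c1 * tail F x)"
      using elim(2) c1 by (intro mult_left_mono) auto
    then show ?case using elim(1) c1 by simp
  qed
qed

text \<open>If the sum exceeds \<open>x\<close>, then one summand exceeds x - B or both exceed
  \<open>B\<close>. Long-tailedness makes the shift by \<open>B\<close> harmless, and the third
  event costs at most C^2 times the same probability for two \<open>F\<close>-variables, a small
  multiple of \<open>tail F x\<close> when \<open>B\<close> is large.\<close>

lemma tail_at_most_add:
  assumes "prob_space M" and indep: "prob_space.indep_var M borel X borel Y"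
    and X: "tail_at_most M X c1" "c1 \<ge> 0" and Y: "tail_at_most M Y c2" "c2 \<ge> 0"
  shows "tail_at_most M (\<lambda>\<omega>. X \<omega> + Y \<omega>) (c1 + c2)"
  unfolding tail_at_most_def
proof (intro allI impI)
  interpret M: prob_space M by fact
  have [measurable]: "X \<in> borel_measurable M" "Y \<in> borel_measurable M"
    using indep by (auto dest: M.indep_var_rv1 M.indep_var_rv2)
  fix c' assume c': "c1 + c2 < c'"
  \<comment> \<open>Three errors: one for each shifted tail and one for both summands being
    large.\<close>
  define e where "e = (c' - c1 - c2) / 3"
  have e: "e > 0" using c' by (simp add: e_def)
  define C where "C = max c1 c2 + 1"
  have C: "C > c1" "C > c2" "C > 0" using X Y by (auto simp: C_def)
  obtain x1 where x1: "\<And>x. x \<ge> x1 \<Longrightarrow> measure M {\<omega>\<in>space M. X \<omega> > x} \<le> C * tail F x"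
    using tail_at_mostD[OF X(1) C(1)] by (auto simp: eventually_at_top_linorder)
  obtain x2 where x2: "\<And>x. x \<ge> x2 \<Longrightarrow> measure M {\<omega>\<in>space M. Y \<omega> > x} \<le> C * tail F x"
    using tail_at_mostD[OF Y(1) C(2)] by (auto simp: eventually_at_top_linorder)
  have "\<forall>\<^sub>F B in at_top. tail F B < e / (3 * C^2)" using e C by (intro tail_less) simp
  then obtain x3 where x3: "\<And>x. x \<ge> x3 \<Longrightarrow> tail F x < e / (3 * C^2)"
    by (auto simp: eventually_at_top_linorder)
  define B where "B = Max {0, x1, x2, x3}"
  have B: "B \<ge> 0" "B \<ge> x1" "B \<ge> x2" "tail F B < e / (3 * C^2)"
    by (auto simp: B_def intro!: x3)
  have [simp]: "emeasure (distr M borel X) {y<..} = ennreal (measure M {\<omega>\<in>space M. X \<omega> > y})" for y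
    by (subst emeasure_distr) (auto simp: M.emeasure_eq_measure intro!: arg_cong[where f="measure M"])
  have [simp]: "emeasure (distr M borel Y) {y<..} = ennreal (measure M {\<omega>\<in>space M. Y \<omega> > y})" for y
    by (subst emeasure_distr) (auto simp: M.emeasure_eq_measure intro!: arg_cong[where f="measure M"])
  have fin: "finite_measure (distr M borel X)" "finite_measure (distr M borel Y)"
    by (rule prob_space.finite_measure, rule M.prob_space_distr, measurable)+
  have dX: "emeasure (distr M borel X) {y<..} \<le> ennreal C * emeasure (interval_measure F) {y<..}" if "y \<ge> B" for y
    using x1[of y] that B C by (simp add: emeasure_Ioi ennreal_mult'[symmetric] ennreal_leI)
  have dY: "emeasure (distr M borel Y) {y<..} \<le> ennreal C * emeasure (interval_measure F) {y<..}" if "y \<ge> B" for y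
    using x2[of y] that B C by (simp add: emeasure_Ioi ennreal_mult'[symmetric] ennreal_leI)
  have J: "both_large (distr M borel X) (distr M borel Y) B x \<le> ennreal (C^2) * both_large (interval_measure F) (interval_measure F) B x" for x
  proof -
    have m: "(\<lambda>y. emeasure (interval_measure F) {max B (x - y)<..}) \<in> borel_measurable borel"
      by (rule both_large_measurable) (simp_all add: finite_measure_axioms)
    have "both_large (distr M borel X) (distr M borel Y) B x \<le> ennreal C * both_large (distr M borel X) (interval_measure F) B x"
      by (rule both_large_mono[OF dY _ m]) auto
    also have "both_large (distr M borel X) (interval_measure F) B x = both_large (interval_measure F) (distr M borel X) B x"
      by (rule both_large_commute) (auto simp: fin finite_measure_axioms)
    also have "ennreal C * \<dots> \<le> ennreal C * (ennreal C * both_large (interval_measure F) (interval_measure F) B x)"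
      by (intro mult_left_mono both_large_mono[OF dX _ m]) auto
    finally show ?thesis using C by (simp add: power2_eq_square ennreal_mult mult.assoc)
  qed
  have "c1 < c1 + e" "c2 < c2 + e" using e by auto
  note ev = tail_at_most_shift[OF X(1) X(2) this(1), of B] tail_at_most_shift[OF Y(1) Y(2) this(2), of B]
  show "\<forall>\<^sub>F x in at_top. measure M {\<omega>\<in>space M. x < X \<omega> + Y \<omega>} \<le> c' * tail F x"
    \<comment> \<open>Taking \<open>tail F B\<close> itself as the error term makes the factor 3 *
      tail F B, which the choice of \<open>B\<close> keeps below e / C^2.\<close>
    using ev integral_both_large_upper[OF B(1) tail_pos[of B]]
  proof eventually_elim
    case (elim x)
    have "both_large (interval_measure F) (interval_measure F) B x \<le> ennreal (3 * tail F B * tail F x)"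
      using elim(3) by (simp add: both_large_def emeasure_Ioi)
    then have "ennreal (C^2) * both_large (interval_measure F) (interval_measure F) B x \<le> ennreal (C^2) * ennreal (3 * tail F B * tail F x)"
      by (intro mult_left_mono) auto
    also have "\<dots> = ennreal (C^2 * (3 * tail F B * tail F x))"
      by (rule ennreal_mult'[symmetric]) simp
    also have "\<dots> \<le> ennreal (e * tail F x)"
    proof (rule ennreal_leI)
      have "C^2 * (3 * tail F B) \<le> e" using B(4) C by (simp add: field_simps)
      then have "(C^2 * (3 * tail F B)) * tail F x \<le> e * tail F x" by (rule mult_right_mono) (rule tail_nonneg)
      then show "C^2 * (3 * tail F B * tail F x) \<le> e * tail F x" by (simp add: mult_ac)
    qed
    finally have "emeasure M {\<omega>\<in>space M. B < X \<omega> \<and> B < Y \<omega> \<and> x < X \<omega> + Y \<omega>} \<le> ennreal (e * tail F x)"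
      using J[of x] M.prob_both_large[OF indep, of B x] by simp
    then have 3: "measure M {\<omega>\<in>space M. B < X \<omega> \<and> B < Y \<omega> \<and> x < X \<omega> + Y \<omega>} \<le> e * tail F x"
      using e tail_nonneg[of x] by (simp add: M.emeasure_eq_measure)
    have "measure M {\<omega>\<in>space M. x < X \<omega> + Y \<omega>}
       \<le> measure M ({\<omega>\<in>space M. X \<omega> > x - B} \<union> {\<omega>\<in>space M. Y \<omega> > x - B} \<union> {\<omega>\<in>space M. B < X \<omega> \<and> B < Y \<omega> \<and> x < X \<omega> + Y \<omega>})"
      by (rule M.finite_measure_mono) auto
    also have "\<dots> \<le> measure M {\<omega>\<in>space M. X \<omega> > x - B} + measure M {\<omega>\<in>space M. Y \<omega> > x - B}
        + measure M {\<omega>\<in>space M. B < X \<omega> \<and> B < Y \<omega> \<and> x < X \<omega> + Y \<omega>}"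
      by (intro order_trans[OF measure_Un_le] add_right_mono measure_Un_le) auto
    also have "\<dots> \<le> (c1 + e) * tail F x + (c2 + e) * tail F x + e * tail F x"
      using elim 3 by linarith
    also have "\<dots> = c' * tail F x" by (simp add: e_def field_simps)
    finally show ?case .
  qed
qed

lemma tail_at_most_sum:
  assumes "prob_space M" "finite I" "prob_space.indep_vars M (\<lambda>_. borel) X I"
    and "\<And>i. i \<in> I \<Longrightarrow> tail_at_most M (X i) (c i)" "\<And>i. i \<in> I \<Longrightarrow> c i \<ge> 0"
  shows "tail_at_most M (\<lambda>\<omega>. \<Sum>i\<in>I. X i \<omega>) (\<Sum>i\<in>I. c i)"
  using assms(2-)
proof (induction I)
  case empty
  show ?case unfolding tail_at_most_def
  proof (intro allI impI)
    fix c' :: real assume "(\<Sum>i\<in>{}. c i) < c'"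
    then have "c' > 0" by simp
    show "\<forall>\<^sub>F x in at_top. measure M {\<omega>\<in>space M. x < (\<Sum>i\<in>{}. X i \<omega>)} \<le> c' * tail F x"
      using eventually_ge_at_top[of 0] by eventually_elim (use \<open>c' > 0\<close> tail_nonneg in auto)
  qed
next
  case (insert i I)
  interpret M: prob_space M by fact
  have "tail_at_most M (\<lambda>\<omega>. X i \<omega> + (\<Sum>i\<in>I. X i \<omega>)) (c i + (\<Sum>i\<in>I. c i))"
  proof (rule tail_at_most_add[OF assms(1)])
    show "M.indep_var borel (X i) borel (\<lambda>\<omega>. \<Sum>i\<in>I. X i \<omega>)"
      by (rule M.indep_vars_sum[OF insert(1,2,4)])
    show "tail_at_most M (\<lambda>\<omega>. \<Sum>i\<in>I. X i \<omega>) (\<Sum>i\<in>I. c i)"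
      using insert M.indep_vars_subset[OF insert(4), of I] by auto
  qed (use insert in \<open>auto intro!: sum_nonneg\<close>)
  then show ?case using insert by simp
qed

end

section \<open>Riemann sums of the tail and the integrated tail\<close>

locale subexponential_integrated =
  subexponential_distribution F + I: subexponential_distribution "integrated_tail F" for F
begin

abbreviation "H \<equiv> tail (integrated_tail F)"

text \<open>The integrated tail without truncation at 1: it is additive over adjacent intervals, and
  it agrees with \<open>H\<close> far out.\<close>

definition G :: "real \<Rightarrow> real" where "G x = (LINT u:{x..}|lborel. tail F u)"

lemma H_eq_min: "x \<ge> 0 \<Longrightarrow> H x = min 1 (G x)"
  unfolding G_def by (subst tail_def) (simp add: integrated_tail_def)

lemma tail_integrable: "x \<ge> 0 \<Longrightarrow> set_integrable lborel {x..} (tail F)"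
  \<comment> \<open>The integral of a non-integrable function is 0 by convention, so positivity of
    \<open>H\<close> yields integrability.\<close>
  using H_eq_min[of x] I.tail_pos[of x] not_integrable_integral_eq
  by (force simp: G_def set_integrable_def set_lebesgue_integral_def)

lemma G_nonneg: "0 \<le> G x"
  unfolding G_def set_lebesgue_integral_def by (intro integral_nonneg_AE) (auto simp: tail_nonneg)

lemma H_eq_G: "\<forall>\<^sub>F x in at_top. H x = G x"
  using I.tail_less[of 1, simplified] eventually_ge_at_top[of 0]
  by eventually_elim (auto simp: H_eq_min)

lemma G_diff:
  assumes "0 \<le> x" "x \<le> y"
  shows "(y - x) * tail F y \<le> G x - G y" "G x - G y \<le> (y - x) * tail F x"
proof -
  have i: "set_integrable lborel {x..<y} (tail F)" "set_integrable lborel {y..} (tail F)"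
    by (rule set_integrable_subset[OF tail_integrable[OF assms(1)]]; use assms in auto)+
  have "{x..} = {x..<y} \<union> {y..}" using assms by auto
  then have "G x = (LINT u:{x..<y}|lborel. tail F u) + G y"
    unfolding G_def by (simp, subst set_integral_Un[OF _ i]) auto
  moreover have "(LINT u:{x..<y}|lborel. tail F y) \<le> (LINT u:{x..<y}|lborel. tail F u)"
    by (rule set_integral_mono[OF _ i(1)])
       (use assms in \<open>auto simp: tail_antimono set_integrable_def\<close>)
  moreover have "(LINT u:{x..<y}|lborel. tail F u) \<le> (LINT u:{x..<y}|lborel. tail F x)"
    by (rule set_integral_mono[OF i(1)])
       (use assms in \<open>auto simp: tail_antimono set_integrable_def\<close>)
  moreover have "(LINT u:{x..<y}|lborel. c) = (y - x) * c" for c :: real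
    using assms by (simp add: set_lebesgue_integral_def)
  ultimately show "(y - x) * tail F y \<le> G x - G y" "G x - G y \<le> (y - x) * tail F x"
    by auto
qed

lemma G_at_top: "(G \<longlongrightarrow> 0) at_top"
  using I.tail_at_top H_eq_G by (rule Lim_transform_eventually)

text \<open>The integral over [x, x + y] is at least y * tail F (x + y) and at most
  \<open>H x\<close>. Long-tailedness moves the argument back to \<open>x\<close> at the cost of a
  factor 2, hence y = 2 / e.\<close>

lemma tail_le_H:
  assumes "e > 0"
  shows "\<forall>\<^sub>F x in at_top. tail F x \<le> e * H x"
proof -
  define y where "y = 2 / e"
  have "\<forall>\<^sub>F x in at_top. tail F ((x + y) - y) \<le> 2 * tail F (x + y)"
    by (rule eventually_at_top_shift[OF long_tailed]) simp
  then show ?thesis using H_eq_G eventually_ge_at_top[of 0]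
  proof eventually_elim
    case (elim x)
    have "y > 0" using assms by (simp add: y_def)
    then have "y * tail F (x + y) \<le> G x - G (x + y)" using G_diff(1)[of x "x + y"] elim by simp
    then have "y * tail F (x + y) \<le> H x" using G_nonneg[of "x + y"] elim by linarith
    then have "tail F (x + y) \<le> H x / y" using \<open>y > 0\<close> by (simp add: field_simps)
    then have "tail F x \<le> 2 * (H x / y)" using elim by simp
    then show ?case using assms by (simp add: y_def mult.commute)
  qed
qed

text \<open>Cells of length \<open>c\<close>: right endpoints give a lower Riemann sum, left
  endpoints in \<open>sum_tail_ge\<close> an upper one.\<close>

lemma sum_tail_le:
  assumes "0 \<le> x" "0 < c"
  shows "c * (\<Sum>n<m. tail F (x + real (Suc n) * c)) \<le> G x - G (x + real m * c)"
proof (induction m)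
  case (Suc m)
  have "c * tail F (x + real (Suc m) * c) \<le> G (x + real m * c) - G (x + real (Suc m) * c)"
    using G_diff(1)[of "x + real m * c" "x + real (Suc m) * c"] assms by (simp add: algebra_simps)
  then show ?case using Suc by (simp add: algebra_simps)
qed simp

lemma sum_tail_ge:
  assumes "0 \<le> x" "0 < c"
  shows "G x - G (x + real m * c) \<le> c * (\<Sum>n<m. tail F (x + real n * c))"
proof (induction m)
  case (Suc m)
  have "G (x + real m * c) - G (x + real (Suc m) * c) \<le> c * tail F (x + real m * c)"
    using G_diff(2)[of "x + real m * c" "x + real (Suc m) * c"] assms by (simp add: algebra_simps)
  then show ?case using Suc by (simp add: algebra_simps)
qed simp

text \<open>All terms but the one at n = 0 fit under the integral, which gives 1 / c; the remaining
  term is o(H) and takes up the surplus k - 1 / c. The threshold for \<open>x\<close> does not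
  depend on the index set.\<close>

lemma sum_tail_upper:
  assumes "c > 0" "1 / c < k"
  shows "\<forall>\<^sub>F x in at_top. \<forall>I. finite I \<longrightarrow> (\<Sum>n\<in>I. tail F (x + real n * c)) \<le> k * H x"
proof -
  have "k - 1 / c > 0" using assms by simp
  from tail_le_H[OF this] H_eq_G eventually_ge_at_top[of 0] show ?thesis
  proof eventually_elim
    case (elim x)
    show ?case
    proof (intro allI impI)
      fix I :: "nat set" assume I: "finite I"
      then obtain m where m: "I \<subseteq> {..<Suc m}"
        by (metis finite_nat_set_iff_bounded lessThan_iff less_Suc_eq subsetI)
      have "(\<Sum>n\<in>I. tail F (x + real n * c)) \<le> (\<Sum>n<Suc m. tail F (x + real n * c))"
        using m by (intro sum_mono2) (auto simp: tail_nonneg)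
      also have "\<dots> = tail F x + (\<Sum>n<m. tail F (x + real (Suc n) * c))"
        by (subst sum.lessThan_Suc_shift) simp
      also have "(\<Sum>n<m. tail F (x + real (Suc n) * c)) \<le> G x / c"
        using sum_tail_le[of x c m] G_nonneg[of "x + real m * c"] elim assms by (simp add: field_simps)
      also have "tail F x + G x / c \<le> (k - 1 / c) * H x + H x / c" using elim by simp
      also have "\<dots> = k * H x" by (simp add: field_simps)
      finally show "(\<Sum>n\<in>I. tail F (x + real n * c)) \<le> k * H x" by simp
    qed
  qed
qed

text \<open>By comparison with the integral the full sum is at least about H x / c, and
  \<open>admissible_threshold\<close> makes the terms up to \<open>N x\<close> negligible. A finite
  \<open>m\<close>, depending on \<open>x\<close>, already suffices, so that only finite families of
  events have to be handled later.\<close>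

lemma sum_tail_lower:
  assumes N: "admissible_threshold F N" and "c > 0" "k < 1 / c" "A \<ge> 0"
  shows "\<forall>\<^sub>F x in at_top. \<exists>m. k * H x \<le> (\<Sum>n\<in>{n. N x \<le> int n \<and> n < m}. tail F (x + A + real n * c))"
proof -
  \<comment> \<open>Three losses of e * H x each: the shift by \<open>A\<close>, the terms up to
    \<open>N x\<close>, and the cut at \<open>m\<close>.\<close>
  define e where "e = (1 / c - k) * c / 3"
  have e: "e > 0" using assms by (simp add: e_def)
  have "(\<lambda>x. \<Sum>n=0..N x. tail F (x + of_int n * c)) \<in> o(H)"
    using N by (auto simp: admissible_threshold_def)
  then have ev1: "\<forall>\<^sub>F x in at_top. norm (\<Sum>n=0..N x. tail F (x + of_int n * c)) \<le> (e / c) * norm (H x)"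
    using landau_o.smallD[of _ at_top H "e / c"] e assms by simp
  have ev2: "\<forall>\<^sub>F x in at_top. (1 - e) * H x \<le> G (x + A)"
  proof -
    have "\<forall>\<^sub>F x in at_top. H ((x + A) - A) \<le> (1 + e) * H (x + A)"
      by (rule eventually_at_top_shift[OF I.long_tailed]) (use e in simp)
    moreover have "\<forall>\<^sub>F x in at_top. H (x + A) = G (x + A)"
      by (rule eventually_at_top_shift[OF H_eq_G])
    ultimately show ?thesis
    proof eventually_elim
      case (elim x)
      have "(1 - e) * H x \<le> H (x + A)"
      proof (cases "e \<ge> 1")
        case True
        then show ?thesis using I.tail_nonneg[of x] I.tail_nonneg[of "x + A"]
          by (meson diff_le_0_iff_le mult_nonpos_nonneg order_trans)
      next
        case False
        then have "(1 - e) * H x \<le> (1 - e) * ((1 + e) * H (x + A))"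
          using elim by (intro mult_left_mono) auto
        also have "\<dots> = (1 - e^2) * H (x + A)" by (simp add: power2_eq_square algebra_simps)
        also have "\<dots> \<le> 1 * H (x + A)" by (intro mult_right_mono) (auto simp: I.tail_nonneg)
        finally show ?thesis by simp
      qed
      then show ?case using elim by simp
    qed
  qed
  show ?thesis using ev1 ev2 eventually_ge_at_top[of 0]
  proof eventually_elim
    case (elim x)
    have xA: "x + A \<ge> 0" using elim assms by simp
    have "filterlim (\<lambda>m. x + A + real m * c) at_top sequentially"
      using assms by (intro filterlim_tendsto_add_at_top[OF tendsto_const] filterlim_at_top_mult_tendsto_pos[OF tendsto_const] filterlim_real_sequentially)
    from filterlim_compose[OF G_at_top this]
    have "\<forall>\<^sub>F m in sequentially. G (x + A + real m * c) < e * H x"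
      using e I.tail_pos[of x] by (intro order_tendstoD(2)) auto
    then obtain m where m: "G (x + A + real m * c) < e * H x"
      by (auto simp: eventually_sequentially)
    have "(\<Sum>n<m. tail F (x + A + real n * c))
       \<le> (\<Sum>n\<in>{n. N x \<le> int n \<and> n < m} \<union> {n. int n \<le> N x}. tail F (x + A + real n * c))"
    proof (rule sum_mono2)
      have "{n. int n \<le> N x} \<subseteq> {..nat (N x)}" by auto
      then show "finite ({n. N x \<le> int n \<and> n < m} \<union> {n. int n \<le> N x})"
        using finite_subset by auto
    qed (auto simp: tail_nonneg)
    also have "\<dots> \<le> (\<Sum>n\<in>{n. N x \<le> int n \<and> n < m}. tail F (x + A + real n * c)) + (\<Sum>n\<in>{n. int n \<le> N x}. tail F (x + A + real n * c))"
    proof -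
      have "{n. int n \<le> N x} \<subseteq> {..nat (N x)}" by auto
      then have "finite {n. int n \<le> N x}" using finite_subset by auto
      then show ?thesis
        by (subst sum_Un) (auto simp: tail_nonneg intro!: sum_nonneg)
    qed
    also have "(\<Sum>n\<in>{n. int n \<le> N x}. tail F (x + A + real n * c)) \<le> (\<Sum>n\<in>{n. int n \<le> N x}. tail F (x + real n * c))"
      using assms by (intro sum_mono tail_antimono) simp
    also have "\<dots> = (\<Sum>n=0..N x. tail F (x + of_int n * c))"
      by (rule sum.reindex_bij_witness[of _ nat int]) auto
    also have "\<dots> \<le> e / c * H x" using elim(1) I.tail_nonneg[of x] by simp
    finally have "(\<Sum>n<m. tail F (x + A + real n * c)) \<le> (\<Sum>n\<in>{n. N x \<le> int n \<and> n < m}. tail F (x + A + real n * c)) + e / c * H x"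
      by simp
    then have "c * (\<Sum>n<m. tail F (x + A + real n * c)) \<le> c * (\<Sum>n\<in>{n. N x \<le> int n \<and> n < m}. tail F (x + A + real n * c)) + e * H x"
      using assms(2) by (simp add: field_simps)
    then have "(1 - e) * H x - e * H x - e * H x \<le> c * (\<Sum>n\<in>{n. N x \<le> int n \<and> n < m}. tail F (x + A + real n * c))"
      using sum_tail_ge[OF xA assms(2), of m] m elim(2) by linarith
    moreover have "(1 - e) * H x - e * H x - e * H x = c * (k * H x)"
      using assms(2) by (simp add: e_def field_simps)
    ultimately have "k * H x \<le> (\<Sum>n\<in>{n. N x \<le> int n \<and> n < m}. tail F (x + A + real n * c))"
      using assms(2) by (simp add: mult_le_cancel_left)
    then show ?case by blast
  qed
qed

end


section \<open>Random walks with negative drift\<close>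

definition walk :: "(nat \<Rightarrow> real) \<Rightarrow> nat \<Rightarrow> real" where
  "walk w n = (\<Sum>k<n. w k)"

lemma walk_0[simp]: "walk w 0 = 0"
  by (simp add: walk_def)

lemma walk_case_nat: "walk (case_nat s w) (Suc n) = s + walk w n"
  unfolding walk_def by (subst sum.lessThan_Suc_shift) simp

lemma walk_comb_seq: "walk (comb_seq k w w') (k + n) = walk w k + walk w' n"
  by (induction n) (simp_all add: walk_def comb_seq_def add.assoc)

lemma walk_comb_seq_le: "n \<le> k \<Longrightarrow> walk (comb_seq k w w') n = walk w n"
  by (simp add: walk_def comb_seq_def)

definition walk_max :: "(nat \<Rightarrow> real) \<Rightarrow> nat \<Rightarrow> real" where
  "walk_max w n = Max (walk w ` {..n})"

lemma walk_max_ge: "k \<le> n \<Longrightarrow> walk w k \<le> walk_max w n"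
  by (simp add: walk_max_def)

lemma walk_max_nonneg: "0 \<le> walk_max w n"
  using walk_max_ge[of 0 n w] by simp

lemma walk_max_mono: "n \<le> m \<Longrightarrow> walk_max w n \<le> walk_max w m"
  unfolding walk_max_def by (rule Max_mono) auto

lemma less_walk_max_iff: "x < walk_max w n \<longleftrightarrow> (\<exists>k\<le>n. x < walk w k)"
  unfolding walk_max_def by (subst Max_gr_iff) auto

text \<open>Lindley's recursion: a step placed in front of the walk is added to the later maximum,
  and the start at 0 remains a competitor.\<close>

lemma walk_max_case_nat: "walk_max (case_nat s w) (Suc n) = max 0 (s + walk_max w n)"
proof -
  have "walk (case_nat s w) ` {..Suc n} = insert 0 ((\<lambda>x. s + x) ` walk w ` {..n})"
    by (simp add: atMost_Suc_eq_insert_0 image_image walk_case_nat)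
  then show ?thesis
    unfolding walk_max_def
    by (simp add: mono_Max_commute[where f="\<lambda>x. s + x", symmetric] mono_def)
qed

section \<open>The canonical random walk and the finiteness of its supremum\<close>

locale random_walk = step: real_distribution D for D +
  assumes integrable_step: "integrable D (\<lambda>x. x)"
begin

sublocale sequence_space D
  by unfold_locales

lemma coord_measurable[measurable]: "(\<lambda>w. w (k::nat)) \<in> borel_measurable S"
proof -
  have "(\<lambda>w. w k) \<in> measurable S D" by simp
  then show ?thesis by (simp cong: measurable_cong_sets)
qed

lemma walk_measurable[measurable]: "(\<lambda>w. walk w n) \<in> borel_measurable S"
  unfolding walk_def by measurable

lemma walk_max_measurable[measurable]: "(\<lambda>w. walk_max w n) \<in> borel_measurable S"
  unfolding walk_max_def by (rule borel_measurable_Max) auto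

lemma coord_integrable: "integrable S (\<lambda>w. w k)"
proof -
  have "distr S D (\<lambda>w. w k) = D" by (rule PiM_component) simp
  then have "integrable (distr S D (\<lambda>w. w k)) (\<lambda>x. x)" using integrable_step by simp
  then show ?thesis by (subst (asm) integrable_distr_eq) (auto cong: measurable_cong_sets)
qed

lemma walk_max_integrable: "integrable S (\<lambda>w. walk_max w n)"
proof (rule Bochner_Integration.integrable_bound)
  show "integrable S (\<lambda>w. \<Sum>k<n. \<bar>w k\<bar>)"
    by (intro Bochner_Integration.integrable_sum integrable_abs coord_integrable)
  show "AE w in S. norm (walk_max w n) \<le> norm (\<Sum>k<n. \<bar>w k\<bar>)"
  proof (rule AE_I2)
    fix w :: "nat \<Rightarrow> real"
    have "walk w k \<le> (\<Sum>k<n. \<bar>w k\<bar>)" if "k \<le> n" for k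
    proof -
      have "walk w k \<le> (\<Sum>k<k. \<bar>w k\<bar>)" unfolding walk_def by (intro sum_mono) auto
      also have "\<dots> \<le> (\<Sum>k<n. \<bar>w k\<bar>)" using that by (intro sum_mono2) auto
      finally show ?thesis .
    qed
    then have "walk_max w n \<le> (\<Sum>k<n. \<bar>w k\<bar>)" unfolding walk_max_def by (subst Max_le_iff) auto
    then show "norm (walk_max w n) \<le> norm (\<Sum>k<n. \<bar>w k\<bar>)"
      using walk_max_nonneg[of w n] by (simp add: sum_nonneg)
  qed
qed measurable

text \<open>The event of an infinite supremum, with thresholds and times in the natural numbers so
  that it is measurable.\<close>

definition unbounded :: "(nat \<Rightarrow> real) set" where
  "unbounded = {w. \<forall>B::nat. \<exists>n. real B < walk_max w n}"

lemma unbounded_measurable[measurable]: "Measurable.pred S (\<lambda>w. w \<in> unbounded)"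
  unfolding unbounded_def by simp

lemma unbounded_dominated:
  fixes u v :: "nat \<Rightarrow> real" and c :: real
  assumes u: "u \<in> unbounded" and le: "\<And>n. \<exists>m. walk_max u n \<le> walk_max v m + c"
  shows "v \<in> unbounded"
  unfolding unbounded_def mem_Collect_eq
proof
  fix B :: nat
  obtain B' :: nat where B': "real B' > real B + c" using reals_Archimedean2 by blast
  obtain n where "real B' < walk_max u n" using u unfolding unbounded_def by blast
  moreover obtain m where "walk_max u n \<le> walk_max v m + c" using le by blast
  ultimately show "\<exists>n. real B < walk_max v n" using B' by (intro exI[of _ m]) linarith
qed

text \<open>A step in front moves all later partial sums by \<open>s\<close>, hence the maxima by a
  bounded amount: the event does not depend on the first step.\<close>

lemma unbounded_case_nat: "case_nat s w \<in> unbounded \<longleftrightarrow> w \<in> unbounded"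
proof
  assume "case_nat s w \<in> unbounded"
  then show "w \<in> unbounded"
  proof (rule unbounded_dominated)
    fix n
    have "walk_max (case_nat s w) n \<le> walk_max (case_nat s w) (Suc n)" by (rule walk_max_mono) simp
    then show "\<exists>m. walk_max (case_nat s w) n \<le> walk_max w m + \<bar>s\<bar>"
      using walk_max_nonneg[of w n] by (intro exI[of _ n]) (auto simp: walk_max_case_nat)
  qed
next
  assume "w \<in> unbounded"
  then show "case_nat s w \<in> unbounded"
  proof (rule unbounded_dominated)
    show "\<exists>m. walk_max w n \<le> walk_max (case_nat s w) m + \<bar>s\<bar>" for n
      by (intro exI[of _ "Suc n"]) (auto simp: walk_max_case_nat)
  qed
qed

abbreviation shift :: "(nat \<Rightarrow> real) \<Rightarrow> nat \<Rightarrow> real" where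
  "shift w \<equiv> (\<lambda>n. w (Suc n))"

lemma case_nat_shift: "case_nat (w 0) (shift w) = (w :: nat \<Rightarrow> real)"
  by (auto split: nat.split)

lemma walk_max_Suc: "walk_max w (Suc n) = max 0 (w 0 + walk_max (shift w) n)"
  using walk_max_case_nat[of "w 0" "shift w" n] by (simp add: case_nat_shift)

lemma unbounded_shift: "shift w \<in> unbounded \<longleftrightarrow> w \<in> unbounded"
  using unbounded_case_nat[of "w 0" "shift w"] by (simp add: case_nat_shift)

lemma shift_measurable: "shift \<in> measurable S S"
  by (rule measurable_PiM_single') auto

lemma walk_max_shift_measurable[measurable]: "(\<lambda>w. walk_max (shift w) n) \<in> borel_measurable S"
  by (rule measurable_compose[OF shift_measurable walk_max_measurable])

lemma distr_shift: "distr S S shift = S"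
  using distr_PiM_reindex[of UNIV "\<lambda>_. D" Suc UNIV]
  by (simp add: step.prob_space_axioms restrict_UNIV)

text \<open>
  On the shift-invariant event of an unbounded maximum, stationarity of the maximum forces
  the mean increment \<open>E max(\<xi>, -M\<^sub>n)\<close> to be nonnegative, and this tends to the mean of \<open>\<xi>\<close>.
\<close>

lemma prob_unbounded:
  assumes neg: "(\<integral>x. x \<partial>D) < 0"
  shows "measure S {w\<in>space S. w \<in> unbounded} = 0"
proof -
  interpret PP: pair_sigma_finite D S
    by unfold_locales
  define U where "U = (indicator {w\<in>space S. w \<in> unbounded} :: _ \<Rightarrow> real)"
  have sU: "{w\<in>space S. w \<in> unbounded} \<in> sets S" by measurable
  have [measurable]: "U \<in> borel_measurable S"
    unfolding U_def using sU by (rule borel_measurable_indicator)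
  have [measurable]: "(\<lambda>w. U (shift w)) \<in> borel_measurable S"
    by (rule measurable_compose[OF shift_measurable]) measurable
  have U01: "U w = 0 \<or> U w = 1" for w by (simp add: U_def indicator_def)
  have U0: "0 \<le> U w" "\<bar>x * U w\<bar> \<le> \<bar>x\<bar>" for x w using U01[of w] by auto
  have U_shift: "U (shift w) = U w" if "w \<in> space S" for w
    using that by (simp add: U_def indicator_def unbounded_shift space_PiM)
  let ?g = "\<lambda>n w. max (w 0) (- walk_max (shift w) n) * U w"
  \<comment> \<open>The maxima grow with \<open>n\<close>, and the shifted walk has the same law as
    the walk, also on the invariant event. By Lindley's recursion the difference of the two maxima
    is the truncated step \<open>?g n\<close>.\<close>
  have nn: "0 \<le> (\<integral>w. ?g n w \<partial>S)" for n
  proof -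
    have i: "integrable S (\<lambda>w. walk_max w n * U w)" for n
      by (rule Bochner_Integration.integrable_bound[OF walk_max_integrable[of n]]) (auto simp: U0)
    have i': "integrable S (\<lambda>w. walk_max (shift w) n * U (shift w))"
      using i[of n] by (subst (asm) distr_shift[symmetric], subst (asm) integrable_distr_eq[OF shift_measurable]) auto
    have "(\<integral>w. walk_max (shift w) n * U (shift w) \<partial>S) = (\<integral>w. walk_max w n * U w \<partial>S)"
      by (subst (2) distr_shift[symmetric], subst integral_distr[OF shift_measurable]) auto
    also have "\<dots> \<le> (\<integral>w. walk_max w (Suc n) * U w \<partial>S)"
      by (intro integral_mono i mult_right_mono walk_max_mono U0) simp
    finally have "0 \<le> (\<integral>w. walk_max w (Suc n) * U w - walk_max (shift w) n * U (shift w) \<partial>S)"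
      using i i' by (subst Bochner_Integration.integral_diff) auto
    also have "\<dots> = (\<integral>w. ?g n w \<partial>S)"
    proof (rule Bochner_Integration.integral_cong[OF refl])
      fix w assume w: "w \<in> space S"
      have "max 0 (w 0 + m) - m = max (w 0) (- m)" for m by (simp add: max_def)
      then show "walk_max w (Suc n) * U w - walk_max (shift w) n * U (shift w) = ?g n w"
        unfolding U_shift[OF w] walk_max_Suc by (simp only: left_diff_distrib[symmetric])
    qed
    finally show ?thesis .
  qed
  have "(\<lambda>n. \<integral>w. ?g n w \<partial>S) \<longlonglongrightarrow> (\<integral>w. w 0 * U w \<partial>S)"
  proof (rule integral_dominated_convergence[where w="\<lambda>w. \<bar>w 0\<bar>"])
    \<comment> \<open>On the event the maxima tend to infinity, so that the truncation eventually
      has no effect; off the event both sides vanish.\<close>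
    show "AE w in S. (\<lambda>n. ?g n w) \<longlonglongrightarrow> w 0 * U w"
    proof (rule AE_I2)
      fix w assume w: "w \<in> space S"
      show "(\<lambda>n. ?g n w) \<longlonglongrightarrow> w 0 * U w"
      proof (cases "w \<in> unbounded")
        case True
        then have "shift w \<in> unbounded" by (simp add: unbounded_shift)
        moreover obtain B :: nat where "real B > - w 0" using reals_Archimedean2 by blast
        ultimately obtain m where "- w 0 < walk_max (shift w) m"
          unfolding unbounded_def mem_Collect_eq by (meson order_less_trans)
        then have "- w 0 < walk_max (shift w) n" if "n \<ge> m" for n
          using walk_max_mono[OF that, of "shift w"] by linarith
        then have "\<forall>\<^sub>F n in sequentially. ?g n w = w 0 * U w"
          unfolding eventually_sequentially by (intro exI[of _ m] allI impI) (simp add: max_absorb1 less_imp_le minus_less_iff)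
        then show ?thesis by (rule tendsto_eventually)
      qed (simp add: U_def)
    qed
    show "AE w in S. norm (?g n w) \<le> \<bar>w 0\<bar>" for n
    proof (rule AE_I2)
      fix w
      have "\<bar>?g n w\<bar> \<le> \<bar>max (w 0) (- walk_max (shift w) n)\<bar>" by (rule U0)
      also have "\<dots> \<le> \<bar>w 0\<bar>" using walk_max_nonneg[of "shift w" n] by (auto simp: max_def)
      finally show "norm (?g n w) \<le> \<bar>w 0\<bar>" by simp
    qed
  qed (use coord_integrable[of 0] in auto)
  then have "0 \<le> (\<integral>w. w 0 * U w \<partial>S)"
    by (rule LIMSEQ_le_const) (use nn in auto)
  \<comment> \<open>The first step is independent of the shifted walk, and \<open>U\<close> depends
    only on the latter, so the mean factorizes. With a negative mean, nonnegativity of the product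
    leaves only probability 0.\<close>
  also have "(\<integral>w. w 0 * U w \<partial>S) = (\<integral>x. x \<partial>D) * measure S {w\<in>space S. w \<in> unbounded}"
  proof -
    have i: "integrable S (\<lambda>w. w 0 * U w)"
      by (rule Bochner_Integration.integrable_bound[OF coord_integrable[of 0]]) (auto simp: U0)
    have m: "(\<lambda>(s, w). case_nat s w) \<in> measurable (D \<Otimes>\<^sub>M S) S" by measurable
    have e: "case_nat (fst p) (snd p) 0 * U (case_nat (fst p) (snd p)) = fst p * U (snd p)"
      if "p \<in> space (D \<Otimes>\<^sub>M S)" for p
      using that by (simp add: U_def indicator_def unbounded_case_nat space_PiM)
    have i2: "integrable (D \<Otimes>\<^sub>M S) (\<lambda>p. fst p * U (snd p))"
    proof -
      have "integrable (distr (D \<Otimes>\<^sub>M S) S (\<lambda>(s, w). case_nat s w)) (\<lambda>w. w 0 * U w)"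
        unfolding PiM_iter by (rule i)
      then have "integrable (D \<Otimes>\<^sub>M S) (\<lambda>p. case_nat (fst p) (snd p) 0 * U (case_nat (fst p) (snd p)))"
        by (subst (asm) integrable_distr_eq[OF m]) (simp_all add: case_prod_beta')
      moreover have "integrable (D \<Otimes>\<^sub>M S) (\<lambda>p. case_nat (fst p) (snd p) 0 * U (case_nat (fst p) (snd p)))
          \<longleftrightarrow> integrable (D \<Otimes>\<^sub>M S) (\<lambda>p. fst p * U (snd p))"
        by (intro Bochner_Integration.integrable_cong refl e)
      ultimately show ?thesis by blast
    qed
    have "(\<integral>w. w 0 * U w \<partial>S) = (\<integral>w. w 0 * U w \<partial>distr (D \<Otimes>\<^sub>M S) S (\<lambda>(s, w). case_nat s w))"
      unfolding PiM_iter ..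
    also have "\<dots> = (\<integral>p. case_nat (fst p) (snd p) 0 * U (case_nat (fst p) (snd p)) \<partial>(D \<Otimes>\<^sub>M S))"
      by (subst integral_distr[OF m]) (simp_all add: case_prod_beta')
    also have "\<dots> = (\<integral>p. fst p * U (snd p) \<partial>(D \<Otimes>\<^sub>M S))"
      by (intro Bochner_Integration.integral_cong refl e)
    also have "\<dots> = (\<integral>s. (\<integral>w. s * U w \<partial>S) \<partial>D)"
      using PP.integral_fst'[OF i2] by simp
    also have "\<dots> = (\<integral>x. x \<partial>D) * (\<integral>w. U w \<partial>S)"
      by simp
    also have "(\<integral>w. U w \<partial>S) = measure S {w\<in>space S. w \<in> unbounded}"
      unfolding U_def using sU by (subst Bochner_Integration.integral_indicator) (auto simp: Int_absorb2 sets.sets_into_space)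
    finally show ?thesis .
  qed
  finally show ?thesis
    using neg by (smt (verit) measure_nonneg mult_neg_pos)
qed

text \<open>The events decrease to \<open>unbounded\<close> as the bound grows, and the measure is
  continuous from above.\<close>

lemma walk_bounded_above:
  assumes "(\<integral>x. x \<partial>D) < 0" "e > 0"
  shows "\<exists>B>0. measure S {w\<in>space S. \<exists>n. B < walk w n} < e"
proof -
  let ?A = "\<lambda>B::nat. {w\<in>space S. \<exists>n. real B < walk w n}"
  have "(\<lambda>B. measure S (?A B)) \<longlonglongrightarrow> measure S (\<Inter>B. ?A B)"
    by (rule P.finite_Lim_measure_decseq) (auto simp: decseq_def intro: le_less_trans[OF of_nat_mono])
  also have "(\<Inter>B. ?A B) = {w\<in>space S. w \<in> unbounded}"
    unfolding unbounded_def less_walk_max_iff by auto (meson order_refl)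
  also have "measure S \<dots> = 0" by (rule prob_unbounded) fact
  finally have "\<forall>\<^sub>F B in sequentially. measure S (?A B) < e"
    using assms(2) by (rule order_tendstoD)
  then have "\<forall>\<^sub>F B in sequentially. measure S (?A B) < e \<and> B > 0"
    using eventually_gt_at_top by (rule eventually_conj)
  then obtain B where "measure S (?A B) < e" "B > 0"
    by (auto simp: eventually_sequentially)
  then show ?thesis by (intro exI[of _ "real B"]) auto
qed

end

text \<open>Splitting a sequence into its first step and the rest, or into an initial and a final
  part, is done on the product space; any i.i.d. sequence is carried there by its law.\<close>

lemma (in prob_space) iid_random_walk:
  fixes X :: "nat \<Rightarrow> 'a \<Rightarrow> real"
  assumes indep: "indep_vars (\<lambda>_. borel) X UNIV"
    and ident: "\<And>n. distr M borel (X n) = distr M borel (X 0)"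
    and int: "integrable M (X 0)"
  shows "random_walk (distr M borel (X 0))"
    and "distr M (Pi\<^sub>M UNIV (\<lambda>_. distr M borel (X 0))) (\<lambda>\<omega> n. X n \<omega>) = Pi\<^sub>M UNIV (\<lambda>_. distr M borel (X 0))"
    and "(\<lambda>\<omega> n. X n \<omega>) \<in> measurable M (Pi\<^sub>M UNIV (\<lambda>_. distr M borel (X 0)))"
proof -
  have rv: "X n \<in> borel_measurable M" for n
    using indep by (auto simp: indep_vars_def)
  interpret D: prob_space "distr M borel (X 0)" by (rule prob_space_distr[OF rv])
  show "random_walk (distr M borel (X 0))"
  proof
    show "integrable (distr M borel (X 0)) (\<lambda>x. x)"
      using int rv by (subst integrable_distr_eq) auto
  qed simp_all
  have s: "sets (Pi\<^sub>M (UNIV :: nat set) (\<lambda>_. distr M borel (X 0))) = sets (Pi\<^sub>M (UNIV :: nat set) (\<lambda>_. borel :: real measure))"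
    by (rule sets_PiM_cong) auto
  have "distr M (Pi\<^sub>M UNIV (\<lambda>_. borel)) (\<lambda>\<omega>. \<lambda>n\<in>UNIV. X n \<omega>) = Pi\<^sub>M UNIV (\<lambda>n. distr M borel (X n))"
    using indep rv by (subst (asm) indep_vars_iff_distr_eq_PiM') auto
  then have "distr M (Pi\<^sub>M UNIV (\<lambda>_. borel)) (\<lambda>\<omega> n. X n \<omega>) = Pi\<^sub>M UNIV (\<lambda>_. distr M borel (X 0))"
    unfolding restrict_UNIV by (rule trans) (intro PiM_cong refl ident)
  then show "distr M (Pi\<^sub>M UNIV (\<lambda>_. distr M borel (X 0))) (\<lambda>\<omega> n. X n \<omega>) = Pi\<^sub>M UNIV (\<lambda>_. distr M borel (X 0))"
    by (simp add: s cong: distr_cong)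
  show "(\<lambda>\<omega> n. X n \<omega>) \<in> measurable M (Pi\<^sub>M UNIV (\<lambda>_. distr M borel (X 0)))"
    using rv by (intro measurable_PiM_single') (auto cong: measurable_cong_sets)
qed

lemma (in prob_space) iid_walk_bounded_above:
  fixes X :: "nat \<Rightarrow> 'a \<Rightarrow> real"
  assumes indep: "indep_vars (\<lambda>_. borel) X UNIV"
    and ident: "\<And>n. distr M borel (X n) = distr M borel (X 0)"
    and int: "integrable M (X 0)" and neg: "expectation (X 0) < 0" and "e > 0"
  shows "\<exists>B>0. prob {\<omega>\<in>space M. \<exists>n. B < (\<Sum>k<n. X k \<omega>)} < e"
proof -
  note iid = iid_random_walk[OF indep ident int]
  interpret W: random_walk "distr M borel (X 0)" by (rule iid(1))
  have rv: "X 0 \<in> borel_measurable M"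
    using indep by (auto simp: indep_vars_def)
  have "(\<integral>x. x \<partial>distr M borel (X 0)) < 0"
    using neg rv by (subst integral_distr) auto
  from W.walk_bounded_above[OF this \<open>e > 0\<close>] obtain B where B: "B > 0"
    "measure W.S {w\<in>space W.S. \<exists>n. B < walk w n} < e" by blast
  have "measure W.S {w\<in>space W.S. \<exists>n. B < walk w n}
      = measure (distr M W.S (\<lambda>\<omega> n. X n \<omega>)) {w\<in>space W.S. \<exists>n. B < walk w n}"
    by (simp add: iid(2))
  also have "\<dots> = prob ((\<lambda>\<omega> n. X n \<omega>) -` {w\<in>space W.S. \<exists>n. B < walk w n} \<inter> space M)"
    by (rule measure_distr[OF iid(3)]) measurable
  also have "(\<lambda>\<omega> n. X n \<omega>) -` {w\<in>space W.S. \<exists>n. B < walk w n} \<inter> space M = {\<omega>\<in>space M. \<exists>n. B < (\<Sum>k<n. X k \<omega>)}"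
    by (auto simp: walk_def space_PiM)
  finally show ?thesis using B by auto
qed

section \<open>First passage over a sloping line\<close>

context random_walk
begin

lemma coord_indep: "P.indep_vars (\<lambda>_. D) (\<lambda>k w. w k) (UNIV :: nat set)"
proof -
  have "distr S D (\<lambda>w. w k) = D" for k :: nat by (rule PiM_component) simp
  then show ?thesis
    by (subst P.indep_vars_iff_distr_eq_PiM') (auto simp: restrict_UNIV)
qed

text \<open>Adding \<open>m\<close> to every step turns the sloping line into a horizontal one and
  keeps the drift negative, so the bound for i.i.d. steps applies.\<close>

lemma walk_below_line:
  assumes "(\<integral>x. x \<partial>D) < - m" "e > 0"
  shows "\<exists>B>0. measure S {w\<in>space S. \<exists>n. B - real n * m < walk w n} < e"
proof -
  have c: "distr S D (\<lambda>w. w k) = D" for k :: nat by (rule PiM_component) simp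
  let ?X = "\<lambda>(k::nat) w. w k + m"
  have d: "distr S borel (?X k) = distr D borel (\<lambda>x. x + m)" for k
  proof -
    have "distr (distr S D (\<lambda>w. w k)) borel (\<lambda>x. x + m) = distr S borel ((\<lambda>x. x + m) \<circ> (\<lambda>w. w k))"
      by (rule distr_distr) (simp_all cong: measurable_cong_sets)
    then show ?thesis by (simp add: c comp_def)
  qed
  have "P.indep_vars (\<lambda>_. borel) ?X UNIV"
    by (rule P.indep_vars_compose2[OF coord_indep]) (simp cong: measurable_cong_sets)
  moreover have "P.expectation (?X 0) < 0"
  proof -
    have "P.expectation (?X 0) = P.expectation (\<lambda>w. w 0) + m"
      using coord_integrable[of 0] P.prob_space by (subst Bochner_Integration.integral_add) auto
    also have "P.expectation (\<lambda>w. w 0) = (\<integral>x. x \<partial>distr S D (\<lambda>w. w 0))"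
      by (rule integral_distr[symmetric]) (simp_all cong: measurable_cong_sets)
    finally show ?thesis using assms(1) unfolding c by simp
  qed
  ultimately obtain B where "B > 0" "measure S {w\<in>space S. \<exists>n. B < (\<Sum>k<n. ?X k w)} < e"
    using P.iid_walk_bounded_above[of ?X e] coord_integrable[of 0] d assms(2) by auto
  moreover have "(\<exists>n. B < (\<Sum>k<n. ?X k w)) \<longleftrightarrow> (\<exists>n. B - real n * m < walk w n)" for w
    by (simp add: walk_def sum.distrib less_diff_eq diff_less_eq)
  ultimately show ?thesis by auto
qed

text \<open>The first passage takes place at time \<open>Suc k\<close>. Time 0 is not tested, since
  the walk starts below the line when A > 0.\<close>

definition first_above :: "real \<Rightarrow> real \<Rightarrow> nat \<Rightarrow> (nat \<Rightarrow> real) \<Rightarrow> bool" where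
  "first_above A m k w \<longleftrightarrow> A - real (Suc k) * m < walk w (Suc k) \<and>
     (\<forall>j<k. walk w (Suc j) \<le> A - real (Suc j) * m)"

lemma first_above_measurable[measurable]: "Measurable.pred S (first_above A m k)"
  unfolding first_above_def by measurable

lemma first_above_unique: "first_above A m k w \<Longrightarrow> first_above A m l w \<Longrightarrow> k = l"
  unfolding first_above_def by (meson linorder_neqE_nat not_le)

text \<open>Passages at different times exclude each other, and each implies a crossing of the line.
  The bound holds for every level \<open>y\<close>, and serves where \<open>y\<close> is too small
  for a tail estimate.\<close>

lemma sum_first_above_le:
  "(\<Sum>k<n. measure S {w\<in>space S. first_above A m k w \<and> y < walk w (Suc k)})
     \<le> measure S {w\<in>space S. \<exists>n. A - real n * m < walk w n}"
proof -
  have "(\<Sum>k<n. measure S {w\<in>space S. first_above A m k w \<and> y < walk w (Suc k)})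
      = measure S (\<Union>k<n. {w\<in>space S. first_above A m k w \<and> y < walk w (Suc k)})"
    by (rule P.finite_measure_finite_Union[symmetric])
       (auto simp: disjoint_family_on_def dest: first_above_unique)
  also have "\<dots> \<le> measure S {w\<in>space S. \<exists>n. A - real n * m < walk w n}"
    by (rule P.finite_measure_mono) (auto simp: first_above_def intro!: exI[of _ "Suc _"])
  finally show ?thesis .
qed

text \<open>Just before the passage the walk is at most A - k * m, so the single step
  \<open>k\<close> has to carry it beyond \<open>y\<close>.\<close>

lemma first_above_jump:
  assumes "A > 0"
  shows "measure S {w\<in>space S. first_above A m k w \<and> y < walk w (Suc k)} \<le> measure D {y - A + real k * m<..}"
proof -
  have "measure S {w\<in>space S. first_above A m k w \<and> y < walk w (Suc k)}
      \<le> measure S ((\<lambda>w. w k) -` {y - A + real k * m<..} \<inter> space S)"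
  proof (rule P.finite_measure_mono)
    show "(\<lambda>w. w k) -` {y - A + real k * m<..} \<inter> space S \<in> sets S"
      by (rule measurable_sets[OF coord_measurable]) simp
    show "{w\<in>space S. first_above A m k w \<and> y < walk w (Suc k)} \<subseteq> (\<lambda>w. w k) -` {y - A + real k * m<..} \<inter> space S"
    proof
      fix w assume w': "w \<in> {w\<in>space S. first_above A m k w \<and> y < walk w (Suc k)}"
      then have w: "first_above A m k w" "y < walk w (Suc k)" by auto
      have "walk w k \<le> A - real k * m"
      proof (cases k)
        case 0
        then show ?thesis using assms by simp
      next
        case (Suc j)
        then show ?thesis using w(1) by (simp add: first_above_def)
      qed
      then have "y - A + real k * m < w k" using w(2) by (simp add: walk_def)
      then show "w \<in> (\<lambda>w. w k) -` {y - A + real k * m<..} \<inter> space S" using w' by simp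
    qed
  qed
  also have "\<dots> = measure (distr S borel (\<lambda>w. w k)) {y - A + real k * m<..}"
    by (subst measure_distr) auto
  also have "distr S borel (\<lambda>w. w k) = distr S D (\<lambda>w. w k)"
    by (rule distr_cong) auto
  also have "\<dots> = D" by (rule PiM_component) simp
  finally show ?thesis .
qed

text \<open>Decomposition at the first passage. For x \<ge> A a walk that exceeds \<open>x\<close>
  has passed the line; from then on it continues as an independent copy \<open>w'\<close>, whose
  maximum has to make up the difference.\<close>

lemma prob_walk_max_Suc_le:
  assumes "x \<ge> A" "A > 0" "m \<ge> 0"
  shows "emeasure S {w\<in>space S. x < walk_max w (Suc n)}
    \<le> (\<integral>\<^sup>+w'. (\<Sum>k\<le>n. emeasure S {w\<in>space S. first_above A m k w \<and> x - walk_max w' n < walk w (Suc k)}) \<partial>S)"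
proof -
  interpret PS: pair_sigma_finite S S by unfold_locales
  \<comment> \<open>The continuation may use \<open>n\<close> further steps, more than the n - k
    that remain. This only enlarges the event, and lets the one maximum \<open>walk_max w' n\<close>
    serve for all \<open>k\<close>.\<close>
  let ?E = "\<lambda>k. {w\<in>space S. first_above A m k w \<and> (\<exists>j\<le>n. x < walk w (Suc k + j))}"
  have "emeasure S {w\<in>space S. x < walk_max w (Suc n)} \<le> emeasure S (\<Union>k\<le>n. ?E k)"
  proof (rule emeasure_mono)
    show "{w\<in>space S. x < walk_max w (Suc n)} \<subseteq> (\<Union>k\<le>n. ?E k)"
    proof safe
      fix w assume w: "w \<in> space S" "x < walk_max w (Suc n)"
      then obtain j where j: "j \<le> Suc n" "x < walk w j" by (auto simp: less_walk_max_iff)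
      then obtain i where i: "j = Suc i" using assms by (cases j) auto
      have ex: "A - real (Suc i) * m < walk w (Suc i)"
        using j assms mult_nonneg_nonneg[of "real (Suc i)" m] unfolding i by linarith
      define k where "k = (LEAST k. A - real (Suc k) * m < walk w (Suc k))"
      have k: "A - real (Suc k) * m < walk w (Suc k)" unfolding k_def by (rule LeastI[of _ i]) (rule ex)
      have "\<not> A - real (Suc l) * m < walk w (Suc l)" if "l < k" for l
        using that unfolding k_def by (rule not_less_Least)
      then have f: "first_above A m k w" using k by (auto simp: first_above_def not_less)
      have "k \<le> i" unfolding k_def by (rule Least_le) (rule ex)
      then have "x < walk w (Suc k + (i - k))" "i - k \<le> n" "k \<le> n" using j i by auto
      then show "w \<in> (\<Union>k\<le>n. ?E k)" using w f by blast
    qed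
  qed measurable
  also have "\<dots> \<le> (\<Sum>k\<le>n. emeasure S (?E k))"
    by (rule emeasure_subadditive_finite) auto
  also have "\<dots> = (\<Sum>k\<le>n. (\<integral>\<^sup>+w'. emeasure S {w\<in>space S. first_above A m k w \<and> x - walk_max w' n < walk w (Suc k)} \<partial>S))"
  proof (rule sum.cong[OF refl])
    fix k
    \<comment> \<open>Splicing two independent sequences at \<open>Suc k\<close> reproduces the law;
      the passage depends on the first one, the later increments on the second.\<close>
    let ?c = "\<lambda>(w, w'). comb_seq (Suc k) w w'"
    have mc: "?c \<in> measurable (S \<Otimes>\<^sub>M S) S" by (rule measurable_comb_seq)
    have sE: "?E k \<in> sets S" by measurable
    have "emeasure S (?E k) = emeasure (S \<Otimes>\<^sub>M S) (?c -` ?E k \<inter> space (S \<Otimes>\<^sub>M S))"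
      using emeasure_distr[OF mc sE] unfolding PiM_comb_seq .
    also have "\<dots> = (\<integral>\<^sup>+w'. emeasure S ((\<lambda>w. (w, w')) -` (?c -` ?E k \<inter> space (S \<Otimes>\<^sub>M S))) \<partial>S)"
      by (rule PS.emeasure_pair_measure_alt2) (rule measurable_sets[OF mc sE])
    also have "\<dots> = (\<integral>\<^sup>+w'. emeasure S {w\<in>space S. first_above A m k w \<and> x - walk_max w' n < walk w (Suc k)} \<partial>S)"
    proof (intro nn_integral_cong arg_cong[where f="emeasure S"])
      fix w' assume w': "w' \<in> space S"
      have fa: "first_above A m k (comb_seq (Suc k) w w') \<longleftrightarrow> first_above A m k w" for w
        unfolding first_above_def by (simp add: walk_comb_seq_le)
      have wk: "(\<exists>j\<le>n. x < walk (comb_seq (Suc k) w w') (Suc k + j)) \<longleftrightarrow> x - walk_max w' n < walk w (Suc k)" for w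
        unfolding walk_comb_seq diff_less_eq using less_walk_max_iff[of "x - walk w (Suc k)" w' n]
        by (simp add: diff_less_eq add.commute)
      show "(\<lambda>w. (w, w')) -` (?c -` ?E k \<inter> space (S \<Otimes>\<^sub>M S))
          = {w\<in>space S. first_above A m k w \<and> x - walk_max w' n < walk w (Suc k)}"
        unfolding space_pair_measure
        using w' by (auto simp: fa wk[unfolded add_Suc] space_PiM)
    qed
    finally show "emeasure S (?E k) = (\<integral>\<^sup>+w'. emeasure S {w\<in>space S. first_above A m k w \<and> x - walk_max w' n < walk w (Suc k)} \<partial>S)" .
  qed
  also have "\<dots> = (\<integral>\<^sup>+w'. (\<Sum>k\<le>n. emeasure S {w\<in>space S. first_above A m k w \<and> x - walk_max w' n < walk w (Suc k)}) \<partial>S)"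
  proof (rule nn_integral_sum[symmetric])
    fix k
    have "mono (\<lambda>z. measure S {w\<in>space S. first_above A m k w \<and> x - z < walk w (Suc k)})"
    proof (rule monoI)
      fix z z' :: real assume "z \<le> z'"
      then show "measure S {w\<in>space S. first_above A m k w \<and> x - z < walk w (Suc k)}
           \<le> measure S {w\<in>space S. first_above A m k w \<and> x - z' < walk w (Suc k)}"
        by (intro P.finite_measure_mono) auto
    qed
    from borel_measurable_mono[OF this]
    show "(\<lambda>w'. emeasure S {w\<in>space S. first_above A m k w \<and> x - walk_max w' n < walk w (Suc k)}) \<in> borel_measurable S"
      unfolding P.emeasure_eq_measure
      by (intro measurable_compose[OF _ measurable_ennreal] measurable_compose[OF walk_max_measurable])
  qed
  finally show ?thesis .
qed

end


section \<open>Veraverbeke's upper bound for the supremum\<close>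

locale heavy_walk = random_walk D + T: subexponential_integrated F for D F +
  fixes c mu :: real
  assumes c_nonneg: "c \<ge> 0" and mu_pos: "mu > 0"
    and mean: "(\<integral>x. x \<partial>D) = - mu"
    and step_tail: "\<And>c'. c < c' \<Longrightarrow> \<forall>\<^sub>F x in at_top. measure D {x<..} \<le> c' * tail F x"
begin

definition p :: "nat \<Rightarrow> real \<Rightarrow> real" where
  "p n x = measure S {w\<in>space S. x < walk_max w n}"

lemma p_le_1: "p n x \<le> 1" unfolding p_def by (rule P.prob_le_1)

lemma p_0: "0 \<le> x \<Longrightarrow> p 0 x = 0"
  by (simp add: p_def walk_max_def)

text \<open>By \<open>first_above_jump\<close> the sum is at most a sum of step tails along a line
  of slope \<open>m\<close>, that is about (c / m) * H. The constants \<open>c1\<close> and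
  \<open>k1\<close> leave room for the step tail, the Riemann sum and the shift by
  \<open>A\<close>.\<close>

lemma jump_sum_upper:
  assumes "0 < m" "m < mu" "c / m < k" "A > 0"
  shows "\<forall>\<^sub>F y in at_top. \<forall>n. (\<Sum>k<n. measure S {w\<in>space S. first_above A m k w \<and> y < walk w (Suc k)}) \<le> k * T.H y"
proof -
  obtain c1 where c1: "c < c1" "c1 / m < k"
    using dense[of c "k * m"] assms by (auto simp: field_simps)
  then have c1p: "c1 > 0" using c_nonneg by simp
  obtain k1 where k1: "1 / m < k1" "k1 < k / c1"
    using dense[of "1 / m" "k / c1"] c1 c1p assms by (auto simp: field_simps)
  have "1 / m > 0" using assms(1) by simp
  then have k1p: "k1 > 0" using k1(1) by linarith
  have "k1 * c1 < k" using k1(2) c1p by (simp add: pos_less_divide_eq)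
  then have kk: "k / (c1 * k1) > 1" using k1p c1p by (simp add: pos_less_divide_eq mult.commute)
  obtain y0 where y0: "\<And>y. y \<ge> y0 \<Longrightarrow> measure D {y<..} \<le> c1 * tail F y"
    using step_tail[OF c1(1)] by (auto simp: eventually_at_top_linorder)
  have "\<forall>\<^sub>F y in at_top. \<forall>I. finite I \<longrightarrow> (\<Sum>n\<in>I. tail F (y + - A + real n * m)) \<le> k1 * T.H (y + - A)"
    by (rule eventually_at_top_shift[OF T.sum_tail_upper[OF assms(1) k1(1)]])
  then show ?thesis
    using T.I.long_tailed[OF kk, of A] eventually_ge_at_top[of "y0 + A"]
  proof eventually_elim
    case (elim y)
    show ?case
    proof
      fix n
      have "(\<Sum>k<n. measure S {w\<in>space S. first_above A m k w \<and> y < walk w (Suc k)}) \<le> (\<Sum>k<n. c1 * tail F (y + - A + real k * m))"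
      proof (rule sum_mono)
        fix k
        have "measure D {y - A + real k * m<..} \<le> c1 * tail F (y - A + real k * m)"
          using elim(3) assms(1) by (intro y0) (simp add: add_increasing2)
        then show "measure S {w\<in>space S. first_above A m k w \<and> y < walk w (Suc k)} \<le> c1 * tail F (y + - A + real k * m)"
          using first_above_jump[OF assms(4), of m k y] by simp
      qed
      also have "\<dots> = c1 * (\<Sum>k<n. tail F (y + - A + real k * m))" by (simp add: sum_distrib_left)
      also have "\<dots> \<le> c1 * (k1 * T.H (y - A))" using elim(1) c1p by (intro mult_left_mono) auto
      also have "\<dots> \<le> c1 * (k1 * (k / (c1 * k1) * T.H y))"
        using elim(2) c1p k1p by (intro mult_left_mono) auto
      also have "\<dots> = k * T.H y" using c1p k1p by simp
      finally show "(\<Sum>k<n. measure S {w\<in>space S. first_above A m k w \<and> y < walk w (Suc k)}) \<le> k * T.H y" .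
    qed
  qed
qed

text \<open>
  The walk is restarted when it first exceeds the line \<open>A - k m\<close>, whose slope is slightly flatter than
  the drift. This is unlikely for large \<open>A\<close>, and the walk restarts above \<open>y\<close> with probability at
  most \<open>k H(y)\<close>. Iterating the resulting renewal inequality replaces the use of ladder heights and
  does not need \<open>F\<close> to be strongly subexponential.
\<close>

lemma recursion:
  assumes "x \<ge> A" "A > 0" "m \<ge> 0" "e \<ge> 0" "k \<ge> 0"
    and e: "measure S {w\<in>space S. \<exists>n. A - real n * m < walk w n} \<le> e"
    and k: "\<And>y n. y \<ge> x1 \<Longrightarrow> (\<Sum>k<n. measure S {w\<in>space S. first_above A m k w \<and> y < walk w (Suc k)}) \<le> k * T.H y"
  shows "ennreal (p (Suc n) x) \<le> ennreal e * ennreal (p n (x - x1))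
     + ennreal k * (\<integral>\<^sup>+z\<in>{x1<..}. ennreal (p n (x - z)) \<partial>interval_measure (integrated_tail F))"
proof -
  let ?mu = "interval_measure (integrated_tail F)"
  interpret PS: pair_sigma_finite ?mu S by unfold_locales
  \<comment> \<open>If the level left after the continuation is at least \<open>x1\<close>, the
    bound k * H applies; otherwise only \<open>e\<close> is available. Here \<open>H\<close> is
    written as a mass of the integrated-tail measure, so that Fubini can be used below.\<close>
  let ?V = "\<lambda>w'. ennreal e * indicator {w'\<in>space S. x - x1 < walk_max w' n} w' + ennreal k * emeasure ?mu {max x1 (x - walk_max w' n)<..}"
  have "ennreal (p (Suc n) x) = emeasure S {w\<in>space S. x < walk_max w (Suc n)}"
    by (simp add: p_def P.emeasure_eq_measure)
  also have "\<dots> \<le> (\<integral>\<^sup>+w'. (\<Sum>k\<le>n. emeasure S {w\<in>space S. first_above A m k w \<and> x - walk_max w' n < walk w (Suc k)}) \<partial>S)"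
    by (rule prob_walk_max_Suc_le) fact+
  also have "\<dots> \<le> (\<integral>\<^sup>+w'. ?V w' \<partial>S)"
  proof (rule nn_integral_mono)
    fix w' assume w': "w' \<in> space S"
    have eq: "(\<Sum>k\<le>n. emeasure S {w\<in>space S. first_above A m k w \<and> x - walk_max w' n < walk w (Suc k)})
       = ennreal (\<Sum>k<Suc n. measure S {w\<in>space S. first_above A m k w \<and> x - walk_max w' n < walk w (Suc k)})"
      by (simp add: P.emeasure_eq_measure sum_ennreal lessThan_Suc_atMost del: sum.lessThan_Suc)
    show "(\<Sum>k\<le>n. emeasure S {w\<in>space S. first_above A m k w \<and> x - walk_max w' n < walk w (Suc k)}) \<le> ?V w'"
    proof (cases "x1 \<le> x - walk_max w' n")
      case True
      have "(\<Sum>k<Suc n. measure S {w\<in>space S. first_above A m k w \<and> x - walk_max w' n < walk w (Suc k)})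
         \<le> k * T.H (x - walk_max w' n)"
        by (rule k[OF True])
      then show ?thesis
        unfolding eq using True assms(5)
        by (simp add: T.I.emeasure_Ioi ennreal_mult'[symmetric] ennreal_leI max_absorb2 indicator_def del: sum.lessThan_Suc)
    next
      case False
      have "(\<Sum>k<Suc n. measure S {w\<in>space S. first_above A m k w \<and> x - walk_max w' n < walk w (Suc k)}) \<le> e"
        by (rule order_trans[OF sum_first_above_le e])
      then have "ennreal (\<Sum>k<Suc n. measure S {w\<in>space S. first_above A m k w \<and> x - walk_max w' n < walk w (Suc k)}) \<le> ennreal e"
        by (rule ennreal_leI)
      also have "\<dots> \<le> ?V w'" using False w' by (simp add: not_le less_diff_eq diff_less_eq add.commute)
      finally show ?thesis unfolding eq .
    qed
  qed
  also have "\<dots> = ennreal e * ennreal (p n (x - x1)) + ennreal k * (\<integral>\<^sup>+w'. emeasure ?mu {max x1 (x - walk_max w' n)<..} \<partial>S)"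
  proof -
    have [measurable]: "(\<lambda>w'. emeasure ?mu {max x1 (x - walk_max w' n)<..}) \<in> borel_measurable S"
      by (rule measurable_compose[OF walk_max_measurable T.I.both_large_measurable])
         (simp_all add: T.I.finite_measure_axioms)
    show ?thesis
      by (subst nn_integral_add) (auto simp: nn_integral_cmult p_def P.emeasure_eq_measure)
  qed
  \<comment> \<open>Both sides are the probability that a variable \<open>z\<close> with the
    integrated tail, independent of the walk, exceeds \<open>x1\<close> while z plus the maximum
    exceeds \<open>x\<close>. Conditioning on \<open>z\<close> brings back
    \<open>p n\<close>.\<close>
  also have "(\<integral>\<^sup>+w'. emeasure ?mu {max x1 (x - walk_max w' n)<..} \<partial>S)
     = (\<integral>\<^sup>+z\<in>{x1<..}. ennreal (p n (x - z)) \<partial>?mu)"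
  proof -
    let ?E = "{q \<in> space (?mu \<Otimes>\<^sub>M S). x1 < fst q \<and> x < fst q + walk_max (snd q) n}"
    have [measurable]: "(\<lambda>q. fst q) \<in> borel_measurable (?mu \<Otimes>\<^sub>M S)"
      using measurable_fst[of ?mu S] by (simp cong: measurable_cong_sets)
    have [measurable]: "(\<lambda>q. walk_max (snd q) n) \<in> borel_measurable (?mu \<Otimes>\<^sub>M S)"
      by (rule measurable_compose[OF measurable_snd walk_max_measurable])
    have E: "?E \<in> sets (?mu \<Otimes>\<^sub>M S)" by measurable
    have "(\<integral>\<^sup>+w'. emeasure ?mu {max x1 (x - walk_max w' n)<..} \<partial>S) = (\<integral>\<^sup>+w'. emeasure ?mu ((\<lambda>z. (z, w')) -` ?E) \<partial>S)"
      by (intro nn_integral_cong arg_cong[where f="emeasure ?mu"]) (auto simp: space_pair_measure)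
    also have "\<dots> = emeasure (?mu \<Otimes>\<^sub>M S) ?E"
      by (rule PS.emeasure_pair_measure_alt2[symmetric, OF E])
    also have "\<dots> = (\<integral>\<^sup>+z. emeasure S (Pair z -` ?E) \<partial>?mu)"
      by (rule P.emeasure_pair_measure_alt[OF E])
    also have "\<dots> = (\<integral>\<^sup>+z\<in>{x1<..}. ennreal (p n (x - z)) \<partial>?mu)"
    proof (rule nn_integral_cong)
      fix z
      have "Pair z -` ?E = (if x1 < z then {w\<in>space S. x - z < walk_max w n} else {})"
        by (auto simp: space_pair_measure)
      then show "emeasure S (Pair z -` ?E) = ennreal (p n (x - z)) * indicator {x1<..} z"
        by (simp add: p_def P.emeasure_eq_measure)
    qed
    finally show ?thesis .
  qed
  finally show ?thesis .
qed

text \<open>One pass through the recursion turns a factor \<open>b\<close> into r * b + k, uniformly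
  in \<open>n\<close>. The crossing probability and the convolution part contribute r / 2 each to
  the factor of \<open>b\<close>; values of \<open>z\<close> above x - B, where nothing is assumed
  about \<open>p\<close>, contribute k * H x.\<close>

lemma improvement:
  assumes "0 < m" "m < mu" "c / m < k" "0 < r"
  shows "\<forall>B\<ge>0. \<exists>x2\<ge>0. \<forall>n b x. b \<ge> 0 \<longrightarrow> x \<ge> x2 \<longrightarrow> (\<forall>z\<ge>B. p n z \<le> b * T.H z) \<longrightarrow> p (Suc n) x \<le> (r * b + k) * T.H x"
proof (intro allI impI)
  fix B :: real assume B0: "B \<ge> 0"
  let ?mu = "interval_measure (integrated_tail F)"
  have "0 \<le> c / m" using assms(1) c_nonneg by simp
  then have k0: "k > 0" using assms(3) by linarith
  obtain k1 where k1: "c / m < k1" "k1 < k" using dense[OF assms(3)] by blast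
  have k1p: "k1 > 0" using k1(1) \<open>0 \<le> c / m\<close> by linarith
  have "(\<integral>x. x \<partial>D) < - m" "r / 4 > 0" using mean assms by auto
  \<comment> \<open>r / 4 and not r / 2, because passing from x - x1 to \<open>x\<close> costs a
    factor 2.\<close>
  from walk_below_line[OF this] obtain A where A: "A > 0"
    "measure S {w\<in>space S. \<exists>n. A - real n * m < walk w n} < r / 4" by blast
  have "\<forall>\<^sub>F y in at_top. T.H y < r / (4 * k)" using assms k0 by (intro T.I.tail_less) simp
  from eventually_conj[OF eventually_conj[OF jump_sum_upper[OF assms(1,2) k1(1) A(1)] this] eventually_ge_at_top[of 0]]
  obtain x1 where x1: "\<And>y n. y \<ge> x1 \<Longrightarrow> (\<Sum>k<n. measure S {w\<in>space S. first_above A m k w \<and> y < walk w (Suc k)}) \<le> k1 * T.H y"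
     "T.H x1 < r / (4 * k)" "x1 \<ge> 0"
    unfolding eventually_at_top_linorder by blast
  \<comment> \<open>The gap between \<open>k1\<close> and \<open>k\<close> pays for the shift by
    \<open>B\<close>.\<close>
  have k_k1: "k / k1 > 1" using k1 k1p by simp
  have "r / (4 * k) > 0" using k0 assms by simp
  have "\<forall>\<^sub>F x in at_top. \<forall>n b. b \<ge> 0 \<longrightarrow> (\<forall>z\<ge>B. p n z \<le> b * T.H z) \<longrightarrow> p (Suc n) x \<le> (r * b + k) * T.H x"
    using T.I.integral_Ioc_upper[OF x1(3) \<open>r / (4 * k) > 0\<close>] T.I.long_tailed[OF k_k1, of B]
      T.I.long_tailed[of 2 x1, simplified] eventually_ge_at_top[of A] eventually_ge_at_top[of "x1 + B"]
  proof eventually_elim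
    case (elim x)
    show ?case
    proof (intro allI impI)
      fix n b assume b: "(b::real) \<ge> 0" and p: "\<forall>z\<ge>B. p n z \<le> b * T.H z"
      have "ennreal (p (Suc n) x) \<le> ennreal (r / 4) * ennreal (p n (x - x1))
         + ennreal k1 * (\<integral>\<^sup>+z\<in>{x1<..}. ennreal (p n (x - z)) \<partial>?mu)"
        using A assms k1p elim(4) x1(1) by (intro recursion[where A=A and m=m]) auto
      also have "ennreal (r / 4) * ennreal (p n (x - x1)) \<le> ennreal (r / 2 * b * T.H x)"
      proof -
        have "p n (x - x1) \<le> b * T.H (x - x1)" using p elim(5) by auto
        also have "\<dots> \<le> b * (2 * T.H x)" using b elim(3) by (intro mult_left_mono)
        finally have "r / 4 * p n (x - x1) \<le> r / 4 * (b * (2 * T.H x))" using assms by (intro mult_left_mono) auto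
        then have le: "r / 4 * p n (x - x1) \<le> r / 2 * b * T.H x" by (simp add: mult_ac)
        have "ennreal (r / 4) * ennreal (p n (x - x1)) = ennreal (r / 4 * p n (x - x1))"
          by (rule ennreal_mult'[symmetric]) (use assms in simp)
        then show ?thesis using ennreal_leI[OF le] by (simp only:)
      qed
      also have "(\<integral>\<^sup>+z\<in>{x1<..}. ennreal (p n (x - z)) \<partial>?mu) \<le> ennreal (T.H (x - B) + b * (r / (2 * k)) * T.H x)"
      proof -
        have "(\<integral>\<^sup>+z\<in>{x1<..}. ennreal (p n (x - z)) \<partial>?mu)
           \<le> (\<integral>\<^sup>+z. indicator {x - B<..} z + ennreal b * (ennreal (T.H (x - z)) * indicator {x1<..x} z) \<partial>?mu)"
        proof (rule nn_integral_mono)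
          fix z
          show "ennreal (p n (x - z)) * indicator {x1<..} z \<le> indicator {x - B<..} z + ennreal b * (ennreal (T.H (x - z)) * indicator {x1<..x} z)"
          proof (cases "x - B < z")
            case True
            have "ennreal (p n (x - z)) * indicator {x1<..} z \<le> 1"
              using p_le_1[of n "x - z"] by (simp add: indicator_def)
            also have "1 \<le> indicator {x - B<..} z + ennreal b * (ennreal (T.H (x - z)) * indicator {x1<..x} z)"
              using True by simp
            finally show ?thesis .
          next
            case False
            then have le: "p n (x - z) \<le> b * T.H (x - z)" using p by auto
            have "z \<le> x" using False B0 by simp
            then show ?thesis using le b False by (auto simp: indicator_def ennreal_mult'[symmetric] ennreal_leI)
          qed
        qed
        also have "\<dots> = ennreal (T.H (x - B)) + ennreal b * (\<integral>\<^sup>+z\<in>{x1<..x}. ennreal (T.H (x - z)) \<partial>?mu)"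
          by (subst nn_integral_add) (auto simp: nn_integral_cmult T.I.emeasure_Ioi)
        also have "\<dots> \<le> ennreal (T.H (x - B)) + ennreal b * ennreal ((r / (2 * k)) * T.H x)"
        proof (intro add_left_mono mult_left_mono order_trans[OF elim(1)] ennreal_leI mult_right_mono T.I.tail_nonneg)
          show "T.H x1 + r / (4 * k) \<le> r / (2 * k)" using x1(2) by simp
        qed simp
        also have "\<dots> = ennreal (T.H (x - B) + b * (r / (2 * k)) * T.H x)"
        proof -
          have "ennreal b * ennreal ((r / (2 * k)) * T.H x) = ennreal (b * ((r / (2 * k)) * T.H x))"
            by (rule ennreal_mult'[symmetric]) (rule b)
          then show ?thesis using b assms k0
            by (simp add: T.I.tail_nonneg mult.assoc del: times_divide_eq_left times_divide_eq_right)
        qed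
        finally show ?thesis .
      qed
      finally have "ennreal (p (Suc n) x) \<le> ennreal (r / 2 * b * T.H x) + ennreal k1 * ennreal (T.H (x - B) + b * (r / (2 * k)) * T.H x)"
        by (simp add: add_mono mult_left_mono)
      also have "\<dots> = ennreal (r / 2 * b * T.H x + k1 * (T.H (x - B) + b * (r / (2 * k)) * T.H x))"
        by (subst ennreal_mult'[symmetric], use k1p in simp, rule ennreal_plus[symmetric])
           (use b assms k0 k1p in \<open>auto simp: T.I.tail_nonneg\<close>)
      finally have "p (Suc n) x \<le> r / 2 * b * T.H x + k1 * (T.H (x - B) + b * (r / (2 * k)) * T.H x)"
        using b assms k0 k1p by (subst (asm) ennreal_le_iff) (auto simp: T.I.tail_nonneg)
      also have "k1 * (T.H (x - B) + b * (r / (2 * k)) * T.H x) \<le> k * T.H x + b * (r / 2) * T.H x"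
      proof -
        have "k1 * T.H (x - B) \<le> k1 * (k / k1 * T.H x)" using elim(2) k1p by (intro mult_left_mono) auto
        also have "\<dots> = k * T.H x" using k1p by simp
        finally have 1: "k1 * T.H (x - B) \<le> k * T.H x" .
        have "k1 * (b * (r / (2 * k)) * T.H x) \<le> k * (b * (r / (2 * k)) * T.H x)"
          using k1 b assms k0 by (intro mult_right_mono) (auto simp: T.I.tail_nonneg)
        also have "\<dots> = b * (r / 2) * T.H x" using k0 by simp
        finally show ?thesis using 1 unfolding distrib_left by linarith
      qed
      finally have "p (Suc n) x \<le> r / 2 * b * T.H x + (k * T.H x + b * (r / 2) * T.H x)" by simp
      also have "\<dots> = (r * b + k) * T.H x" by (simp add: field_simps)
      finally show "p (Suc n) x \<le> (r * b + k) * T.H x" .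
    qed
  qed
  then obtain x2 where "\<And>x. x \<ge> x2 \<Longrightarrow> \<forall>n b. b \<ge> 0 \<longrightarrow> (\<forall>z\<ge>B. p n z \<le> b * T.H z) \<longrightarrow> p (Suc n) x \<le> (r * b + k) * T.H x"
    unfolding eventually_at_top_linorder by blast
  then show "\<exists>x2\<ge>0. \<forall>n b x. b \<ge> 0 \<longrightarrow> x \<ge> x2 \<longrightarrow> (\<forall>z\<ge>B. p n z \<le> b * T.H z) \<longrightarrow> p (Suc n) x \<le> (r * b + k) * T.H x"
    by (intro exI[of _ "max x2 0"]) auto
qed

text \<open>With r = 1/2 the map of \<open>improvement\<close> does not lead above \<open>b\<close>
  if \<open>b\<close> is at least twice its constant term. Induction on \<open>n\<close> thus keeps
  one \<open>b\<close> for all x \<ge> x2; below \<open>x2\<close> the trivial bound 1 is covered by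
  b \<ge> 1 / H x2.\<close>

lemma a_priori_bound: "\<exists>b\<ge>0. \<forall>n. \<forall>x\<ge>0. p n x \<le> b * T.H x"
proof -
  have "0 < mu / 2" "mu / 2 < mu" "c / (mu / 2) < c / (mu / 2) + 1" "0 < (1/2 :: real)"
    using mu_pos by auto
  from improvement[OF this, rule_format, of 0] obtain x2 where x2: "x2 \<ge> 0"
    "\<And>n b x. b \<ge> 0 \<Longrightarrow> x \<ge> x2 \<Longrightarrow> (\<forall>z\<ge>0. p n z \<le> b * T.H z) \<Longrightarrow> p (Suc n) x \<le> (1/2 * b + (c / (mu / 2) + 1)) * T.H x"
    by blast
  define b where "b = max (1 / T.H x2) (2 * (c / (mu / 2) + 1))"
  have b0: "b \<ge> 0" using T.I.tail_pos[of x2] by (simp add: b_def le_max_iff_disj less_imp_le)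
  have "\<forall>x\<ge>0. p n x \<le> b * T.H x" for n
  proof (induction n)
    case 0
    then show ?case using b0 by (simp add: p_0 T.I.tail_nonneg)
  next
    case (Suc n)
    show ?case
    proof (intro allI impI)
      fix x :: real assume "x \<ge> 0"
      show "p (Suc n) x \<le> b * T.H x"
      proof (cases "x \<ge> x2")
        case True
        have "p (Suc n) x \<le> (1/2 * b + (c / (mu / 2) + 1)) * T.H x" by (rule x2(2)[OF b0 True Suc])
        also have "\<dots> \<le> b * T.H x"
        proof (intro mult_right_mono T.I.tail_nonneg)
          have "2 * (c / (mu / 2) + 1) \<le> b" unfolding b_def by (rule max.cobounded2)
          moreover have "2 * q \<le> b \<Longrightarrow> 1/2 * b + q \<le> b" for q by simp
          ultimately show "1/2 * b + (c / (mu / 2) + 1) \<le> b" by blast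
        qed
        finally show ?thesis .
      next
        case False
        have "p (Suc n) x \<le> 1" by (rule p_le_1)
        also have "1 = (1 / T.H x2) * T.H x2" using T.I.tail_pos[of x2] by simp
        also have "\<dots> \<le> b * T.H x"
          using False b0 T.I.tail_pos[of x2] by (intro mult_mono T.I.tail_antimono T.I.tail_nonneg) (auto simp: b_def)
        finally show ?thesis .
      qed
    qed
  qed
  then show ?thesis using b0 by blast
qed

text \<open>Iterating b -> r * b + k from the a priori bound converges to the fixed point k / (1 -
  r). The starting point \<open>B\<close> moves with each iteration but never depends on
  \<open>n\<close>.\<close>

lemma eventually_p_le:
  assumes "0 < m" "m < mu" "c / m < k" "0 < r" "r < 1" "k / (1 - r) < k'"
  shows "\<exists>B. \<forall>n. \<forall>x\<ge>B. p n x \<le> k' * T.H x"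
proof -
  obtain b0 where b0: "b0 \<ge> 0" "\<And>n x. x \<ge> 0 \<Longrightarrow> p n x \<le> b0 * T.H x"
    using a_priori_bound by blast
  have "0 \<le> c / m" using assms(1) c_nonneg by simp
  then have k0: "k > 0" using assms(3) by linarith
  have it: "\<exists>B\<ge>0. \<forall>n. \<forall>x\<ge>B. p n x \<le> (r ^ i * b0 + k / (1 - r)) * T.H x" for i
  proof (induction i)
    case 0
    have "p n x \<le> (r ^ 0 * b0 + k / (1 - r)) * T.H x" if "x \<ge> 0" for n x
    proof -
      have "p n x \<le> b0 * T.H x" by (rule b0(2)[OF that])
      also have "\<dots> \<le> (r ^ 0 * b0 + k / (1 - r)) * T.H x"
        using k0 assms by (intro mult_right_mono T.I.tail_nonneg) auto
      finally show ?thesis .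
    qed
    then show ?case by blast
  next
    case (Suc i)
    let ?b = "r ^ i * b0 + k / (1 - r)"
    obtain B where B: "B \<ge> 0" "\<And>n. \<forall>x\<ge>B. p n x \<le> ?b * T.H x" using Suc by blast
    obtain x2 where x2: "x2 \<ge> 0"
      "\<And>n b x. b \<ge> 0 \<Longrightarrow> x \<ge> x2 \<Longrightarrow> (\<forall>z\<ge>B. p n z \<le> b * T.H z) \<Longrightarrow> p (Suc n) x \<le> (r * b + k) * T.H x"
      using improvement[OF assms(1-4), rule_format, OF B(1)] by blast
    have b: "?b \<ge> 0" using b0(1) k0 assms by simp
    have eq: "r * ?b + k = r ^ Suc i * b0 + k / (1 - r)"
      using assms by (simp add: field_simps)
    have "p n x \<le> (r ^ Suc i * b0 + k / (1 - r)) * T.H x" if "x \<ge> x2" for n x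
    proof (cases n)
      case 0
      then show ?thesis using that x2(1) b k0 assms b0(1) by (simp add: p_0 T.I.tail_nonneg)
    next
      case (Suc n')
      then show ?thesis using x2(2)[OF b that B(2)[of n']] by (simp only: eq)
    qed
    then show ?case using x2(1) by (intro exI[of _ x2]) simp
  qed
  have "(\<lambda>i. r ^ i * b0 + k / (1 - r)) \<longlonglongrightarrow> 0 * b0 + k / (1 - r)"
    using assms by (intro tendsto_intros LIMSEQ_power_zero) auto
  then have "\<forall>\<^sub>F i in sequentially. r ^ i * b0 + k / (1 - r) < k'"
    using assms(6) by (intro order_tendstoD(2)) auto
  then obtain i where i: "r ^ i * b0 + k / (1 - r) < k'" by (auto simp: eventually_sequentially)
  obtain B where B: "\<And>n x. x \<ge> B \<Longrightarrow> p n x \<le> (r ^ i * b0 + k / (1 - r)) * T.H x" using it by blast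
  have "p n x \<le> k' * T.H x" if "x \<ge> B" for n x
    using B[OF that, of n] mult_right_mono[OF less_imp_le[OF i] T.I.tail_nonneg[of x]] by linarith
  then show ?thesis by blast
qed

text \<open>The slope \<open>m\<close> can be taken close enough to \<open>mu\<close>, and the bound
  on finite maxima is uniform in \<open>n\<close>, so it passes to the supremum.\<close>

theorem walk_supremum_tail:
  assumes "c / mu < k"
  shows "\<forall>\<^sub>F x in at_top. measure S {w\<in>space S. \<exists>n. x < walk w n} \<le> k * T.H x"
proof -
  have "0 \<le> c / mu" using mu_pos c_nonneg by simp
  then have k0: "k > 0" using assms by linarith
  have "((\<lambda>m. c / m) \<longlongrightarrow> c / mu) (at_left mu)"
    using mu_pos by (intro tendsto_intros) auto
  then have "\<forall>\<^sub>F m in at_left mu. c / m < k" using assms by (rule order_tendstoD)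
  moreover have "\<forall>\<^sub>F m in at_left mu. 0 < m \<and> m < mu"
    using mu_pos eventually_at_left_field by blast
  ultimately have "\<forall>\<^sub>F m in at_left mu. c / m < k \<and> 0 < m \<and> m < mu" by (rule eventually_conj)
  then obtain m where m: "0 < m" "m < mu" "c / m < k"
    using eventually_happens'[OF trivial_limit_at_left_real] by blast
  obtain k1 where k1: "c / m < k1" "k1 < k" using dense[OF m(3)] by blast
  \<comment> \<open>Small enough for k1 / (1 - r) < k: the product k * (1 - r) is the midpoint of
    \<open>k\<close> and \<open>k1\<close>.\<close>
  define r where "r = (1 - k1 / k) / 2"
  have "0 \<le> c / m" using m c_nonneg by simp
  then have k1p: "k1 > 0" using k1(1) by linarith
  have r: "0 < r" "r < 1" using k1 k1p k0 by (auto simp: r_def field_simps)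
  have "k1 / (1 - r) < k"
  proof -
    have "1 - r = (1 + k1 / k) / 2" by (simp add: r_def field_simps)
    then have "k * (1 - r) = (k + k1) / 2" using k0 by (simp add: field_simps)
    then have "k1 < k * (1 - r)" using k1 by simp
    then show ?thesis using r by (simp add: field_simps)
  qed
  from eventually_p_le[OF m(1,2) k1(1) r this] obtain B where B: "\<And>n x. x \<ge> B \<Longrightarrow> p n x \<le> k * T.H x" by blast
  have "measure S {w\<in>space S. \<exists>n. x < walk w n} \<le> k * T.H x" if "x \<ge> B" for x
  proof -
    have "(\<lambda>n. measure S {w\<in>space S. x < walk_max w n}) \<longlonglongrightarrow> measure S (\<Union>n. {w\<in>space S. x < walk_max w n})"
      by (rule P.finite_Lim_measure_incseq)
         (auto simp: incseq_def intro: less_le_trans[OF _ walk_max_mono])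
    moreover have "(\<Union>n. {w\<in>space S. x < walk_max w n}) = {w\<in>space S. \<exists>n. x < walk w n}"
      unfolding less_walk_max_iff by auto
    ultimately have "(\<lambda>n. p n x) \<longlonglongrightarrow> measure S {w\<in>space S. \<exists>n. x < walk w n}" by (simp add: p_def)
    then show ?thesis
      by (rule LIMSEQ_le_const2) (use B[OF that] in blast)
  qed
  then show ?thesis by (auto simp: eventually_at_top_linorder)
qed

end

lemma (in prob_space) iid_walk_supremum_tail:
  fixes X :: "nat \<Rightarrow> 'a \<Rightarrow> real"
  assumes F: "subexponential_integrated F"
    and indep: "indep_vars (\<lambda>_. borel) X UNIV"
    and ident: "\<And>n. distr M borel (X n) = distr M borel (X 0)"
    and int: "integrable M (X 0)" and neg: "expectation (X 0) = - mu" "mu > 0"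
    and tail: "\<And>c'. c < c' \<Longrightarrow> \<forall>\<^sub>F x in at_top. prob {\<omega>\<in>space M. x < X 0 \<omega>} \<le> c' * tail F x"
    and c: "c \<ge> 0" "c / mu < k"
  shows "\<forall>\<^sub>F x in at_top. prob {\<omega>\<in>space M. \<exists>n. x < (\<Sum>k<n. X k \<omega>)} \<le> k * tail (integrated_tail F) x"
proof -
  have rv: "X 0 \<in> borel_measurable M"
    using indep by (auto simp: indep_vars_def)
  note iid = iid_random_walk[OF indep ident int]
  interpret W: random_walk "distr M borel (X 0)" by (rule iid(1))
  interpret T: subexponential_integrated F by (rule F)
  have D: "measure (distr M borel (X 0)) {x<..} = prob {\<omega>\<in>space M. x < X 0 \<omega>}" for x
    using rv by (subst measure_distr) (auto intro!: arg_cong[where f=prob])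
  interpret W: heavy_walk "distr M borel (X 0)" F c mu
  proof
    show "(\<integral>x. x \<partial>distr M borel (X 0)) = - mu"
      using neg rv by (subst integral_distr) auto
    show "\<forall>\<^sub>F x in at_top. measure (distr M borel (X 0)) {x<..} \<le> c' * tail F x" if "c < c'" for c'
      unfolding D by (rule tail[OF that])
  qed (use neg c in auto)
  have "measure W.S {w\<in>space W.S. \<exists>n. x < walk w n} = prob {\<omega>\<in>space M. \<exists>n. x < (\<Sum>k<n. X k \<omega>)}" for x
  proof -
    have "measure W.S {w\<in>space W.S. \<exists>n. x < walk w n}
        = measure (distr M W.S (\<lambda>\<omega> n. X n \<omega>)) {w\<in>space W.S. \<exists>n. x < walk w n}"
      by (simp add: iid(2))
    also have "\<dots> = prob ((\<lambda>\<omega> n. X n \<omega>) -` {w\<in>space W.S. \<exists>n. x < walk w n} \<inter> space M)"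
      by (rule measure_distr[OF iid(3)]) measurable
    also have "(\<lambda>\<omega> n. X n \<omega>) -` {w\<in>space W.S. \<exists>n. x < walk w n} \<inter> space M = {\<omega>\<in>space M. \<exists>n. x < (\<Sum>k<n. X k \<omega>)}"
      by (auto simp: walk_def space_PiM)
    finally show ?thesis .
  qed
  then show ?thesis using W.walk_supremum_tail[OF c(2)] by simp
qed


section \<open>Monotone-separable networks\<close>

lemma last_activity_cong:
  assumes "\<And>k. m \<le> k \<Longrightarrow> k \<le> n \<Longrightarrow> T k = T' k" "\<And>k. m \<le> k \<Longrightarrow> k \<le> n \<Longrightarrow> z k = z' k"
  shows "last_activity f m n T z = last_activity f m n T' z'"
proof -
  have 1: "(\<lambda>i\<in>{..<nat (n - m + 1)}. T (m + int i)) = (\<lambda>i\<in>{..<nat (n - m + 1)}. T' (m + int i))"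
    by (intro restrict_ext assms(1)) auto
  have 2: "(\<lambda>i\<in>{..<nat (n - m + 1)}. z (m + int i)) = (\<lambda>i\<in>{..<nat (n - m + 1)}. z' (m + int i))"
    by (intro restrict_ext assms(2)) auto
  show ?thesis unfolding last_activity_def Let_def 1 2 ..
qed

lemma mono_degenerate: "mono degenerate_input"
  by (auto simp: mono_def degenerate_input_def)

locale network =
  fixes f :: "nat \<Rightarrow> (nat \<Rightarrow> real) \<times> (nat \<Rightarrow> 'k) \<Rightarrow> real" and z :: "int \<Rightarrow> 'k"
  assumes ms: "monotone_separable f z"
begin

abbreviation "la m n T \<equiv> last_activity f m n T z"
abbreviation "dater m n T \<equiv> maximal_dater f m n T z"
abbreviation "dater0 m n \<equiv> maximal_dater f m n degenerate_input z"

lemma la_homogeneous: "mono T \<Longrightarrow> m \<le> n \<Longrightarrow> la m n (\<lambda>k. c + T k) = la m n T + c"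
  using ms unfolding monotone_separable_def by blast

lemma la_separable: "mono T \<Longrightarrow> m \<le> l \<Longrightarrow> l < n \<Longrightarrow> la m l T \<le> T (l + 1) \<Longrightarrow> la m n T = la (l + 1) n T"
  using ms unfolding monotone_separable_def by blast

lemma la_mono:
  assumes "mono T" "mono T'" "m \<le> n" "\<And>k. m \<le> k \<Longrightarrow> k \<le> n \<Longrightarrow> T k \<le> T' k"
  shows "la m n T \<le> la m n T'"
proof -
  \<comment> \<open>Clamping the indices to the window does not change the activity, and makes a
    comparison on the window a comparison at all indices, as external monotonicity requires.\<close>
  let ?c = "\<lambda>k. max m (min n k)"
  have "la m n T = la m n (\<lambda>k. T (?c k))" "la m n T' = la m n (\<lambda>k. T' (?c k))"
    by (auto intro!: last_activity_cong)
  moreover have "mono (\<lambda>k. T (?c k))" "mono (\<lambda>k. T' (?c k))"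
    using assms(1,2) by (auto intro!: monoI elim!: monoD)
  moreover have "T (?c k) \<le> T' (?c k)" for k using assms(3) by (intro assms(4)) auto
  ultimately show ?thesis
    using ms assms(3) unfolding monotone_separable_def by auto
qed

lemma dater_nonneg: "mono T \<Longrightarrow> m \<le> n \<Longrightarrow> 0 \<le> dater m n T"
  using ms unfolding monotone_separable_def maximal_dater_def by fastforce

lemma la_const: "m \<le> n \<Longrightarrow> la m n (\<lambda>k. c) = dater0 m n + c"
  using la_homogeneous[OF mono_degenerate, of m n c]
  by (simp add: maximal_dater_def degenerate_input_def)

text \<open>All arrivals of the window are delayed to the last one; for the converse bound in
  \<open>dater_ge_degenerate\<close> they are advanced to the first one.\<close>

lemma dater_le_degenerate: "mono T \<Longrightarrow> m \<le> n \<Longrightarrow> dater m n T \<le> dater0 m n"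
  using la_mono[of T "\<lambda>_. T n" m n] la_const[of m n "T n"]
  by (auto simp: maximal_dater_def[of f m n T] mono_def)

lemma dater_ge_degenerate: "mono T \<Longrightarrow> m \<le> n \<Longrightarrow> dater0 m n - (T n - T m) \<le> dater m n T"
  using la_mono[of "\<lambda>_. T m" T m n] la_const[of m n "T m"]
  by (auto simp: maximal_dater_def[of f m n T] mono_def)

lemma dater_single: "mono T \<Longrightarrow> dater n n T = dater0 n n"
  using dater_ge_degenerate[of T n n] dater_le_degenerate[of T n n] by simp

text \<open>Delaying the arrivals after \<open>l\<close> by the time \<open>c\<close> that the
  network still needs lets it empty before they come, so that separability applies. The delay cannot
  decrease the activity, and homogeneity returns it as the additional term.\<close>

lemma la_step:
  assumes "mono T" "m \<le> l" "l < n"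
  shows "la m n T \<le> la (l + 1) n T + max 0 (la m l T - T (l + 1))"
proof -
  define c where "c = max 0 (la m l T - T (l + 1))"
  define T' where "T' = (\<lambda>k. if k \<le> l then T k else c + T k)"
  have c: "c \<ge> 0" by (simp add: c_def)
  have T': "mono T'"
  proof (rule monoI)
    fix x y :: int assume "x \<le> y"
    then show "T' x \<le> T' y" using monoD[OF assms(1), of x y] c by (auto simp: T'_def)
  qed
  have "la m n T \<le> la m n T'"
    using assms c by (intro la_mono T') (auto simp: T'_def)
  also have "\<dots> = la (l + 1) n T'"
  proof (rule la_separable[OF T' assms(2,3)])
    have "la m l T' = la m l T" by (rule last_activity_cong) (auto simp: T'_def)
    then show "la m l T' \<le> T' (l + 1)" by (auto simp: T'_def c_def)
  qed
  also have "\<dots> = la (l + 1) n (\<lambda>k. c + T k)"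
    by (rule last_activity_cong) (auto simp: T'_def)
  also have "\<dots> = la (l + 1) n T + c" using assms by (intro la_homogeneous) auto
  finally show ?thesis by (simp add: c_def)
qed

text \<open>The arrivals before \<open>l\<close> are moved into the past until they have been
  completed by \<open>T l\<close>. By separability they are then without effect, and advancing
  arrivals cannot increase the activity.\<close>

lemma dater_mono_start:
  assumes "mono T" "m \<le> l" "l \<le> n"
  shows "dater l n T \<le> dater m n T"
proof (cases "m = l")
  case False
  then have ml: "m \<le> l - 1" using assms by simp
  define c where "c = max 0 (la m (l - 1) T - T l)"
  define T' where "T' = (\<lambda>k. if k \<le> l - 1 then - c + T k else T k)"
  have c: "c \<ge> 0" by (simp add: c_def)
  have T': "mono T'"
  proof (rule monoI)
    fix x y :: int assume "x \<le> y"
    then show "T' x \<le> T' y" using monoD[OF assms(1), of x y] c by (auto simp: T'_def)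
  qed
  have "la l n T = la (l - 1 + 1) n T'"
    unfolding diff_add_cancel by (rule last_activity_cong) (auto simp: T'_def)
  also have "\<dots> = la m n T'"
  proof (rule la_separable[symmetric, OF T' ml])
    have "la m (l - 1) T' = la m (l - 1) (\<lambda>k. - c + T k)" by (rule last_activity_cong) (auto simp: T'_def)
    also have "\<dots> = la m (l - 1) T - c" using la_homogeneous[OF assms(1) ml, of "- c"] by simp
    finally show "la m (l - 1) T' \<le> T' (l - 1 + 1)" by (auto simp: T'_def c_def)
  qed (use assms in auto)
  also have "\<dots> \<le> la m n T"
    using assms c by (intro la_mono T') (auto simp: T'_def)
  finally show ?thesis by (simp add: maximal_dater_def)
qed simp

lemma dater0_subadditive:
  assumes "m \<le> l" "l < n"
  shows "dater0 m n \<le> dater0 m l + dater0 (l + 1) n"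
  using la_step[OF mono_degenerate assms] dater_nonneg[OF mono_degenerate assms(1)]
  by (simp add: maximal_dater_def degenerate_input_def)

lemma dater0_le_sum:
  assumes "m \<le> n"
  shows "dater0 m n \<le> (\<Sum>k\<in>{m..n}. dater0 k k)"
  using assms
proof (induction n rule: int_ge_induct)
  case (step n)
  have "dater0 m (n + 1) \<le> dater0 m n + dater0 (n + 1) (n + 1)"
    using dater0_subadditive[of m n "n + 1"] step by simp
  moreover have "{m..n + 1} = insert (n + 1) {m..n}" using step by auto
  ultimately show ?case using step by simp
qed simp

lemma stationary_dater_SUP:
  assumes "mono T"
  shows "stationary_dater f T z = (SUP n::nat. ereal (dater (- int n) 0 T))"
  unfolding stationary_dater_def
  by (intro limI LIMSEQ_SUP) (auto simp: incseq_def intro!: dater_mono_start assms)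

lemma less_stationary_dater_iff:
  assumes "mono T"
  shows "ereal x < stationary_dater f T z \<longleftrightarrow> (\<exists>n::nat. x < dater (- int n) 0 T)"
  unfolding stationary_dater_SUP[OF assms] less_SUP_iff by simp

text \<open>Delaying every arrival of a block to the end of its block only increases the daters.\<close>

lemma dater_blocks_le:
  fixes L k :: nat
  assumes T: "mono T" and L: "L \<ge> 1" and k: "k \<ge> 1"
  defines "s \<equiv> \<lambda>l::nat. dater0 (- (int l + 1) * int L + 1) (- int l * int L)"
    and "u \<equiv> \<lambda>l::nat. T (- (int l - 1) * int L) - T (- int l * int L)"
  shows "\<exists>q. dater (- int k * int L + 1) 0 T \<le> s 0 + (\<Sum>l\<in>{0<..q}. s l - u l)"
proof -
  \<comment> \<open>The index is rounded up to a multiple of \<open>L\<close>, the end of its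
    block.\<close>
  define T' where "T' = (\<lambda>j. T (- ((- j) div int L) * int L))"
  have L0: "int L > 0" using L by simp
  have T'_ge: "T j \<le> T' j" for j
    unfolding T'_def
  proof (rule monoD[OF T])
    have "(- j) div int L * int L \<le> - j"
      using L0 by (metis div_mult_mod_eq le_add_same_cancel1 pos_mod_sign)
    then show "j \<le> - ((- j) div int L) * int L" by simp
  qed
  have T': "mono T'"
    unfolding T'_def
  proof (rule monoI, rule monoD[OF T])
    fix x y :: int assume "x \<le> y"
    then have "(- y) div int L \<le> (- x) div int L" using L0 by (intro zdiv_mono1) auto
    then show "- ((- x) div int L) * int L \<le> - ((- y) div int L) * int L"
      using L0 by simp
  qed
  have T'_end: "T' (- int i * int L) = T (- int i * int L)" for i :: nat
    using L0 by (simp add: T'_def)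
  have T'_start: "T' (- (int i + 1) * int L + 1) = T (- int i * int L)" for i :: nat
  proof -
    have "(- (- (int i + 1) * int L + 1)) = (int L - 1) + int i * int L" by (simp add: algebra_simps)
    then have "(- (- (int i + 1) * int L + 1)) div int L = int i"
      using L0 by (simp only: div_mult_self1) simp
    then show ?thesis unfolding T'_def by simp
  qed
  define W where "W = (\<lambda>i::nat. dater (- int k * int L + 1) (- int i * int L) T')"
  have le: "- int k * int L + 1 \<le> - int i * int L" if "i < k" for i :: nat
  proof -
    have "int L * 1 \<le> int L * (int k - int i)" using that L0 by (intro mult_left_mono) auto
    then show ?thesis using L0 by (simp add: algebra_simps)
  qed
  have s_ge: "dater (- (int i + 1) * int L + 1) (- int i * int L) T' \<le> s i" for i :: nat
    unfolding s_def using L0 by (intro dater_le_degenerate T') (simp add: algebra_simps)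
  \<comment> \<open>Lindley's recursion over blocks: under \<open>T'\<close> all arrivals of block
    \<open>i\<close> come together, so what earlier blocks leave over is \<open>W (Suc i)\<close>
    less the gap \<open>u (Suc i)\<close>, if positive.\<close>
  have W_step: "W i \<le> s i + max 0 (W (Suc i) - u (Suc i))" if "Suc i < k" for i
  proof -
    have 1: "- int k * int L + 1 \<le> - (int i + 1) * int L" using le[OF that] by (simp add: algebra_simps)
    have 2: "- (int i + 1) * int L < - int i * int L" using L0 by (simp add: algebra_simps)
    note la_step[OF T' 1 2]
    then show ?thesis
      using s_ge[of i] T'_start[of i] T'_end[of i] T'_end[of "Suc i"]
      unfolding W_def u_def maximal_dater_def by (simp add: algebra_simps)
  qed
  have "\<exists>q. W i \<le> s i + (\<Sum>l\<in>{i<..q}. s l - u l)" if "i < k" for i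
  proof -
    have "i \<le> k - 1" using that by simp
    then show ?thesis
    proof (induction rule: inc_induct)
      case base
      have "int (k - 1) + 1 = int k" using k by simp
      then have "W (k - 1) \<le> s (k - 1)" using s_ge[of "k - 1"] unfolding W_def by simp
      then show ?case by (intro exI[of _ "k - 1"]) simp
    next
      case (step i)
      then obtain q where q: "W (Suc i) \<le> s (Suc i) + (\<Sum>l\<in>{Suc i<..q}. s l - u l)" by blast
      have st: "W i \<le> s i + max 0 (W (Suc i) - u (Suc i))" using step by (intro W_step) auto
      show ?case
      proof (cases "W (Suc i) \<le> u (Suc i)")
        case True
        then show ?thesis using st by (intro exI[of _ i]) simp
      next
        case False
        \<comment> \<open>\<open>q\<close> may be smaller than \<open>Suc i\<close>, with an empty
          sum; the maximum makes room for the term at \<open>Suc i\<close>.\<close>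
        define q' where "q' = max q (Suc i)"
        have "{Suc i<..q'} = {Suc i<..q}" by (auto simp: q'_def)
        moreover have "{i<..q'} = insert (Suc i) {Suc i<..q'}" by (auto simp: q'_def)
        ultimately have "(\<Sum>l\<in>{i<..q'}. s l - u l) = s (Suc i) - u (Suc i) + (\<Sum>l\<in>{Suc i<..q}. s l - u l)"
          by simp
        then show ?thesis using False st q by (intro exI[of _ q']) simp
      qed
    qed
  qed
  then obtain q where q: "W 0 \<le> s 0 + (\<Sum>l\<in>{0<..q}. s l - u l)" using k by auto
  have "dater (- int k * int L + 1) 0 T \<le> W 0"
    using la_mono[OF T T' _ T'_ge, of "- int k * int L + 1" 0] le[of 0] k T'_end[of 0]
    by (simp add: W_def maximal_dater_def)
  then show ?thesis using q by (intro exI[of _ q]) simp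
qed

text \<open>A window reaching back to -n is enlarged to \<open>Suc n\<close> whole blocks, which
  cannot lower the dater.\<close>

lemma stationary_dater_blocks:
  fixes L :: nat
  assumes T: "mono T" and L: "L \<ge> 1" and x: "ereal x < stationary_dater f T z"
  shows "\<exists>q. x < dater0 (- int L + 1) 0
    + (\<Sum>l\<in>{0<..q}. dater0 (- (int l + 1) * int L + 1) (- int l * int L)
        - (T (- (int l - 1) * int L) - T (- int l * int L)))"
proof -
  obtain n :: nat where n: "x < dater (- int n) 0 T"
    using x unfolding less_stationary_dater_iff[OF T] by blast
  have le: "int n + 1 \<le> (int n + 1) * int L" using L by (simp add: mult_le_cancel_left1)
  then have a: "dater (- int n) 0 T \<le> dater (- int (Suc n) * int L + 1) 0 T"
    using L by (intro dater_mono_start T) (auto simp: algebra_simps)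
  obtain q where q: "dater (- int (Suc n) * int L + 1) 0 T
      \<le> dater0 (- (int 0 + 1) * int L + 1) (- int 0 * int L)
        + (\<Sum>l\<in>{0<..q}. dater0 (- (int l + 1) * int L + 1) (- int l * int L)
          - (T (- (int l - 1) * int L) - T (- int l * int L)))"
    using dater_blocks_le[OF T L, of "Suc n"] by auto
  have e: "- (int 0 + 1) * int L + 1 = - int L + 1" "- int 0 * int L = 0" by simp_all
  show ?thesis
    by (rule exI[of _ q], rule less_le_trans[OF n order_trans[OF a q[unfolded e]]])
qed

end

text \<open>With all arrivals at 0 the dater is a function of the marks in the window alone.
  Indexing these from 0 removes the position of the window, so that stationarity of the marks
  applies.\<close>

definition window_dater :: "(nat \<Rightarrow> (nat \<Rightarrow> real) \<times> (nat \<Rightarrow> 'k) \<Rightarrow> real) \<Rightarrow> nat \<Rightarrow> (nat \<Rightarrow> 'k) \<Rightarrow> real" where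
  "window_dater f l v = f l (\<lambda>i\<in>{..<l}. 0, v)"

lemma dater0_eq_window:
  "maximal_dater f m n degenerate_input z = window_dater f (nat (n - m + 1)) (\<lambda>i\<in>{..<nat (n - m + 1)}. z (m + int i))"
  by (simp add: maximal_dater_def last_activity_def window_dater_def degenerate_input_def Let_def)

lemma window_dater_measurable:
  assumes "measurable_network S f" "l \<ge> 1"
  shows "window_dater f l \<in> borel_measurable (Pi\<^sub>M {..<l} (\<lambda>_. S))"
proof -
  have "f l \<in> (Pi\<^sub>M {..<l} (\<lambda>_. borel) \<Otimes>\<^sub>M Pi\<^sub>M {..<l} (\<lambda>_. S)) \<rightarrow>\<^sub>M borel"
    using assms by (simp add: measurable_network_def)
  moreover have "(\<lambda>v. (\<lambda>i\<in>{..<l}. 0::real, v)) \<in> Pi\<^sub>M {..<l} (\<lambda>_. S) \<rightarrow>\<^sub>M Pi\<^sub>M {..<l} (\<lambda>_. borel) \<Otimes>\<^sub>M Pi\<^sub>M {..<l} (\<lambda>_. S)"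
    by (intro measurable_Pair measurable_ident measurable_restrict) auto
  ultimately show ?thesis unfolding window_dater_def by (rule measurable_compose[rotated])
qed

lemma last_activity_measurable:
  assumes "measurable_network S f" "m \<le> n" "\<And>k. T k \<in> borel_measurable M" "\<And>k. \<zeta> k \<in> M \<rightarrow>\<^sub>M S"
  shows "(\<lambda>\<omega>. last_activity f m n (\<lambda>k. T k \<omega>) (\<lambda>k. \<zeta> k \<omega>)) \<in> borel_measurable M"
proof -
  let ?l = "nat (n - m + 1)"
  have "f ?l \<in> (Pi\<^sub>M {..<?l} (\<lambda>_. borel) \<Otimes>\<^sub>M Pi\<^sub>M {..<?l} (\<lambda>_. S)) \<rightarrow>\<^sub>M borel"
    using assms by (simp add: measurable_network_def)
  moreover have "(\<lambda>\<omega>. (\<lambda>i\<in>{..<?l}. T (m + int i) \<omega>, \<lambda>i\<in>{..<?l}. \<zeta> (m + int i) \<omega>))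
      \<in> M \<rightarrow>\<^sub>M Pi\<^sub>M {..<?l} (\<lambda>_. borel) \<Otimes>\<^sub>M Pi\<^sub>M {..<?l} (\<lambda>_. S)"
    by (intro measurable_Pair measurable_restrict assms)
  ultimately show ?thesis unfolding last_activity_def Let_def by (rule measurable_compose[rotated])
qed

text \<open>Fekete's lemma by division with remainder. The hypotheses concern positive arguments
  only, because the dater of an empty window has no meaning.\<close>

lemma fekete_subadditive:
  fixes e :: "nat \<Rightarrow> real"
  assumes sub: "\<And>m n. m \<ge> 1 \<Longrightarrow> n \<ge> 1 \<Longrightarrow> e (m + n) \<le> e m + e n" and nonneg: "\<And>n. n \<ge> 1 \<Longrightarrow> 0 \<le> e n"
  shows "(\<lambda>n. e n / real n) \<longlonglongrightarrow> (INF n\<in>{1..}. e n / real n)"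
    and "\<And>n. n \<ge> 1 \<Longrightarrow> (INF n\<in>{1..}. e n / real n) \<le> e n / real n"
proof -
  let ?b = "INF n\<in>{1..}. e n / real n"
  have bdd: "bdd_below ((\<lambda>n. e n / real n) ` {1..})"
    by (rule bdd_belowI2[of _ 0]) (use nonneg in auto)
  show le: "?b \<le> e n / real n" if "n \<ge> 1" for n
    using that by (intro cINF_lower bdd) auto
  have mult: "e (q * p) \<le> real q * e p" if "q \<ge> 1" "p \<ge> 1" for q p
    using that(1)
  proof (induction q rule: nat_induct_at_least)
    case (Suc q)
    have "e (Suc q * p) \<le> e p + e (q * p)" using sub[of p "q * p"] that Suc by simp
    then show ?case using Suc by (simp add: algebra_simps)
  qed simp
  have lin: "e n \<le> real n * e 1" if "n \<ge> 1" for n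
    using mult[of n 1] that by simp
  show "(\<lambda>n. e n / real n) \<longlonglongrightarrow> ?b"
  proof (rule LIMSEQ_I)
    fix r :: real assume r: "0 < r"
    have "\<exists>p\<in>{1..}. e p / real p < ?b + r / 2"
      using r by (subst cINF_less_iff[symmetric, OF _ bdd]) auto
    then obtain p :: nat where p: "p \<ge> 1" "e p / real p < ?b + r / 2" by auto
    \<comment> \<open>Beyond \<open>n0\<close> the remainder, at most p * e 1, falls below r / 2
      after division by \<open>n\<close>.\<close>
    obtain n0 :: nat where n0: "real n0 > 2 * real p * e 1 / r" using reals_Archimedean2 by blast
    have "norm (e n / real n - ?b) < r" if n: "n \<ge> max (Suc n0) p" for n
    proof -
      have n1: "n \<ge> 1" "n \<ge> p" "real n > 2 * real p * e 1 / r" using n n0 by auto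
      have q: "n div p \<ge> 1" using n1 p by (simp add: Suc_le_eq div_greater_zero_iff)
      have "e n \<le> real (n div p) * e p + real p * e 1"
      proof (cases "n mod p = 0")
        case True
        then have "n = n div p * p" by (simp add: mod_0_imp_dvd)
        then have "e n \<le> real (n div p) * e p" using mult[OF q p(1)] by metis
        then show ?thesis using nonneg[of 1] by (simp add: add_increasing2)
      next
        case False
        have "e n \<le> e (n div p * p) + e (n mod p)"
          using sub[of "n div p * p" "n mod p"] q p(1) False by (simp add: Suc_le_eq)
        moreover have "e (n mod p) \<le> real p * e 1"
        proof -
          have "e (n mod p) \<le> real (n mod p) * e 1" using False by (intro lin) simp
          also have "\<dots> \<le> real p * e 1" using nonneg[of 1] p(1) by (intro mult_right_mono) (auto simp: less_imp_le)
          finally show ?thesis .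
        qed
        ultimately show ?thesis using mult[OF q p(1)] by simp
      qed
      also have "real (n div p) * e p \<le> real n * (e p / real p)"
      proof -
        have "real (n div p) \<le> real n / real p"
          using p(1) of_nat_mono[OF div_times_less_eq_dividend[of n p], where 'a=real]
          by (simp add: pos_le_divide_eq)
        then have "real (n div p) * e p \<le> real n / real p * e p" using nonneg[OF p(1)] by (rule mult_right_mono)
        then show ?thesis by simp
      qed
      finally have "e n \<le> real n * (e p / real p) + real p * e 1" by simp
      then have "e n / real n \<le> e p / real p + real p * e 1 / real n"
        using n1 by (simp add: field_simps)
      moreover have "real p * e 1 / real n < r / 2" using n1 r by (simp add: field_simps)
      ultimately have "e n / real n < ?b + r" using p(2) by linarith
      then show ?thesis using le[OF n1(1)] by simp
    qed
    then show "\<exists>no. \<forall>n\<ge>no. norm (e n / real n - ?b) < r" by blast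
  qed
qed


section \<open>Independent sequences and blocks\<close>

context prob_space
begin

lemma indep_rvsD:
  assumes "indep_rvs M S X S' X'" "A \<in> sets S" "B \<in> sets S'"
  shows "prob ((X -` A \<inter> space M) \<inter> (X' -` B \<inter> space M)) = prob (X -` A \<inter> space M) * prob (X' -` B \<inter> space M)"
proof (rule indep_setD)
  show "indep_set (sets (vimage_algebra (space M) X S)) (sets (vimage_algebra (space M) X' S'))"
    using assms by (simp add: indep_rvs_def)
  show "X -` A \<inter> space M \<in> sets (vimage_algebra (space M) X S)"
    "X' -` B \<inter> space M \<in> sets (vimage_algebra (space M) X' S')"
    using assms by (auto intro: in_vimage_algebra)
qed

lemma indep_rvs_prob_and:
  assumes "indep_rvs M S X S' X'" "Measurable.pred S P" "Measurable.pred S' Q"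
  shows "prob {\<omega>\<in>space M. P (X \<omega>) \<and> Q (X' \<omega>)} = prob {\<omega>\<in>space M. P (X \<omega>)} * prob {\<omega>\<in>space M. Q (X' \<omega>)}"
proof -
  have X: "X \<in> M \<rightarrow>\<^sub>M S" "X' \<in> M \<rightarrow>\<^sub>M S'" using assms by (auto simp: indep_rvs_def)
  have 1: "X -` {s\<in>space S. P s} \<inter> space M = {\<omega>\<in>space M. P (X \<omega>)}"
    using measurable_space[OF X(1)] by auto
  have 2: "X' -` {s\<in>space S'. Q s} \<inter> space M = {\<omega>\<in>space M. Q (X' \<omega>)}"
    using measurable_space[OF X(2)] by auto
  have "{\<omega>\<in>space M. P (X \<omega>) \<and> Q (X' \<omega>)} = {\<omega>\<in>space M. P (X \<omega>)} \<inter> {\<omega>\<in>space M. Q (X' \<omega>)}" by auto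
  then show ?thesis
    using indep_rvsD[OF assms(1), of "{s\<in>space S. P s}" "{s\<in>space S'. Q s}"] assms(2,3)
    unfolding 1 2 by (simp add: pred_def)
qed

lemma iid_sequence_measurable: "iid_sequence M S X \<Longrightarrow> X n \<in> M \<rightarrow>\<^sub>M S"
  by (simp add: iid_sequence_def indep_vars_def)

lemma iid_sequence_distr: "iid_sequence M S X \<Longrightarrow> distr M S (X n) = distr M S (X m)"
  by (metis iid_sequence_def)

lemma iid_sequence_prob:
  assumes "iid_sequence M S X" "Measurable.pred S P"
  shows "prob {\<omega>\<in>space M. P (X n \<omega>)} = prob {\<omega>\<in>space M. P (X m \<omega>)}"
proof -
  have "prob {\<omega>\<in>space M. P (X n \<omega>)} = measure (distr M S (X n)) {s\<in>space S. P s}" for n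
    using iid_sequence_measurable[OF assms(1), of n] assms(2)
    by (subst measure_distr) (auto simp: pred_def intro!: arg_cong[where f=prob] dest: measurable_space)
  then show ?thesis using iid_sequence_distr[OF assms(1), of n m] by metis
qed

lemma distr_iid_sequence:
  assumes "iid_sequence M S X"
  shows "distr M (Pi\<^sub>M UNIV (\<lambda>_. S)) (\<lambda>\<omega> n. X n \<omega>) = Pi\<^sub>M UNIV (\<lambda>_. distr M S (X 0))"
proof -
  have "distr M (Pi\<^sub>M UNIV (\<lambda>_. S)) (\<lambda>\<omega>. \<lambda>n\<in>UNIV. X n \<omega>) = Pi\<^sub>M UNIV (\<lambda>n. distr M S (X n))"
    using assms iid_sequence_measurable[OF assms]
    by (subst (asm) iid_sequence_def, subst (asm) indep_vars_iff_distr_eq_PiM') auto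
  then show ?thesis
    unfolding restrict_UNIV by (rule trans) (intro PiM_cong refl iid_sequence_distr[OF assms])
qed

lemma distr_iid_window:
  fixes g :: "'i \<Rightarrow> int"
  assumes "iid_sequence M S X" "inj_on g I"
  shows "distr M (Pi\<^sub>M I (\<lambda>_. S)) (\<lambda>\<omega>. \<lambda>i\<in>I. X (g i) \<omega>) = Pi\<^sub>M I (\<lambda>_. distr M S (X 0))"
proof -
  let ?D = "distr M S (X 0)"
  note X = iid_sequence_measurable[OF assms(1)]
  have ps: "prob_space ?D" by (rule prob_space_distr[OF X])
  have m: "(\<lambda>w. \<lambda>i\<in>I. w (g i)) \<in> Pi\<^sub>M UNIV (\<lambda>_. S) \<rightarrow>\<^sub>M Pi\<^sub>M I (\<lambda>_. S)"
    by (intro measurable_restrict) auto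
  have m': "(\<lambda>\<omega> n. X n \<omega>) \<in> M \<rightarrow>\<^sub>M Pi\<^sub>M UNIV (\<lambda>_. S)"
    by (rule measurable_PiM_single') (auto simp: X measurable_space[OF X])
  have "distr M (Pi\<^sub>M I (\<lambda>_. S)) (\<lambda>\<omega>. \<lambda>i\<in>I. X (g i) \<omega>)
      = distr (distr M (Pi\<^sub>M UNIV (\<lambda>_. S)) (\<lambda>\<omega> n. X n \<omega>)) (Pi\<^sub>M I (\<lambda>_. S)) (\<lambda>w. \<lambda>i\<in>I. w (g i))"
    by (subst distr_distr[OF m m']) (simp add: comp_def)
  also have "\<dots> = distr (Pi\<^sub>M UNIV (\<lambda>_. ?D)) (Pi\<^sub>M I (\<lambda>_. ?D)) (\<lambda>w. \<lambda>i\<in>I. w (g i))"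
    unfolding distr_iid_sequence[OF assms(1)] by (intro distr_cong refl sets_PiM_cong) simp
  also have "\<dots> = Pi\<^sub>M I (\<lambda>_. ?D)"
    using distr_PiM_reindex[of UNIV "\<lambda>_. ?D" g I] assms(2) ps by simp
  finally show ?thesis .
qed

lemma prob_iid_window:
  fixes g h :: "'i \<Rightarrow> int"
  assumes X: "iid_sequence M S X" and inj: "inj_on g I" "inj_on h I" and P: "Measurable.pred (Pi\<^sub>M I (\<lambda>_. S)) P"
  shows "prob {\<omega>\<in>space M. P (\<lambda>i\<in>I. X (g i) \<omega>)} = prob {\<omega>\<in>space M. P (\<lambda>i\<in>I. X (h i) \<omega>)}"
proof -
  have "prob {\<omega>\<in>space M. P (\<lambda>i\<in>I. X (g i) \<omega>)} = measure (distr M (Pi\<^sub>M I (\<lambda>_. S)) (\<lambda>\<omega>. \<lambda>i\<in>I. X (g i) \<omega>)) {s\<in>space (Pi\<^sub>M I (\<lambda>_. S)). P s}" for g :: "'i \<Rightarrow> int"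
  proof (subst measure_distr)
    have m: "(\<lambda>\<omega>. \<lambda>i\<in>I. X (g i) \<omega>) \<in> M \<rightarrow>\<^sub>M Pi\<^sub>M I (\<lambda>_. S)"
      by (intro measurable_restrict iid_sequence_measurable[OF X])
    then show "(\<lambda>\<omega>. \<lambda>i\<in>I. X (g i) \<omega>) \<in> M \<rightarrow>\<^sub>M Pi\<^sub>M I (\<lambda>_. S)" .
    show "prob {\<omega>\<in>space M. P (\<lambda>i\<in>I. X (g i) \<omega>)} = prob ((\<lambda>\<omega>. \<lambda>i\<in>I. X (g i) \<omega>) -` {s\<in>space (Pi\<^sub>M I (\<lambda>_. S)). P s} \<inter> space M)"
      using measurable_space[OF m] by (intro arg_cong[where f=prob]) auto
  qed (use P in \<open>simp add: pred_def\<close>)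
  then show ?thesis using distr_iid_window[OF X inj(1)] distr_iid_window[OF X inj(2)] by simp
qed

lemma integral_iid_window:
  fixes g h :: "'i \<Rightarrow> int" and G :: "_ \<Rightarrow> real"
  assumes X: "iid_sequence M S X" and inj: "inj_on g I" "inj_on h I" and G: "G \<in> borel_measurable (Pi\<^sub>M I (\<lambda>_. S))"
  shows "expectation (\<lambda>\<omega>. G (\<lambda>i\<in>I. X (g i) \<omega>)) = expectation (\<lambda>\<omega>. G (\<lambda>i\<in>I. X (h i) \<omega>))"
proof -
  have "expectation (\<lambda>\<omega>. G (\<lambda>i\<in>I. X (g i) \<omega>)) = integral\<^sup>L (distr M (Pi\<^sub>M I (\<lambda>_. S)) (\<lambda>\<omega>. \<lambda>i\<in>I. X (g i) \<omega>)) G" for g :: "'i \<Rightarrow> int"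
    by (rule integral_distr[symmetric, OF _ G]) (intro measurable_restrict iid_sequence_measurable[OF X])
  then show ?thesis using distr_iid_window[OF X inj(1)] distr_iid_window[OF X inj(2)] by simp
qed

text \<open>Disjoint index ranges give independence, translated ones a common law. Blocks with
  larger index lie further to the left, the order in which the network is followed into the
  past.\<close>

lemma iid_blocks:
  fixes X :: "int \<Rightarrow> 'a \<Rightarrow> 'b" and e :: "nat \<Rightarrow> int" and L :: nat and G :: "(nat \<Rightarrow> 'b) \<Rightarrow> real"
  assumes X: "iid_sequence M S X" and disj: "\<And>k l. k < l \<Longrightarrow> e l + int L \<le> e k"
    and G: "G \<in> borel_measurable (Pi\<^sub>M {..<L} (\<lambda>_. S))"
  defines "W \<equiv> \<lambda>l \<omega>. G (\<lambda>i\<in>{..<L}. X (e l + int i) \<omega>)"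
  shows "indep_vars (\<lambda>_. borel) W UNIV" "distr M borel (W l) = distr M borel (W 0)"
proof -
  let ?K = "\<lambda>l. {e l..<e l + int L}"
  have "indep_vars (\<lambda>_. S) X UNIV" using X by (simp add: iid_sequence_def)
  then have "indep_vars (\<lambda>l. Pi\<^sub>M (?K l) (\<lambda>_. S)) (\<lambda>l \<omega>. restrict (\<lambda>i. X i \<omega>) (?K l)) (UNIV :: nat set)"
  proof (rule indep_vars_restrict)
    show "disjoint_family_on ?K UNIV"
      unfolding disjoint_family_on_def
    proof (intro ballI impI)
      fix k l :: nat assume "k \<noteq> l"
      then consider "k < l" | "l < k" by linarith
      then show "?K k \<inter> ?K l = {}" using disj[of k l] disj[of l k] by cases auto
    qed
  qed auto
  then have "indep_vars (\<lambda>_. borel) (\<lambda>l \<omega>. G (\<lambda>i\<in>{..<L}. restrict (\<lambda>i. X i \<omega>) (?K l) (e l + int i))) UNIV"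
  proof (rule indep_vars_compose2[where Y="\<lambda>l v. G (\<lambda>i\<in>{..<L}. v (e l + int i))"])
    fix l :: nat
    show "(\<lambda>v. G (\<lambda>i\<in>{..<L}. v (e l + int i))) \<in> Pi\<^sub>M (?K l) (\<lambda>_. S) \<rightarrow>\<^sub>M borel"
      by (rule measurable_compose[OF _ G]) (intro measurable_restrict, auto)
  qed
  moreover have "(\<lambda>i\<in>{..<L}. restrict (\<lambda>i. X i \<omega>) (?K l) (e l + int i)) = (\<lambda>i\<in>{..<L}. X (e l + int i) \<omega>)" for l \<omega>
    by (rule restrict_ext) auto
  ultimately show "indep_vars (\<lambda>_. borel) W UNIV" by (simp add: W_def)
  have d: "distr M borel (W l) = distr (Pi\<^sub>M {..<L} (\<lambda>_. distr M S (X 0))) borel G" for l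
  proof -
    have m: "(\<lambda>\<omega>. \<lambda>i\<in>{..<L}. X (e l + int i) \<omega>) \<in> M \<rightarrow>\<^sub>M Pi\<^sub>M {..<L} (\<lambda>_. S)"
      by (intro measurable_restrict iid_sequence_measurable[OF X])
    have "distr M borel (W l) = distr (distr M (Pi\<^sub>M {..<L} (\<lambda>_. S)) (\<lambda>\<omega>. \<lambda>i\<in>{..<L}. X (e l + int i) \<omega>)) borel G"
      by (subst distr_distr[OF G m]) (simp add: comp_def W_def)
    also have "distr M (Pi\<^sub>M {..<L} (\<lambda>_. S)) (\<lambda>\<omega>. \<lambda>i\<in>{..<L}. X (e l + int i) \<omega>) = Pi\<^sub>M {..<L} (\<lambda>_. distr M S (X 0))"
      by (rule distr_iid_window[OF X]) (auto simp: inj_on_def)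
    finally show ?thesis .
  qed
  show "distr M borel (W l) = distr M borel (W 0)" unfolding d[of l] d[of 0] ..
qed

lemma indep_vars_split:
  assumes X: "indep_vars (\<lambda>_. S) X UNIV" and AB: "A \<inter> B = {}"
    and P: "Measurable.pred (Pi\<^sub>M A (\<lambda>_. S)) P" and Q: "Measurable.pred (Pi\<^sub>M B (\<lambda>_. S)) Q"
  shows "prob {\<omega>\<in>space M. P (\<lambda>i\<in>A. X i \<omega>) \<and> Q (\<lambda>i\<in>B. X i \<omega>)}
    = prob {\<omega>\<in>space M. P (\<lambda>i\<in>A. X i \<omega>)} * prob {\<omega>\<in>space M. Q (\<lambda>i\<in>B. X i \<omega>)}"
proof -
  have iv: "indep_var (Pi\<^sub>M A (\<lambda>_. S)) (\<lambda>\<omega>. \<lambda>i\<in>A. X i \<omega>) (Pi\<^sub>M B (\<lambda>_. S)) (\<lambda>\<omega>. \<lambda>i\<in>B. X i \<omega>)"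
    by (rule indep_var_restrict[OF X AB]) auto
  note m = indep_var_rv1[OF iv] indep_var_rv2[OF iv]
  have e: "{\<omega>\<in>space M. P (\<lambda>i\<in>A. X i \<omega>)} = (\<lambda>\<omega>. \<lambda>i\<in>A. X i \<omega>) -` {v\<in>space (Pi\<^sub>M A (\<lambda>_. S)). P v} \<inter> space M"
    "{\<omega>\<in>space M. Q (\<lambda>i\<in>B. X i \<omega>)} = (\<lambda>\<omega>. \<lambda>i\<in>B. X i \<omega>) -` {v\<in>space (Pi\<^sub>M B (\<lambda>_. S)). Q v} \<inter> space M"
    "{\<omega>\<in>space M. P (\<lambda>i\<in>A. X i \<omega>) \<and> Q (\<lambda>i\<in>B. X i \<omega>)} =
     (\<lambda>\<omega>. (\<lambda>i\<in>A. X i \<omega>, \<lambda>i\<in>B. X i \<omega>)) -` ({v\<in>space (Pi\<^sub>M A (\<lambda>_. S)). P v} \<times> {v\<in>space (Pi\<^sub>M B (\<lambda>_. S)). Q v}) \<inter> space M"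
    using m[THEN measurable_space] by auto
  show ?thesis
    unfolding e using indep_varD[OF iv, of "{v\<in>space (Pi\<^sub>M A (\<lambda>_. S)). P v}" "{v\<in>space (Pi\<^sub>M B (\<lambda>_. S)). Q v}"] P Q
    by (simp add: pred_def)
qed

text \<open>As the two sequences are independent of each other, the probability of finitely many
  rectangles factors completely, whatever the shift \<open>c\<close>. Rectangles are stable under
  intersection and generate the product, which extends this to all events.\<close>

lemma iid_sequence_pair:
  fixes \<tau> :: "int \<Rightarrow> 'a \<Rightarrow> real" and \<zeta> :: "int \<Rightarrow> 'a \<Rightarrow> 'k"
  assumes IA: "assumption_IA M S \<zeta> \<tau>"
  shows "iid_sequence M (borel \<Otimes>\<^sub>M S) (\<lambda>n \<omega>. (\<tau> (n + c) \<omega>, \<zeta> n \<omega>))"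
proof -
  have \<zeta>: "iid_sequence M S \<zeta>" and \<tau>: "iid_sequence M borel \<tau>"
    and ind: "indep_rvs M (Pi\<^sub>M UNIV (\<lambda>_. S)) (\<lambda>\<omega> n. \<zeta> n \<omega>) (Pi\<^sub>M UNIV (\<lambda>_. borel)) (\<lambda>\<omega> n. \<tau> n \<omega>)"
    using IA by (auto simp: assumption_IA_def)
  note m\<zeta> = iid_sequence_measurable[OF \<zeta>] and m\<tau> = iid_sequence_measurable[OF \<tau>]
  let ?X = "\<lambda>n \<omega>. (\<tau> (n + c) \<omega>, \<zeta> n \<omega>)"
  let ?R = "{A \<times> B |A B. A \<in> sets borel \<and> B \<in> sets S}"
  let ?F = "\<lambda>n. {?X n -` R \<inter> space M |R. R \<in> ?R}"
  have mX: "?X n \<in> M \<rightarrow>\<^sub>M borel \<Otimes>\<^sub>M S" for n using m\<zeta> m\<tau> by simp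
  have key: "prob (\<Inter>j\<in>J. ?X j -` (A j \<times> B j) \<inter> space M)
      = (\<Prod>j\<in>J. prob (\<tau> (j + c) -` A j \<inter> space M)) * (\<Prod>j\<in>J. prob (\<zeta> j -` B j \<inter> space M))"
    if J: "finite J" "J \<noteq> {}" and A: "\<And>j. j \<in> J \<Longrightarrow> A j \<in> sets borel" and B: "\<And>j. j \<in> J \<Longrightarrow> B j \<in> sets S" for J A B
  proof -
    let ?J' = "(\<lambda>j. j + c) ` J"
    have e1: "(\<lambda>\<omega> n. \<zeta> n \<omega>) -` {w\<in>space (Pi\<^sub>M UNIV (\<lambda>_. S)). \<forall>j\<in>J. w j \<in> B j} \<inter> space M = (\<Inter>j\<in>J. \<zeta> j -` B j \<inter> space M)"
      using J m\<zeta>[THEN measurable_space] by (auto simp: space_PiM)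
    have e2: "(\<lambda>\<omega> n. \<tau> n \<omega>) -` {w\<in>space (Pi\<^sub>M UNIV (\<lambda>_. borel)). \<forall>j\<in>J. w (j + c) \<in> A j} \<inter> space M = (\<Inter>j\<in>J. \<tau> (j + c) -` A j \<inter> space M)"
      using J by (auto simp: space_PiM)
    have "(\<Inter>j\<in>J. ?X j -` (A j \<times> B j) \<inter> space M) = (\<Inter>j\<in>J. \<zeta> j -` B j \<inter> space M) \<inter> (\<Inter>j\<in>J. \<tau> (j + c) -` A j \<inter> space M)"
      using J by auto
    also have "prob \<dots> = prob (\<Inter>j\<in>J. \<zeta> j -` B j \<inter> space M) * prob (\<Inter>j\<in>J. \<tau> (j + c) -` A j \<inter> space M)"
      unfolding e1[symmetric] e2[symmetric]
    proof (rule indep_rvsD[OF ind])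
      have "{w\<in>space (Pi\<^sub>M UNIV (\<lambda>_. S)). w j \<in> B j} \<in> sets (Pi\<^sub>M UNIV (\<lambda>_. S))" if "j \<in> J" for j
        using measurable_sets[OF measurable_component_singleton[of j UNIV "\<lambda>_. S"] B[OF that]]
        by (simp add: vimage_def Int_def conj_commute)
      then show "{w\<in>space (Pi\<^sub>M UNIV (\<lambda>_. S)). \<forall>j\<in>J. w j \<in> B j} \<in> sets (Pi\<^sub>M UNIV (\<lambda>_. S))"
        using J by (intro sets.sets_Collect_finite_All') auto
      have "{w\<in>space (Pi\<^sub>M UNIV (\<lambda>_. borel :: real measure)). w (j + c) \<in> A j} \<in> sets (Pi\<^sub>M UNIV (\<lambda>_. borel))" if "j \<in> J" for j
        using measurable_sets[OF measurable_component_singleton[of "j + c" UNIV "\<lambda>_. borel"] A[OF that]]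
        by (simp add: vimage_def Int_def conj_commute)
      then show "{w\<in>space (Pi\<^sub>M UNIV (\<lambda>_. borel)). \<forall>j\<in>J. w (j + c) \<in> A j} \<in> sets (Pi\<^sub>M UNIV (\<lambda>_. borel))"
        using J by (intro sets.sets_Collect_finite_All') auto
    qed
    also have "prob (\<Inter>j\<in>J. \<zeta> j -` B j \<inter> space M) = (\<Prod>j\<in>J. prob (\<zeta> j -` B j \<inter> space M))"
      using \<zeta> J B by (intro indep_varsD[where I=UNIV and M'="\<lambda>_. S"]) (auto simp: iid_sequence_def)
    also have "(\<Inter>j\<in>J. \<tau> (j + c) -` A j \<inter> space M) = (\<Inter>i\<in>?J'. \<tau> i -` A (i - c) \<inter> space M)" by auto
    also have "prob \<dots> = (\<Prod>i\<in>?J'. prob (\<tau> i -` A (i - c) \<inter> space M))"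
      using \<tau> J A by (intro indep_varsD[where I=UNIV and M'="\<lambda>_. borel"]) (auto simp: iid_sequence_def)
    also have "\<dots> = (\<Prod>j\<in>J. prob (\<tau> (j + c) -` A j \<inter> space M))"
      by (subst prod.reindex) (auto simp: inj_on_def)
    finally show ?thesis by (simp add: mult.commute)
  qed
  have key1: "prob (?X j -` (A \<times> B) \<inter> space M) = prob (\<tau> (j + c) -` A \<inter> space M) * prob (\<zeta> j -` B \<inter> space M)"
    if "A \<in> sets borel" "B \<in> sets S" for j A B
    using key[of "{j}" "\<lambda>_. A" "\<lambda>_. B"] that by simp
  have "indep_sets ?F UNIV"
  proof (rule indep_setsI)
    show "?F i \<subseteq> events" for i using mX by (auto intro!: measurable_sets)
  next
    fix A :: "int \<Rightarrow> 'a set" and J assume J: "J \<noteq> {}" "J \<subseteq> UNIV" "finite J" "\<forall>j\<in>J. A j \<in> ?F j"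
    have "\<exists>a b. A j = ?X j -` (a \<times> b) \<inter> space M \<and> a \<in> sets borel \<and> b \<in> sets S" if "j \<in> J" for j
    proof -
      have "A j \<in> ?F j" using J(4) that by (rule bspec)
      then show ?thesis
      proof (elim CollectE exE conjE)
        fix R a b assume "A j = ?X j -` R \<inter> space M" "R = a \<times> b" "a \<in> sets borel" "b \<in> sets S"
        then show ?thesis by (intro exI[of _ a] exI[of _ b]) (simp only: simp_thms)
      qed
    qed
    then obtain a b where ab: "\<And>j. j \<in> J \<Longrightarrow> A j = ?X j -` (a j \<times> b j) \<inter> space M"
      "\<And>j. j \<in> J \<Longrightarrow> a j \<in> sets borel" "\<And>j. j \<in> J \<Longrightarrow> b j \<in> sets S" by metis
    have "prob (\<Inter>j\<in>J. A j) = prob (\<Inter>j\<in>J. ?X j -` (a j \<times> b j) \<inter> space M)" using ab(1) by simp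
    also have "\<dots> = (\<Prod>j\<in>J. prob (\<tau> (j + c) -` a j \<inter> space M) * prob (\<zeta> j -` b j \<inter> space M))"
      using key[OF J(3,1) ab(2,3)] by (simp add: prod.distrib)
    also have "\<dots> = (\<Prod>j\<in>J. prob (A j))"
      by (rule prod.cong[OF refl]) (simp add: ab key1)
    finally show "prob (\<Inter>j\<in>J. A j) = (\<Prod>j\<in>J. prob (A j))" .
  qed
  then have "indep_sets (\<lambda>n. sigma_sets (space M) (?F n)) UNIV"
  proof (rule indep_sets_sigma)
    fix n
    show "Int_stable (?F n)"
    proof (rule Int_stableI, elim CollectE exE conjE)
      fix a b R R' A A' B B'
      assume ab: "a = ?X n -` R \<inter> space M" "b = ?X n -` R' \<inter> space M" "R = A \<times> B" "R' = A' \<times> B'"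
        and s: "A \<in> sets borel" "B \<in> sets S" "A' \<in> sets borel" "B' \<in> sets S"
      have "a \<inter> b = ?X n -` ((A \<inter> A') \<times> (B \<inter> B')) \<inter> space M" using ab by auto
      moreover have "(A \<inter> A') \<times> (B \<inter> B') \<in> ?R"
        by (intro CollectI exI[of _ "A \<inter> A'"] exI[of _ "B \<inter> B'"] conjI refl sets.Int s)
      ultimately show "a \<inter> b \<in> ?F n" by blast
    qed
  qed
  moreover have "sigma_sets (space M) (?F n) = {?X n -` A \<inter> space M |A. A \<in> sets (borel \<Otimes>\<^sub>M S)}" for n
  proof -
    have "?R = {a \<times> b |a b. a \<in> sets borel \<and> b \<in> sets S}" by auto
    then show ?thesis unfolding sets_pair_measure
      by (subst sigma_sets_vimage_commute[symmetric]) (use m\<zeta>[THEN measurable_space] in auto)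
  qed
  ultimately have iv: "indep_vars (\<lambda>_. borel \<Otimes>\<^sub>M S) ?X UNIV"
    unfolding indep_vars_def2 using mX by simp
  have d: "distr M (borel \<Otimes>\<^sub>M S) (?X n) = distr M borel (\<tau> 0) \<Otimes>\<^sub>M distr M S (\<zeta> 0)" for n
  proof (rule pair_measure_eqI[symmetric])
    show "sigma_finite_measure (distr M borel (\<tau> 0))" "sigma_finite_measure (distr M S (\<zeta> 0))"
      by (auto intro!: finite_measure.sigma_finite_measure prob_space.finite_measure prob_space_distr m\<tau> m\<zeta>)
    show "sets (distr M borel (\<tau> 0) \<Otimes>\<^sub>M distr M S (\<zeta> 0)) = sets (distr M (borel \<Otimes>\<^sub>M S) (?X n))"
      unfolding sets_distr by (rule sets_pair_measure_cong) simp_all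
    fix A B assume AB: "A \<in> sets (distr M borel (\<tau> 0))" "B \<in> sets (distr M S (\<zeta> 0))"
    have "emeasure (distr M borel (\<tau> 0)) A * emeasure (distr M S (\<zeta> 0)) B
        = emeasure (distr M borel (\<tau> (n + c))) A * emeasure (distr M S (\<zeta> n)) B"
      using iid_sequence_distr[OF \<tau>, of "n + c" 0] iid_sequence_distr[OF \<zeta>, of n 0] by simp
    also have "\<dots> = ennreal (prob (\<tau> (n + c) -` A \<inter> space M) * prob (\<zeta> n -` B \<inter> space M))"
      using AB m\<zeta> m\<tau> by (simp add: emeasure_distr emeasure_eq_measure ennreal_mult)
    also have "\<dots> = emeasure (distr M (borel \<Otimes>\<^sub>M S) (?X n)) (A \<times> B)"
      using AB mX by (subst emeasure_distr) (auto simp: emeasure_eq_measure key1)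
    finally show "emeasure (distr M borel (\<tau> 0)) A * emeasure (distr M S (\<zeta> 0)) B = emeasure (distr M (borel \<Otimes>\<^sub>M S) (?X n)) (A \<times> B)" .
  qed
  show ?thesis unfolding iid_sequence_def using iv d by metis
qed

end

section \<open>The principle of a single big jump\<close>

lemma asymp_equiv_imp_quotient_tendsto:
  fixes f g :: "real \<Rightarrow> real"
  assumes "f \<sim>[at_top] (\<lambda>x. c * g x)" "c > 0" "\<And>x. g x > 0"
  shows "((\<lambda>x. f x / g x) \<longlongrightarrow> c) at_top"
proof -
  have nz: "c * g x \<noteq> 0" for x using assms(2) assms(3)[of x] by simp
  have "((\<lambda>x. f x / (c * g x)) \<longlongrightarrow> 1) at_top"
    using assms(1) nz by (simp add: asymp_equiv_def)
  then have "((\<lambda>x. c * (f x / (c * g x))) \<longlongrightarrow> c * 1) at_top" by (intro tendsto_intros)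
  moreover have "c * (f x / (c * g x)) = f x / g x" for x using assms(2) by simp
  ultimately show ?thesis by simp
qed

section \<open>Consequences of the stochastic assumptions\<close>

locale heavy_network = prob_space M + SE: subexponential_integrated F
  for M :: "'a measure" and F :: "real \<Rightarrow> real" +
  fixes S :: "'k measure"
    and f :: "nat \<Rightarrow> (nat \<Rightarrow> real) \<times> (nat \<Rightarrow> 'k) \<Rightarrow> real"
    and T \<tau> :: "int \<Rightarrow> 'a \<Rightarrow> real" and \<zeta> :: "int \<Rightarrow> 'a \<Rightarrow> 'k"
    and r :: nat and Y :: "nat \<Rightarrow> int \<Rightarrow> 'a \<Rightarrow> real"
    and d :: "nat \<Rightarrow> real" and a b :: real
  assumes network: "measurable_network S f"
    and separable: "\<And>\<omega>. \<omega> \<in> space M \<Longrightarrow> monotone_separable f (\<lambda>n. \<zeta> n \<omega>)"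
    and T_measurable[measurable]: "\<And>n. T n \<in> borel_measurable M"
    and T_mono: "\<And>\<omega>. \<omega> \<in> space M \<Longrightarrow> mono (\<lambda>n. T n \<omega>)"
    and \<tau>_eq: "\<And>n. \<tau> n = (\<lambda>\<omega>. T (n + 1) \<omega> - T n \<omega>)"
    and \<tau>_integrable: "\<And>n. integrable M (\<tau> n)" and \<tau>_mean: "\<And>n. (\<integral>\<omega>. \<tau> n \<omega> \<partial>M) = a"
    and dater_integrable: "\<And>n. integrable M (\<lambda>\<omega>. maximal_dater f n n (\<lambda>k. T k \<omega>) (\<lambda>k. \<zeta> k \<omega>))"
    and b_eq: "b = gamma0 M f \<zeta>" and stable: "b < a"
    and r_pos: "r \<ge> 1"
    and IA: "assumption_IA M S \<zeta> \<tau>"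
    and AA: "assumption_AA M f \<zeta> \<tau> r Y"
    and SE: "assumption_SE M r Y F d"
    and H: "assumption_H M r Y F d"
begin

abbreviation "D0 m n \<omega> \<equiv> maximal_dater f m n degenerate_input (\<lambda>k. \<zeta> k \<omega>)"

definition "dd = (\<Sum>j=1..r. d j)"

lemma network_at: "\<omega> \<in> space M \<Longrightarrow> network f (\<lambda>n. \<zeta> n \<omega>)"
  by unfold_locales (rule separable)

lemma \<zeta>_iid: "iid_sequence M S \<zeta>" and \<tau>_iid: "iid_sequence M borel \<tau>"
  using IA by (auto simp: assumption_IA_def)

lemma Y_iid: "iid_sequence M (Pi\<^sub>M {1..r} (\<lambda>_. borel)) (\<lambda>i \<omega>. \<lambda>j\<in>{1..r}. Y j i \<omega>)"
  using AA by (auto simp: assumption_AA_def)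

lemma \<zeta>_measurable: "\<zeta> n \<in> M \<rightarrow>\<^sub>M S" by (rule iid_sequence_measurable[OF \<zeta>_iid])

lemma \<tau>_measurable[measurable]: "\<tau> n \<in> borel_measurable M" by (rule iid_sequence_measurable[OF \<tau>_iid])

lemma Y_measurable: "j \<in> {1..r} \<Longrightarrow> Y j i \<in> borel_measurable M"
  using measurable_compose[OF iid_sequence_measurable[OF Y_iid, of i] measurable_component_singleton[of j "{1..r}" "\<lambda>_. borel"]]
  by simp

lemma D0_window: "D0 m n \<omega> = window_dater f (nat (n - m + 1)) (\<lambda>i\<in>{..<nat (n - m + 1)}. \<zeta> (m + int i) \<omega>)"
  by (rule dater0_eq_window)

lemma D0_measurable[measurable]: "m \<le> n \<Longrightarrow> D0 m n \<in> borel_measurable M"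
  unfolding maximal_dater_def
  by (intro borel_measurable_diff last_activity_measurable[OF network _ _ \<zeta>_measurable]) auto

lemma D0_nonneg: "m \<le> n \<Longrightarrow> \<omega> \<in> space M \<Longrightarrow> 0 \<le> D0 m n \<omega>"
  using network.dater_nonneg[OF network_at mono_degenerate] by blast

lemma D0_single_integrable: "integrable M (D0 n n)"
  using dater_integrable[of n]
  by (rule Bochner_Integration.integrable_cong[THEN iffD1, rotated -1])
     (auto intro: network.dater_single[OF network_at T_mono])

lemma D0_integrable:
  assumes "m \<le> n" shows "integrable M (D0 m n)"
proof (rule Bochner_Integration.integrable_bound)
  show "integrable M (\<lambda>\<omega>. \<Sum>k\<in>{m..n}. D0 k k \<omega>)"
    by (intro Bochner_Integration.integrable_sum D0_single_integrable)
  show "AE \<omega> in M. norm (D0 m n \<omega>) \<le> norm (\<Sum>k\<in>{m..n}. D0 k k \<omega>)"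
  proof (rule AE_I2)
    fix \<omega> assume w: "\<omega> \<in> space M"
    have "D0 m n \<omega> \<le> (\<Sum>k\<in>{m..n}. D0 k k \<omega>)"
      by (rule network.dater0_le_sum[OF network_at[OF w] assms])
    then show "norm (D0 m n \<omega>) \<le> norm (\<Sum>k\<in>{m..n}. D0 k k \<omega>)"
      using D0_nonneg[OF assms w] by simp
  qed
qed (use assms in measurable)

lemma expectation_D0_shift:
  assumes "m \<le> n" shows "expectation (D0 (m + c) (n + c)) = expectation (D0 m n)"
proof -
  have l: "nat (n + c - (m + c) + 1) = nat (n - m + 1)" by simp
  show ?thesis
    unfolding D0_window l
    by (rule integral_iid_window[OF \<zeta>_iid _ _ window_dater_measurable[OF network]])
       (use assms in \<open>auto simp: inj_on_def\<close>)
qed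

lemma prob_D0_shift:
  assumes "m \<le> n" shows "prob {\<omega>\<in>space M. x < D0 (m + c) (n + c) \<omega>} = prob {\<omega>\<in>space M. x < D0 m n \<omega>}"
proof -
  have l: "nat (n + c - (m + c) + 1) = nat (n - m + 1)" by simp
  have [measurable]: "window_dater f (nat (n - m + 1)) \<in> borel_measurable (Pi\<^sub>M {..<nat (n - m + 1)} (\<lambda>_. S))"
    by (rule window_dater_measurable[OF network]) (use assms in simp)
  show ?thesis
    unfolding D0_window l
    by (rule prob_iid_window[OF \<zeta>_iid, where P="\<lambda>v. x < window_dater f (nat (n - m + 1)) v"])
       (auto simp: inj_on_def)
qed

text \<open>The mean dater of \<open>n\<close> simultaneous arrivals; \<open>e L / real L\<close> is
  the constant b_L of a block of length \<open>L\<close>.\<close>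

definition e :: "nat \<Rightarrow> real" where "e n = expectation (D0 (- int n) (-1))"

lemma e_eq: "n \<ge> 1 \<Longrightarrow> expectation (D0 m (m + int n - 1)) = e n"
  using expectation_D0_shift[of "- int n" "-1" "m + int n"] by (simp add: e_def algebra_simps)

lemma e_subadditive: assumes "m \<ge> 1" "n \<ge> 1" shows "e (m + n) \<le> e m + e n"
proof -
  have "e (m + n) = expectation (D0 0 (int (m + n) - 1))" using e_eq[of "m + n" 0] assms by simp
  also have "\<dots> \<le> expectation (\<lambda>\<omega>. D0 0 (int m - 1) \<omega> + D0 (int m - 1 + 1) (int (m + n) - 1) \<omega>)"
    using assms by (intro integral_mono Bochner_Integration.integrable_add D0_integrable network.dater0_subadditive[OF network_at]) auto
  also have "\<dots> = expectation (D0 0 (int m - 1)) + expectation (D0 (int m) (int (m + n) - 1))"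
    using assms by (subst Bochner_Integration.integral_add) (auto intro!: D0_integrable)
  also have "\<dots> = e m + e n" using e_eq[OF assms(1), of 0] e_eq[OF assms(2), of "int m"] by (simp add: add.assoc)
  finally show ?thesis .
qed

lemma e_nonneg: "n \<ge> 1 \<Longrightarrow> 0 \<le> e n"
  unfolding e_def by (rule Bochner_Integration.integral_nonneg) (rule D0_nonneg, auto)

text \<open>\<open>gamma0\<close> is defined through \<open>lim\<close>; Fekete's lemma supplies the
  convergence and identifies \<open>b\<close> as an infimum, so that no normalized block mean lies
  below it.\<close>

lemma e_tendsto: "(\<lambda>n. e n / real n) \<longlonglongrightarrow> b" and b_le: "n \<ge> 1 \<Longrightarrow> b \<le> e n / real n"
proof -
  note s = fekete_subadditive[OF e_subadditive e_nonneg]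
  have "b = (INF n\<in>{1..}. e n / real n)"
    unfolding b_eq gamma0_def using limI[OF s(1)] by (simp add: e_def)
  with s show "(\<lambda>n. e n / real n) \<longlonglongrightarrow> b" "n \<ge> 1 \<Longrightarrow> b \<le> e n / real n" by auto
qed

lemma b_nonneg: "0 \<le> b"
  using e_tendsto by (rule LIMSEQ_le_const) (auto intro!: exI[of _ 1] divide_nonneg_nonneg e_nonneg)

lemma Y_nonneg: "j \<in> {1..r} \<Longrightarrow> AE \<omega> in M. 0 \<le> Y j i \<omega>"
  using AA by (auto simp: assumption_AA_def)

lemma D0_single_eq: "AE \<omega> in M. D0 i i \<omega> = (\<Sum>j=1..r. Y j i \<omega>)"
  using AA by (auto simp: assumption_AA_def)

lemma Y_le_D0_single: assumes "j \<in> {1..r}" shows "AE \<omega> in M. Y j i \<omega> \<le> D0 i i \<omega>"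
proof -
  have "AE \<omega> in M. \<forall>j\<in>{1..r}. 0 \<le> Y j i \<omega>"
    by (rule AE_finite_allI) (auto intro: Y_nonneg)
  then show ?thesis using D0_single_eq[of i]
  proof eventually_elim
    case (elim \<omega>)
    then show ?case using member_le_sum[of j "{1..r}" "\<lambda>j. Y j i \<omega>"] assms by simp
  qed
qed

text \<open>Windows ending at 0 are those for which \<open>assumption_AA\<close> gives a lower
  bound; the other summands are nonnegative and dropped.\<close>

lemma Y_le_D0: assumes "j \<in> {1..r}" shows "AE \<omega> in M. Y j (- int q) \<omega> \<le> D0 (- int q) 0 \<omega>"
proof -
  have "AE \<omega> in M. D0 (- int q) 0 \<omega> \<ge> Max ((\<lambda>j. \<Sum>i=- int q..0. Y j i \<omega>) ` {1..r})"
    using AA by (auto simp: assumption_AA_def)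
  moreover have "AE \<omega> in M. \<forall>i\<in>{- int q..0}. 0 \<le> Y j i \<omega>"
    by (rule AE_finite_allI) (auto intro: Y_nonneg[OF assms])
  ultimately show ?thesis
  proof eventually_elim
    case (elim \<omega>)
    have "Y j (- int q) \<omega> \<le> (\<Sum>i=- int q..0. Y j i \<omega>)"
      using elim(2) by (intro member_le_sum) auto
    also have "\<dots> \<le> Max ((\<lambda>j. \<Sum>i=- int q..0. Y j i \<omega>) ` {1..r})"
      using assms by (intro Max_ge) auto
    finally show ?case using elim(1) by simp
  qed
qed

lemma Y_vector_prob:
  assumes "Measurable.pred (Pi\<^sub>M {1..r} (\<lambda>_. borel)) P"
    and "\<And>i \<omega>. P (\<lambda>j\<in>{1..r}. Y j i \<omega>) \<longleftrightarrow> Q i \<omega>"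
  shows "prob {\<omega>\<in>space M. Q i \<omega>} = prob {\<omega>\<in>space M. Q 1 \<omega>}"
  using iid_sequence_prob[OF Y_iid assms(1), of i 1] unfolding assms(2) .

lemma prob_Y: "j \<in> {1..r} \<Longrightarrow> prob {\<omega>\<in>space M. x < Y j i \<omega>} = prob {\<omega>\<in>space M. x < Y j 1 \<omega>}"
  by (rule Y_vector_prob[where P="\<lambda>v. x < v j"]) auto

abbreviation "Ymax i \<omega> \<equiv> Max ((\<lambda>j. Y j i \<omega>) ` {1..r})"

lemma less_Ymax_iff: "x < Ymax i \<omega> \<longleftrightarrow> (\<exists>j\<in>{1..r}. x < Y j i \<omega>)"
  using r_pos by (subst Max_gr_iff) auto

lemma Y_sets: "j \<in> {1..r} \<Longrightarrow> {\<omega>\<in>space M. x < Y j i \<omega>} \<in> events"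
  using Y_measurable[of j i] by measurable

lemma Ymax_sets: "{\<omega>\<in>space M. x < Ymax i \<omega>} \<in> events"
  unfolding less_Ymax_iff by (rule sets.sets_Collect_finite_Ex[OF Y_sets]) auto

lemma prob_Ymax: "prob {\<omega>\<in>space M. x < Ymax i \<omega>} = prob {\<omega>\<in>space M. x < Ymax 1 \<omega>}"
  unfolding less_Ymax_iff
proof (rule Y_vector_prob[where P="\<lambda>v. \<exists>j\<in>{1..r}. x < v j"])
  show "Measurable.pred (Pi\<^sub>M {1..r} (\<lambda>_. borel)) (\<lambda>v. \<exists>j\<in>{1..r}. x < v j)"
    by (intro pred_intros_finite(4)) auto
qed auto

lemma d_nonneg: "j \<in> {1..r} \<Longrightarrow> 0 \<le> d j" and dd_pos: "0 < dd"
  and Y_quotient: "j \<in> {1..r} \<Longrightarrow> ((\<lambda>x. prob {\<omega>\<in>space M. x < Y j i \<omega>} / tail F x) \<longlongrightarrow> d j) at_top"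
  using SE prob_Y[of j _ i] by (auto simp: assumption_SE_def dd_def)

text \<open>This is where \<open>assumption_H\<close> enters: the sum and the maximum of the
  components share the constant \<open>dd\<close>, and the sum is the single dater. The tails of the
  dater and of the largest component therefore differ by o(tail F) only.\<close>

lemma Ymax_quotient: "((\<lambda>x. prob {\<omega>\<in>space M. x < Ymax i \<omega>} / tail F x) \<longlongrightarrow> dd) at_top"
  and D0_quotient: "((\<lambda>x. prob {\<omega>\<in>space M. x < D0 i i \<omega>} / tail F x) \<longlongrightarrow> dd) at_top"
proof -
  have eq: "(\<lambda>x. \<Sum>j=1..r. d j * tail F x) = (\<lambda>x. dd * tail F x)"
    by (simp add: dd_def sum_distrib_right)
  have h: "(\<lambda>x. prob {\<omega>\<in>space M. x < (\<Sum>j=1..r. Y j 1 \<omega>)}) \<sim>[at_top] (\<lambda>x. prob {\<omega>\<in>space M. x < Ymax 1 \<omega>})"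
    "(\<lambda>x. prob {\<omega>\<in>space M. x < Ymax 1 \<omega>}) \<sim>[at_top] (\<lambda>x. \<Sum>j=1..r. prob {\<omega>\<in>space M. x < Y j 1 \<omega>})"
    "(\<lambda>x. \<Sum>j=1..r. prob {\<omega>\<in>space M. x < Y j 1 \<omega>}) \<sim>[at_top] (\<lambda>x. dd * tail F x)"
    using H unfolding assumption_H_def eq by blast+
  have 2: "(\<lambda>x. prob {\<omega>\<in>space M. x < Ymax 1 \<omega>}) \<sim>[at_top] (\<lambda>x. dd * tail F x)"
    by (rule asymp_equiv_trans[OF h(2,3)])
  then show "((\<lambda>x. prob {\<omega>\<in>space M. x < Ymax i \<omega>} / tail F x) \<longlongrightarrow> dd) at_top"
    unfolding prob_Ymax[of _ i] by (rule asymp_equiv_imp_quotient_tendsto[OF _ dd_pos SE.tail_pos])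
  have "(\<lambda>x. prob {\<omega>\<in>space M. x < (\<Sum>j=1..r. Y j 1 \<omega>)}) \<sim>[at_top] (\<lambda>x. dd * tail F x)"
    by (rule asymp_equiv_trans[OF h(1) 2])
  moreover have "prob {\<omega>\<in>space M. x < (\<Sum>j=1..r. Y j 1 \<omega>)} = prob {\<omega>\<in>space M. x < D0 i i \<omega>}" for x
  proof -
    have "(\<lambda>\<omega>. \<Sum>j=1..r. Y j 1 \<omega>) \<in> borel_measurable M"
      by (intro borel_measurable_sum Y_measurable)
    then have "prob {\<omega>\<in>space M. x < (\<Sum>j=1..r. Y j 1 \<omega>)} = prob {\<omega>\<in>space M. x < D0 1 1 \<omega>}"
      using D0_single_eq[of 1] by (intro measure_eq_AE) auto
    also have "\<dots> = prob {\<omega>\<in>space M. x < D0 i i \<omega>}"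
      using prob_D0_shift[of 1 1 x "i - 1"] by simp
    finally show ?thesis .
  qed
  ultimately show "((\<lambda>x. prob {\<omega>\<in>space M. x < D0 i i \<omega>} / tail F x) \<longlongrightarrow> dd) at_top"
    using asymp_equiv_imp_quotient_tendsto[OF _ dd_pos SE.tail_pos] by simp
qed

lemma quotient_upper:
  assumes "((\<lambda>x. p x / tail F x) \<longlongrightarrow> c) at_top" "c < c'"
  shows "\<forall>\<^sub>F x in at_top. p x \<le> c' * tail F x"
  using order_tendstoD(2)[OF assms] by eventually_elim (use SE.tail_pos in \<open>simp add: pos_divide_less_eq less_imp_le\<close>)

lemma quotient_lower:
  assumes "((\<lambda>x. p x / tail F x) \<longlongrightarrow> c) at_top" "c' < c"
  shows "\<forall>\<^sub>F x in at_top. c' * tail F x \<le> p x"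
  using order_tendstoD(1)[OF assms] by eventually_elim (use SE.tail_pos in \<open>simp add: pos_less_divide_eq less_imp_le\<close>)

lemma Y_upper: "\<forall>\<^sub>F x in at_top. \<forall>j\<in>{1..r}. \<forall>i. prob {\<omega>\<in>space M. x < Y j i \<omega>} \<le> (dd + 1) * tail F x"
proof (intro eventually_ball_finite ballI)
  fix j assume j: "j \<in> {1..r}"
  have "d j \<le> dd" unfolding dd_def using j d_nonneg by (intro member_le_sum) auto
  then have "d j < dd + 1" by simp
  from quotient_upper[OF Y_quotient[OF j, of 1] this]
  show "\<forall>\<^sub>F x in at_top. \<forall>i. prob {\<omega>\<in>space M. x < Y j i \<omega>} \<le> (dd + 1) * tail F x"
  proof eventually_elim
    case (elim x)
    then show ?case using prob_Y[OF j, of x] by metis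
  qed
qed simp

lemma Y_lower:
  assumes j: "j \<in> {1..r}" and "\<epsilon> > 0"
  shows "\<forall>\<^sub>F x in at_top. \<forall>i. (d j - \<epsilon>) * tail F x \<le> prob {\<omega>\<in>space M. x < Y j i \<omega>}"
proof -
  have "d j - \<epsilon> < d j" using assms by simp
  from quotient_lower[OF Y_quotient[OF j, of 1] this] show ?thesis
  proof eventually_elim
    case (elim x)
    then show ?case using prob_Y[OF j, of x] by metis
  qed
qed

text \<open>The indicator of a joint exceedance plus that of an exceedance by the maximum is at most
  the sum of the individual indicators. The means of the latter two agree up to o(tail F), so two
  components of one vector are rarely large together.\<close>

lemma Y_pair_upper:
  assumes "\<epsilon> > 0"
  shows "\<forall>\<^sub>F x in at_top. \<forall>j\<in>{1..r}. \<forall>j'\<in>{1..r}. j \<noteq> j' \<longrightarrow>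
    (\<forall>i. prob {\<omega>\<in>space M. x < Y j i \<omega> \<and> x < Y j' i \<omega>} \<le> \<epsilon> * tail F x)"
proof -
  have "((\<lambda>x. (\<Sum>j\<in>{1..r}. prob {\<omega>\<in>space M. x < Y j 1 \<omega>} / tail F x) - prob {\<omega>\<in>space M. x < Ymax 1 \<omega>} / tail F x) \<longlongrightarrow> (\<Sum>j\<in>{1..r}. d j) - dd) at_top"
    by (intro tendsto_diff tendsto_sum Y_quotient Ymax_quotient)
  then have "((\<lambda>x. ((\<Sum>j\<in>{1..r}. prob {\<omega>\<in>space M. x < Y j 1 \<omega>}) - prob {\<omega>\<in>space M. x < Ymax 1 \<omega>}) / tail F x) \<longlongrightarrow> 0) at_top"
    by (simp add: dd_def diff_divide_distrib sum_divide_distrib)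
  from quotient_upper[OF this assms] show ?thesis
  proof eventually_elim
    case (elim x)
    show ?case
    proof (intro ballI impI allI)
      fix j j' i assume j: "j \<in> {1..r}" "j' \<in> {1..r}" "j \<noteq> j'"
      let ?I = "\<lambda>j \<omega>. indicator {\<omega>\<in>space M. x < Y j i \<omega>} \<omega> :: real"
      note m = Y_sets and mm = Ymax_sets
      have int: "integrable M (indicat_real E)" if "E \<in> events" for E
        using that by (intro integrable_real_indicator) (auto simp: emeasure_eq_measure)
      have mp: "{\<omega>\<in>space M. x < Y j i \<omega> \<and> x < Y j' i \<omega>} \<in> events"
        by (intro sets.sets_Collect_conj m j)
      have "prob {\<omega>\<in>space M. x < Y j i \<omega> \<and> x < Y j' i \<omega>} + prob {\<omega>\<in>space M. x < Ymax i \<omega>}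
         = expectation (\<lambda>\<omega>. indicator {\<omega>\<in>space M. x < Y j i \<omega> \<and> x < Y j' i \<omega>} \<omega> + indicator {\<omega>\<in>space M. x < Ymax i \<omega>} \<omega>)"
        using mp mm by (subst Bochner_Integration.integral_add[OF int int]) auto
      also have "\<dots> \<le> expectation (\<lambda>\<omega>. \<Sum>j\<in>{1..r}. ?I j \<omega>)"
      proof (rule integral_mono)
        fix \<omega> assume w: "\<omega> \<in> space M"
        have two: "(\<Sum>k\<in>{j, j'}. ?I k \<omega>) \<le> (\<Sum>j\<in>{1..r}. ?I j \<omega>)" using j by (intro sum_mono2) auto
        have one: "?I k \<omega> \<le> (\<Sum>j\<in>{1..r}. ?I j \<omega>)" if "k \<in> {1..r}" for k
          using that by (intro member_le_sum) auto
        have zero: "0 \<le> (\<Sum>j\<in>{1..r}. ?I j \<omega>)" by (intro sum_nonneg) auto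
        let ?P = "indicator {\<omega>\<in>space M. x < Y j i \<omega> \<and> x < Y j' i \<omega>} \<omega> :: real"
        let ?Q = "indicator {\<omega>\<in>space M. x < Ymax i \<omega>} \<omega> :: real"
        show "?P + ?Q \<le> (\<Sum>j\<in>{1..r}. ?I j \<omega>)"
        proof (cases "x < Y j i \<omega> \<and> x < Y j' i \<omega>")
          case True
          have "?P \<le> 1" "?Q \<le> 1" by (auto simp: indicator_def)
          moreover have "(\<Sum>k\<in>{j, j'}. ?I k \<omega>) = 2" using True w j(3) by simp
          ultimately show ?thesis using two by linarith
        next
          case False
          then have P: "?P = 0" by (simp add: indicator_def)
          show ?thesis
          proof (cases "x < Ymax i \<omega>")
            case True
            then obtain k where k: "k \<in> {1..r}" "x < Y k i \<omega>" unfolding less_Ymax_iff by blast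
            then have "?I k \<omega> = 1" using w by simp
            moreover have "?Q \<le> 1" by (auto simp: indicator_def)
            ultimately show ?thesis using one[OF k(1)] P by linarith
          next
            case False
            then have "?Q = 0" by (simp add: indicator_def)
            then show ?thesis using zero P by linarith
          qed
        qed
      qed (intro Bochner_Integration.integrable_sum Bochner_Integration.integrable_add int m mp mm, simp)+
      also have "\<dots> = (\<Sum>j\<in>{1..r}. prob {\<omega>\<in>space M. x < Y j i \<omega>})"
        using m by (subst Bochner_Integration.integral_sum[OF int]) auto
      also have "\<dots> = (\<Sum>j\<in>{1..r}. prob {\<omega>\<in>space M. x < Y j 1 \<omega>})"
        by (intro sum.cong refl prob_Y)
      finally show "prob {\<omega>\<in>space M. x < Y j i \<omega> \<and> x < Y j' i \<omega>} \<le> \<epsilon> * tail F x"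
        using elim prob_Ymax[of x i] by simp
    qed
  qed
qed

lemma Y_indep:
  assumes "j \<in> {1..r}" "j' \<in> {1..r}" "i \<noteq> i'"
  shows "prob {\<omega>\<in>space M. x < Y j i \<omega> \<and> x' < Y j' i' \<omega>} = prob {\<omega>\<in>space M. x < Y j i \<omega>} * prob {\<omega>\<in>space M. x' < Y j' i' \<omega>}"
proof -
  have iv: "indep_vars (\<lambda>_. Pi\<^sub>M {1..r} (\<lambda>_. borel)) (\<lambda>i \<omega>. \<lambda>j\<in>{1..r}. Y j i \<omega>) UNIV"
    using Y_iid by (simp add: iid_sequence_def)
  have "prob {\<omega>\<in>space M. (\<lambda>v. x < v i j) (\<lambda>i\<in>{i}. \<lambda>j\<in>{1..r}. Y j i \<omega>) \<and> (\<lambda>v. x' < v i' j') (\<lambda>i\<in>{i'}. \<lambda>j\<in>{1..r}. Y j i \<omega>)}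
     = prob {\<omega>\<in>space M. (\<lambda>v. x < v i j) (\<lambda>i\<in>{i}. \<lambda>j\<in>{1..r}. Y j i \<omega>)} * prob {\<omega>\<in>space M. (\<lambda>v. x' < v i' j') (\<lambda>i\<in>{i'}. \<lambda>j\<in>{1..r}. Y j i \<omega>)}"
  proof (rule indep_vars_split[OF iv])
    have m: "(\<lambda>v. v i j :: real) \<in> borel_measurable (Pi\<^sub>M {i} (\<lambda>_. Pi\<^sub>M {1..r} (\<lambda>_. borel)))" if "j \<in> {1..r}" for i :: int and j
    proof (rule measurable_compose[where f="\<lambda>v. v i" and g="\<lambda>v. v j" and N="Pi\<^sub>M {1..r} (\<lambda>_. borel :: real measure)"])
      show "(\<lambda>v. v i) \<in> Pi\<^sub>M {i} (\<lambda>_. Pi\<^sub>M {1..r} (\<lambda>_. borel)) \<rightarrow>\<^sub>M Pi\<^sub>M {1..r} (\<lambda>_. borel :: real measure)"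
        by (rule measurable_component_singleton) simp
      show "(\<lambda>v. v j) \<in> Pi\<^sub>M {1..r} (\<lambda>_. borel) \<rightarrow>\<^sub>M (borel :: real measure)"
        by (rule measurable_component_singleton) (rule that)
    qed
    show "Measurable.pred (Pi\<^sub>M {i} (\<lambda>_. Pi\<^sub>M {1..r} (\<lambda>_. borel))) (\<lambda>v. x < v i j)"
      using m[OF assms(1), of i] by measurable
    show "Measurable.pred (Pi\<^sub>M {i'} (\<lambda>_. Pi\<^sub>M {1..r} (\<lambda>_. borel))) (\<lambda>v. x' < v i' j')"
      using m[OF assms(2), of i'] by measurable
  qed (use assms in auto)
  then show ?thesis using assms by simp
qed

text \<open>
  The Y-vectors need not be functions of the marks, so a large Y at some index is turned into
  a large dater via windows ending at 0, where (AA) applies, and the stationarity of the marks.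
\<close>

lemma single_large_window_small:
  assumes "\<epsilon> > 0"
  shows "\<forall>\<^sub>F x in at_top. \<forall>n. \<forall>q::nat. prob {\<omega>\<in>space M. x < D0 n n \<omega> \<and> D0 n (n + int q) \<omega> \<le> x} \<le> \<epsilon> * tail F x"
proof -
  have "((\<lambda>x. (prob {\<omega>\<in>space M. x < D0 1 1 \<omega>} - prob {\<omega>\<in>space M. x < Ymax 1 \<omega>}) / tail F x) \<longlongrightarrow> 0) at_top"
    using tendsto_diff[OF D0_quotient[of 1] Ymax_quotient[of 1]] by (simp add: diff_divide_distrib)
  from quotient_upper[OF this assms] show ?thesis
  proof eventually_elim
    case (elim x)
    show ?case
    proof (intro allI)
      fix n :: int and q :: nat
      let ?l = "Suc q"
      let ?P = "\<lambda>v. x < window_dater f 1 (\<lambda>i\<in>{..<1}. v i) \<and> window_dater f ?l v \<le> x"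
      have l: "nat (n + int q - n + 1) = ?l" "nat (n - n + 1) = 1" for n by auto
      have re: "(\<lambda>i\<in>{..<1}. (\<lambda>i\<in>{..<?l}. g i) i) = (\<lambda>i\<in>{..<1}. g i)" for g :: "nat \<Rightarrow> 'k" by auto
      have [measurable]: "window_dater f ?l \<in> borel_measurable (Pi\<^sub>M {..<?l} (\<lambda>_. S))"
        by (rule window_dater_measurable[OF network]) simp
      have [measurable]: "(\<lambda>v. window_dater f 1 (\<lambda>i\<in>{..<1}. v i)) \<in> borel_measurable (Pi\<^sub>M {..<?l} (\<lambda>_. S))"
        by (rule measurable_compose[OF _ window_dater_measurable[OF network]]) (auto intro!: measurable_restrict measurable_component_singleton)
      have P: "Measurable.pred (Pi\<^sub>M {..<?l} (\<lambda>_. S)) ?P" by measurable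
      have "prob {\<omega>\<in>space M. x < D0 n n \<omega> \<and> D0 n (n + int q) \<omega> \<le> x} = prob {\<omega>\<in>space M. ?P (\<lambda>i\<in>{..<?l}. \<zeta> (n + int i) \<omega>)}"
        unfolding D0_window l re ..
      \<comment> \<open>The window is translated so that it ends at 0.\<close>
      also have "\<dots> = prob {\<omega>\<in>space M. ?P (\<lambda>i\<in>{..<?l}. \<zeta> (- int q + int i) \<omega>)}"
        by (rule prob_iid_window[OF \<zeta>_iid _ _ P]) (auto simp: inj_on_def)
      also have "\<dots> = prob {\<omega>\<in>space M. x < D0 (- int q) (- int q) \<omega> \<and> D0 (- int q) (- int q + int q) \<omega> \<le> x}"
        unfolding D0_window l re ..
      \<comment> \<open>Almost surely every component at -q is at most the dater of the window
        ending at 0, so a window dater \<le> x forces \<open>Ymax\<close> \<le> x.\<close>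
      also have "\<dots> \<le> prob ({\<omega>\<in>space M. x < D0 (- int q) (- int q) \<omega>} - {\<omega>\<in>space M. x < Ymax (- int q) \<omega>})"
      proof (rule finite_measure_mono_AE)
        have "AE \<omega> in M. \<forall>j\<in>{1..r}. Y j (- int q) \<omega> \<le> D0 (- int q) 0 \<omega>"
          by (rule AE_finite_allI) (auto intro: Y_le_D0)
        then show "AE \<omega> in M. \<omega> \<in> {\<omega>\<in>space M. x < D0 (- int q) (- int q) \<omega> \<and> D0 (- int q) (- int q + int q) \<omega> \<le> x}
           \<longrightarrow> \<omega> \<in> {\<omega>\<in>space M. x < D0 (- int q) (- int q) \<omega>} - {\<omega>\<in>space M. x < Ymax (- int q) \<omega>}"
        proof eventually_elim
          case (elim \<omega>)
          have "x < D0 (- int q) 0 \<omega>" if "x < Ymax (- int q) \<omega>"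
            using that elim unfolding less_Ymax_iff by (meson less_le_trans)
          then show ?case by (simp add: not_less[symmetric]) blast
        qed
        show "{\<omega>\<in>space M. x < D0 (- int q) (- int q) \<omega>} - {\<omega>\<in>space M. x < Ymax (- int q) \<omega>} \<in> events"
          by (intro sets.Diff Ymax_sets) measurable
      qed
      \<comment> \<open>The largest component is also at most the single dater, so one event
        contains the other up to a null set and the probabilities can be subtracted.\<close>
      also have "\<dots> = prob {\<omega>\<in>space M. x < D0 (- int q) (- int q) \<omega>} - prob {\<omega>\<in>space M. x < Ymax (- int q) \<omega>}"
      proof -
        let ?A = "{\<omega>\<in>space M. x < D0 (- int q) (- int q) \<omega>}" and ?B = "{\<omega>\<in>space M. x < Ymax (- int q) \<omega>}"
        have A: "?A \<in> events" by measurable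
        have "AE \<omega> in M. \<forall>j\<in>{1..r}. Y j (- int q) \<omega> \<le> D0 (- int q) (- int q) \<omega>"
          by (rule AE_finite_allI) (auto intro: Y_le_D0_single)
        then have "AE \<omega> in M. (\<omega> \<in> ?A \<inter> ?B) = (\<omega> \<in> ?B)"
        proof eventually_elim
          case (elim \<omega>)
          have "x < D0 (- int q) (- int q) \<omega>" if "x < Ymax (- int q) \<omega>"
            using that elim unfolding less_Ymax_iff by (meson less_le_trans)
          then show ?case by blast
        qed
        then have "prob (?A \<inter> ?B) = prob ?B"
          using A Ymax_sets by (intro measure_eq_AE) auto
        then show ?thesis using finite_measure_Diff'[OF A Ymax_sets] by simp
      qed
      also have "\<dots> = prob {\<omega>\<in>space M. x < D0 1 1 \<omega>} - prob {\<omega>\<in>space M. x < Ymax 1 \<omega>}"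
        using prob_D0_shift[of 1 1 x "- int q - 1"] prob_Ymax[of x "- int q"] by simp
      finally show "prob {\<omega>\<in>space M. x < D0 n n \<omega> \<and> D0 n (n + int q) \<omega> \<le> x} \<le> \<epsilon> * tail F x"
        using elim by simp
    qed
  qed
qed

end

section \<open>Blocks of customers and the bounding walk\<close>

context heavy_network
begin

abbreviation "mark_space \<equiv> (borel :: real measure) \<Otimes>\<^sub>M S"

text \<open>
  The shift \<open>c\<close> aligns interarrival times and marks: the increments \<open>s l - u l\<close> need \<open>c = L - 1\<close>,
  the increments \<open>u (l + 1) - s l\<close> need \<open>c = -1\<close>.
\<close>

definition mark :: "int \<Rightarrow> int \<Rightarrow> 'a \<Rightarrow> real \<times> 'k" where
  "mark c n \<omega> = (\<tau> (n + c) \<omega>, \<zeta> n \<omega>)"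

lemma mark_iid: "iid_sequence M (mark_space) (mark c)"
  unfolding mark_def by (rule iid_sequence_pair[OF IA])

text \<open>\<open>service\<close> and \<open>span\<close> read their arguments from the coordinates
  m, ..., m + L - 1 of a mark sequence; in this form quantities on disjoint index ranges are
  independent at once.\<close>

definition service :: "nat \<Rightarrow> int \<Rightarrow> (int \<Rightarrow> real \<times> 'k) \<Rightarrow> real" where
  "service L m v = window_dater f L (\<lambda>i\<in>{..<L}. snd (v (m + int i)))"

definition span :: "nat \<Rightarrow> int \<Rightarrow> (int \<Rightarrow> real \<times> 'k) \<Rightarrow> real" where
  "span L m v = (\<Sum>i<L. fst (v (m + int i)))"

lemma mark_component_measurable:
  "k \<in> A \<Longrightarrow> (\<lambda>v. v k) \<in> Pi\<^sub>M A (\<lambda>_. mark_space) \<rightarrow>\<^sub>M mark_space"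
  by (rule measurable_component_singleton)

lemma service_measurable:
  assumes "L \<ge> 1" "{m..<m + int L} \<subseteq> A"
  shows "service L m \<in> borel_measurable (Pi\<^sub>M A (\<lambda>_. mark_space))"
  unfolding service_def
proof (rule measurable_compose[OF _ window_dater_measurable[OF network assms(1)]], rule measurable_restrict)
  fix i assume "i \<in> {..<L}"
  then have "m + int i \<in> A" using assms(2) by auto
  from measurable_compose[OF mark_component_measurable[OF this] measurable_snd]
  show "(\<lambda>v. snd (v (m + int i))) \<in> Pi\<^sub>M A (\<lambda>_. mark_space) \<rightarrow>\<^sub>M S" by simp
qed

lemma span_measurable:
  assumes "{m..<m + int L} \<subseteq> A"
  shows "span L m \<in> borel_measurable (Pi\<^sub>M A (\<lambda>_. mark_space))"
  unfolding span_def
proof (rule borel_measurable_sum)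
  fix i assume "i \<in> {..<L}"
  then have "m + int i \<in> A" using assms by auto
  from measurable_compose[OF mark_component_measurable[OF this] measurable_fst]
  show "(\<lambda>v. fst (v (m + int i))) \<in> borel_measurable (Pi\<^sub>M A (\<lambda>_. mark_space))" by simp
qed

lemma service_mark:
  assumes "{m..<m + int L} \<subseteq> A"
  shows "service L m (\<lambda>n\<in>A. mark c n \<omega>) = D0 m (m + int L - 1) \<omega>"
proof -
  have "(\<lambda>i\<in>{..<L}. snd ((\<lambda>n\<in>A. mark c n \<omega>) (m + int i))) = (\<lambda>i\<in>{..<L}. \<zeta> (m + int i) \<omega>)"
    using assms by (intro restrict_ext) (auto simp: mark_def subset_eq)
  then show ?thesis by (simp add: service_def D0_window)
qed

lemma sum_\<tau>: "(\<Sum>i<L. \<tau> (m + int i) \<omega>) = T (m + int L) \<omega> - T m \<omega>"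
  by (induction L) (simp_all add: \<tau>_eq add_ac)

lemma span_mark:
  assumes "{m..<m + int L} \<subseteq> A"
  shows "span L m (\<lambda>n\<in>A. mark c n \<omega>) = T (m + c + int L) \<omega> - T (m + c) \<omega>"
proof -
  have "span L m (\<lambda>n\<in>A. mark c n \<omega>) = (\<Sum>i<L. \<tau> (m + c + int i) \<omega>)"
    unfolding span_def using assms by (intro sum.cong refl) (auto simp: mark_def subset_eq add_ac)
  then show ?thesis by (simp add: sum_\<tau>)
qed

lemma expectation_T: "integrable M (\<lambda>\<omega>. T (m + int L) \<omega> - T m \<omega>)"
  "expectation (\<lambda>\<omega>. T (m + int L) \<omega> - T m \<omega>) = real L * a"
proof -
  show "integrable M (\<lambda>\<omega>. T (m + int L) \<omega> - T m \<omega>)"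
    unfolding sum_\<tau>[symmetric] by (intro Bochner_Integration.integrable_sum \<tau>_integrable)
  show "expectation (\<lambda>\<omega>. T (m + int L) \<omega> - T m \<omega>) = real L * a"
    unfolding sum_\<tau>[symmetric] by (subst Bochner_Integration.integral_sum) (auto simp: \<tau>_integrable \<tau>_mean)
qed

definition first :: "nat \<Rightarrow> nat \<Rightarrow> int" where "first L l = - (int l + 1) * int L + 1"

lemma first_eq: "first L l + int L - 1 = - int l * int L"
  by (simp add: first_def algebra_simps)

lemma first_disjoint: "k < l \<Longrightarrow> first L l + int L \<le> first L k"
proof -
  assume "k < l"
  then have "int L * 1 \<le> int L * (int l - int k)" by (intro mult_left_mono) auto
  then show ?thesis by (simp add: first_def algebra_simps)
qed

definition s :: "nat \<Rightarrow> nat \<Rightarrow> 'a \<Rightarrow> real" where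
  "s L l \<omega> = D0 (- (int l + 1) * int L + 1) (- int l * int L) \<omega>"

text \<open>The time from the end of block \<open>l\<close> to the end of the block after it; for l
  = 0 it reaches into the future, up to arrival \<open>L\<close>.\<close>

definition u :: "nat \<Rightarrow> nat \<Rightarrow> 'a \<Rightarrow> real" where
  "u L l \<omega> = T (- (int l - 1) * int L) \<omega> - T (- int l * int L) \<omega>"

lemma s_measurable[measurable]: "L \<ge> 1 \<Longrightarrow> s L l \<in> borel_measurable M"
  unfolding s_def using first_eq[of L l] by (intro D0_measurable) (simp add: first_def)

lemma u_measurable[measurable]: "u L l \<in> borel_measurable M"
  unfolding u_def by measurable

lemma u_nonneg: "\<omega> \<in> space M \<Longrightarrow> 0 \<le> u L l \<omega>"
  using monoD[OF T_mono, of \<omega> "- int l * int L" "- (int l - 1) * int L"]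
  by (simp add: u_def algebra_simps)

lemma s_eq: "s L l \<omega> = D0 (first L l) (first L l + int L - 1) \<omega>"
  unfolding first_eq by (simp add: s_def first_def)

lemma u_eq: "u L l \<omega> = T (- int l * int L + int L) \<omega> - T (- int l * int L) \<omega>"
  by (simp add: u_def algebra_simps)

lemma s_integral: "L \<ge> 1 \<Longrightarrow> integrable M (s L l)" "L \<ge> 1 \<Longrightarrow> expectation (s L l) = e L"
  unfolding s_eq by (auto intro!: D0_integrable simp: e_eq)

lemma u_integral: "integrable M (u L l)" "expectation (u L l) = real L * a"
  unfolding u_eq by (rule expectation_T)+

text \<open>The event that the walk bounding \<open>Z\<close> exceeds \<open>x\<close>. The sum
  begins with \<open>s L 0\<close> alone, because the dater is measured from arrival 0, the end of
  block 0.\<close>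

definition blocks :: "nat \<Rightarrow> real \<Rightarrow> 'a set" where
  "blocks L x = {\<omega>\<in>space M. \<exists>q. x < s L 0 \<omega> + (\<Sum>l\<in>{0<..q}. s L l \<omega> - u L l \<omega>)}"

lemma blocks_measurable: "L \<ge> 1 \<Longrightarrow> blocks L x \<in> events"
  unfolding blocks_def by measurable

lemma stationary_dater_subset_blocks:
  assumes "L \<ge> 1"
  shows "{\<omega>\<in>space M. ereal x < stationary_dater f (\<lambda>k. T k \<omega>) (\<lambda>k. \<zeta> k \<omega>)} \<subseteq> blocks L x"
proof safe
  fix \<omega> assume w: "\<omega> \<in> space M" "ereal x < stationary_dater f (\<lambda>k. T k \<omega>) (\<lambda>k. \<zeta> k \<omega>)"
  from network.stationary_dater_blocks[OF network_at[OF w(1)] T_mono[OF w(1)] assms w(2)]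
  show "\<omega> \<in> blocks L x" using w(1) by (simp add: blocks_def s_def u_def)
qed

text \<open>The first family consists of the steps in the upper bound. The second pairs the dater of
  block \<open>l\<close> with the gap leading into that block, and measures how much of an earlier
  jump drains away on the way to 0; \<open>c\<close> will be the slope of a comparison line.\<close>

lemma increments_iid:
  assumes "L \<ge> 1"
  shows "indep_vars (\<lambda>_. borel) (\<lambda>l \<omega>. s L l \<omega> - u L l \<omega>) UNIV"
    "distr M borel (\<lambda>\<omega>. s L l \<omega> - u L l \<omega>) = distr M borel (\<lambda>\<omega>. s L 0 \<omega> - u L 0 \<omega>)"
    "indep_vars (\<lambda>_. borel) (\<lambda>l \<omega>. u L (Suc l) \<omega> - s L l \<omega> - c) UNIV"
    "distr M borel (\<lambda>\<omega>. u L (Suc l) \<omega> - s L l \<omega> - c) = distr M borel (\<lambda>\<omega>. u L (Suc 0) \<omega> - s L 0 \<omega> - c)"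
proof -
  define GS :: "(nat \<Rightarrow> real \<times> 'k) \<Rightarrow> real" where "GS v = window_dater f L (\<lambda>i\<in>{..<L}. snd (v i))" for v
  define GU :: "(nat \<Rightarrow> real \<times> 'k) \<Rightarrow> real" where "GU v = (\<Sum>i<L. fst (v i))" for v
  have c: "(\<lambda>v. v i) \<in> Pi\<^sub>M {..<L} (\<lambda>_. mark_space) \<rightarrow>\<^sub>M mark_space" if "i \<in> {..<L}" for i
    using that by (rule measurable_component_singleton)
  have GS: "GS \<in> borel_measurable (Pi\<^sub>M {..<L} (\<lambda>_. mark_space))"
    unfolding GS_def
    by (rule measurable_compose[OF measurable_restrict window_dater_measurable[OF network assms]])
       (rule measurable_compose[OF c measurable_snd])
  have GU: "GU \<in> borel_measurable (Pi\<^sub>M {..<L} (\<lambda>_. mark_space))"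
    unfolding GU_def by (rule borel_measurable_sum) (rule measurable_compose[OF c measurable_fst])
  have gs: "GS (\<lambda>i\<in>{..<L}. mark c (first L l + int i) \<omega>) = s L l \<omega>" for c l \<omega>
  proof -
    have "(\<lambda>i\<in>{..<L}. snd ((\<lambda>i\<in>{..<L}. mark c (first L l + int i) \<omega>) i)) = (\<lambda>i\<in>{..<L}. \<zeta> (first L l + int i) \<omega>)"
      by (intro restrict_ext) (simp add: mark_def)
    then show ?thesis unfolding s_eq D0_window by (simp add: GS_def)
  qed
  have gu: "GU (\<lambda>i\<in>{..<L}. mark c (first L l + int i) \<omega>) = T (first L l + c + int L) \<omega> - T (first L l + c) \<omega>" for c l \<omega>
    unfolding GU_def sum_\<tau>[symmetric] by (intro sum.cong refl) (simp add: mark_def add_ac)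
  have u1: "T (first L l + (int L - 1) + int L) \<omega> - T (first L l + (int L - 1)) \<omega> = u L l \<omega>" for l \<omega>
  proof -
    have "first L l + (int L - 1) = - int l * int L" using first_eq[of L l] by simp
    then show ?thesis unfolding u_eq by (simp only:)
  qed
  have u2: "T (first L l + - 1 + int L) \<omega> - T (first L l + - 1) \<omega> = u L (Suc l) \<omega>" for l \<omega>
  proof -
    have "first L l + - 1 = - int (Suc l) * int L" by (simp add: first_def)
    then show ?thesis unfolding u_eq by (simp only:)
  qed
  have m1: "(\<lambda>v. GS v - GU v) \<in> borel_measurable (Pi\<^sub>M {..<L} (\<lambda>_. mark_space))"
    using GS GU by (rule borel_measurable_diff)
  have m2: "(\<lambda>v. GU v - GS v - c) \<in> borel_measurable (Pi\<^sub>M {..<L} (\<lambda>_. mark_space))"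
    by (intro borel_measurable_diff GS GU borel_measurable_const)
  note b1 = iid_blocks[where e="first L", OF mark_iid[of "int L - 1"] first_disjoint m1, unfolded gs gu u1]
  note b2 = iid_blocks[where e="first L", OF mark_iid[of "- 1"] first_disjoint m2, unfolded gs gu u2]
  show "indep_vars (\<lambda>_. borel) (\<lambda>l \<omega>. s L l \<omega> - u L l \<omega>) UNIV"
    "distr M borel (\<lambda>\<omega>. s L l \<omega> - u L l \<omega>) = distr M borel (\<lambda>\<omega>. s L 0 \<omega> - u L 0 \<omega>)"
    by (rule b1, assumption)+
  show "indep_vars (\<lambda>_. borel) (\<lambda>l \<omega>. u L (Suc l) \<omega> - s L l \<omega> - c) UNIV"
    "distr M borel (\<lambda>\<omega>. u L (Suc l) \<omega> - s L l \<omega> - c) = distr M borel (\<lambda>\<omega>. u L (Suc 0) \<omega> - s L 0 \<omega> - c)"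
    by (rule b2, assumption)+
qed

text \<open>By subadditivity a block dater is at most the sum of its \<open>L\<close> single daters,
  which are i.i.d. with tail constant \<open>dd\<close>.\<close>

lemma block_tail: "L \<ge> 1 \<Longrightarrow> SE.tail_at_most M (s L 0) (real L * dd)"
proof -
  assume L: "L \<ge> 1"
  let ?I = "{- int L + 1..0}"
  have "indep_vars (\<lambda>_. borel) (\<lambda>k. window_dater f 1 \<circ> (\<lambda>\<omega>. \<lambda>i\<in>{..<1}. \<zeta> (k + int i) \<omega>)) ?I"
  proof -
    have "indep_vars (\<lambda>_. S) \<zeta> UNIV" using \<zeta>_iid by (simp add: iid_sequence_def)
    then have i: "indep_vars (\<lambda>_. S) \<zeta> ?I" by (rule indep_vars_subset) simp
    have m: "(\<lambda>z. \<lambda>i\<in>{..<1::nat}. z) \<in> S \<rightarrow>\<^sub>M Pi\<^sub>M {..<1} (\<lambda>_. S)" by (rule measurable_restrict) simp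
    have "indep_vars (\<lambda>_. borel) (\<lambda>k \<omega>. window_dater f 1 (\<lambda>i\<in>{..<1}. \<zeta> k \<omega>)) ?I"
      by (rule indep_vars_compose2[OF i measurable_compose[OF m window_dater_measurable[OF network]]]) simp
    moreover have "(\<lambda>i\<in>{..<1}. \<zeta> k \<omega>) = (\<lambda>i\<in>{..<1}. \<zeta> (k + int i) \<omega>)" for k \<omega>
      by (rule restrict_ext) simp
    ultimately show ?thesis by (simp add: comp_def)
  qed
  moreover have "(\<lambda>k. window_dater f 1 \<circ> (\<lambda>\<omega>. \<lambda>i\<in>{..<1}. \<zeta> (k + int i) \<omega>)) = (\<lambda>k. D0 k k)"
    unfolding D0_window by (simp add: comp_def)
  ultimately have "indep_vars (\<lambda>_. borel) (\<lambda>k. D0 k k) ?I" by simp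
  then have "SE.tail_at_most M (\<lambda>\<omega>. \<Sum>k\<in>?I. D0 k k \<omega>) (\<Sum>k\<in>?I. dd)"
    using dd_pos by (intro SE.tail_at_most_sum)
      (auto simp: SE.tail_at_most_def prob_space_axioms intro!: quotient_upper[OF D0_quotient])
  then have t: "SE.tail_at_most M (\<lambda>\<omega>. \<Sum>k\<in>?I. D0 k k \<omega>) (real L * dd)" by simp
  have "prob {\<omega>\<in>space M. x < s L 0 \<omega>} \<le> prob {\<omega>\<in>space M. x < (\<Sum>k\<in>?I. D0 k k \<omega>)}" for x
  proof (rule finite_measure_mono)
    show "{\<omega>\<in>space M. x < s L 0 \<omega>} \<subseteq> {\<omega>\<in>space M. x < (\<Sum>k\<in>?I. D0 k k \<omega>)}"
    proof safe
      fix \<omega> assume w: "\<omega> \<in> space M" "x < s L 0 \<omega>"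
      then show "x < (\<Sum>k\<in>?I. D0 k k \<omega>)"
        using network.dater0_le_sum[OF network_at[OF w(1)], of "- int L + 1" 0] L
        by (simp add: s_def)
    qed
    have "(\<lambda>\<omega>. \<Sum>k\<in>?I. D0 k k \<omega>) \<in> borel_measurable M" by (intro borel_measurable_sum D0_measurable) simp
    then show "{\<omega>\<in>space M. x < (\<Sum>k\<in>?I. D0 k k \<omega>)} \<in> events" by measurable
  qed
  note le = this
  show ?thesis unfolding SE.tail_at_most_def
  proof (intro allI impI)
    fix c' assume "real L * dd < c'"
    from SE.tail_at_mostD[OF t this] show "\<forall>\<^sub>F x in at_top. prob {\<omega>\<in>space M. x < s L 0 \<omega>} \<le> c' * tail F x"
      by eventually_elim (rule order_trans[OF le])
  qed
qed

text \<open>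
  The walk bounding \<open>Z\<close> starts with \<open>s L 0\<close> and not with an increment. Subtracting the independent
  span \<open>u L 0\<close> of the arrivals after time 0 makes it a random walk, without a convolution argument.
\<close>

lemma prob_blocks_split:
  assumes L: "L \<ge> 1"
  shows "prob (blocks L x \<inter> {\<omega>\<in>space M. u L 0 \<omega> \<le> B}) = prob (blocks L x) * prob {\<omega>\<in>space M. u L 0 \<omega> \<le> B}"
proof -
  have iv: "indep_vars (\<lambda>_. mark_space) (mark (-1)) UNIV"
    using mark_iid by (simp add: iid_sequence_def)
  \<comment> \<open>The blocks occupy indices up to 0. With shift -1 the coordinate at
    \<open>n\<close> carries the gap before arrival \<open>n\<close>, so \<open>u L 0\<close> is
    made of the coordinates 1 to \<open>L\<close>.\<close>
  have sub: "{first L l..<first L l + int L} \<subseteq> {..0}" for l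
    using first_eq[of L l] by (auto simp: algebra_simps) (smt (verit) mult_nonneg_nonneg of_nat_0_le_iff)
  let ?P = "\<lambda>v. \<exists>q. x < service L (first L 0) v + (\<Sum>l\<in>{0<..q}. service L (first L l) v - span L (first L (l - 1)) v)"
  let ?Q = "\<lambda>v. span L 1 v \<le> B"
  have [measurable]: "service L (first L l) \<in> borel_measurable (Pi\<^sub>M {..0} (\<lambda>_. mark_space))"
     "span L (first L l) \<in> borel_measurable (Pi\<^sub>M {..0} (\<lambda>_. mark_space))" for l
    by (rule service_measurable[OF L sub], rule span_measurable[OF sub])
  have P: "Measurable.pred (Pi\<^sub>M {..0} (\<lambda>_. mark_space)) ?P" by measurable
  have sub1: "{1..<1 + int L} \<subseteq> {1..}" by auto
  have [measurable]: "span L 1 \<in> borel_measurable (Pi\<^sub>M {1..} (\<lambda>_. mark_space))"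
    by (rule span_measurable[OF sub1])
  have Q: "Measurable.pred (Pi\<^sub>M {1..} (\<lambda>_. mark_space)) ?Q" by measurable
  have Pe: "?P (\<lambda>n\<in>{..0}. mark (-1) n \<omega>) \<longleftrightarrow> (\<exists>q. x < s L 0 \<omega> + (\<Sum>l\<in>{0<..q}. s L l \<omega> - u L l \<omega>))" for \<omega>
  proof -
    have "service L (first L l) (\<lambda>n\<in>{..0}. mark (-1) n \<omega>) = s L l \<omega>" for l
      unfolding service_mark[OF sub] s_eq ..
    moreover have "span L (first L (l - 1)) (\<lambda>n\<in>{..0}. mark (-1) n \<omega>) = u L l \<omega>" if "l > 0" for l
    proof -
      have "int (l - 1) + 1 = int l" using that by simp
      then show ?thesis unfolding span_mark[OF sub] u_eq by (simp add: first_def)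
    qed
    ultimately show ?thesis by simp
  qed
  have Qe: "?Q (\<lambda>n\<in>{1..}. mark (-1) n \<omega>) \<longleftrightarrow> u L 0 \<omega> \<le> B" for \<omega>
    unfolding span_mark[OF sub1] u_eq by simp
  have "prob {\<omega>\<in>space M. ?P (\<lambda>n\<in>{..0}. mark (-1) n \<omega>) \<and> ?Q (\<lambda>n\<in>{1..}. mark (-1) n \<omega>)}
      = prob {\<omega>\<in>space M. ?P (\<lambda>n\<in>{..0}. mark (-1) n \<omega>)} * prob {\<omega>\<in>space M. ?Q (\<lambda>n\<in>{1..}. mark (-1) n \<omega>)}"
    by (rule indep_vars_split[OF iv _ P Q]) auto
  moreover have "blocks L x \<inter> {\<omega>\<in>space M. u L 0 \<omega> \<le> B} = {\<omega>\<in>space M. (\<exists>q. x < s L 0 \<omega> + (\<Sum>l\<in>{0<..q}. s L l \<omega> - u L l \<omega>)) \<and> u L 0 \<omega> \<le> B}"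
    by (auto simp: blocks_def)
  ultimately show ?thesis unfolding Pe Qe blocks_def by simp
qed

text \<open>The steps of the block walk have mean e L - L * a and tail constant L * dd; the quotient
  of the constant and the drift is dd / (a - e L / L).\<close>

lemma prob_blocks_upper:
  assumes L: "L \<ge> 1" and "e L / real L < a" "dd / (a - e L / real L) < k"
  shows "\<forall>\<^sub>F x in at_top. prob (blocks L x) \<le> k * SE.H x"
proof -
  define mu where "mu = real L * a - e L"
  have mu: "mu > 0" using assms by (simp add: mu_def field_simps)
  have c: "real L * dd / mu = dd / (a - e L / real L)"
  proof -
    have "mu = real L * (a - e L / real L)" using L by (simp add: mu_def field_simps)
    then show ?thesis using L by simp
  qed
  obtain k1 where k1: "real L * dd / mu < k1" "k1 < k" using dense assms(3) unfolding c by blast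
  have "0 \<le> real L * dd / mu" using mu dd_pos by simp
  then have k1p: "k1 > 0" using k1(1) by linarith
  have ev: "\<forall>\<^sub>F x in at_top. prob {\<omega>\<in>space M. \<exists>n. x < (\<Sum>l<n. s L l \<omega> - u L l \<omega>)} \<le> k1 * SE.H x"
  proof (rule iid_walk_supremum_tail[where c="real L * dd" and mu=mu])
    show "subexponential_integrated F" by (rule SE.subexponential_integrated_axioms)
    show "indep_vars (\<lambda>_. borel) (\<lambda>l \<omega>. s L l \<omega> - u L l \<omega>) UNIV" by (rule increments_iid(1)[OF L])
    show "distr M borel (\<lambda>\<omega>. s L n \<omega> - u L n \<omega>) = distr M borel (\<lambda>\<omega>. s L 0 \<omega> - u L 0 \<omega>)" for n
      by (rule increments_iid(2)[OF L])
    show "integrable M (\<lambda>\<omega>. s L 0 \<omega> - u L 0 \<omega>)"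
      by (intro Bochner_Integration.integrable_diff s_integral u_integral L)
    show "expectation (\<lambda>\<omega>. s L 0 \<omega> - u L 0 \<omega>) = - mu"
      using L by (simp add: s_integral u_integral mu_def)
    fix c' assume "real L * dd < c'"
    from SE.tail_at_mostD[OF block_tail[OF L] this]
    show "\<forall>\<^sub>F x in at_top. prob {\<omega>\<in>space M. x < s L 0 \<omega> - u L 0 \<omega>} \<le> c' * tail F x"
    proof eventually_elim
      case (elim x)
      have "prob {\<omega>\<in>space M. x < s L 0 \<omega> - u L 0 \<omega>} \<le> prob {\<omega>\<in>space M. x < s L 0 \<omega>}"
        using s_measurable[OF L, of 0] u_nonneg by (intro finite_measure_mono) (auto simp: less_diff_eq intro: le_less_trans[rotated] add_increasing2)
      then show ?case using elim by simp
    qed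
  qed (use mu dd_pos k1 in auto)
  \<comment> \<open>The factor 1 - \<delta> is lost twice, once for P(u L 0 \<le> B) and once for
    the shift by \<open>B\<close>; its square is k1 / k.\<close>
  define \<delta> where "\<delta> = 1 - sqrt (k1 / k)"
  have kk: "0 < k1 / k" "k1 / k < 1" using k1 k1p by auto
  have \<delta>: "\<delta> > 0" "\<delta> < 1" using kk by (auto simp: \<delta>_def)
  have sq: "(1 - \<delta>) * (1 - \<delta>) * k = k1" using kk k1 k1p by (simp add: \<delta>_def)
  obtain B :: nat where B: "prob {\<omega>\<in>space M. u L 0 \<omega> \<le> real B} > 1 - \<delta>"
  proof -
    have "(\<lambda>B::nat. prob {\<omega>\<in>space M. u L 0 \<omega> \<le> real B}) \<longlonglongrightarrow> prob (\<Union>B::nat. {\<omega>\<in>space M. u L 0 \<omega> \<le> real B})"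
      by (rule finite_Lim_measure_incseq) (auto simp: incseq_def)
    moreover have "(\<Union>B::nat. {\<omega>\<in>space M. u L 0 \<omega> \<le> real B}) = space M"
      using real_arch_simple by auto
    ultimately have "(\<lambda>B::nat. prob {\<omega>\<in>space M. u L 0 \<omega> \<le> real B}) \<longlonglongrightarrow> 1" by (simp add: prob_space)
    then have "\<forall>\<^sub>F B in sequentially. prob {\<omega>\<in>space M. u L 0 \<omega> \<le> real B} > 1 - \<delta>"
      using \<delta> by (intro order_tendstoD(1)) auto
    then show ?thesis using that by (auto simp: eventually_sequentially)
  qed
  have "1 / (1 - \<delta>) > 1" using \<delta> by simp
  from eventually_at_top_shift[OF ev, of "- real B"] SE.I.long_tailed[OF this, of "real B"] show ?thesis
  proof eventually_elim
    case (elim x)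
    have "prob (blocks L x) * (1 - \<delta>) \<le> prob (blocks L x) * prob {\<omega>\<in>space M. u L 0 \<omega> \<le> real B}"
      using B by (intro mult_left_mono) auto
    also have "\<dots> = prob (blocks L x \<inter> {\<omega>\<in>space M. u L 0 \<omega> \<le> real B})" by (rule prob_blocks_split[OF L, symmetric])
    also have "\<dots> \<le> prob {\<omega>\<in>space M. \<exists>n. x + - real B < (\<Sum>l<n. s L l \<omega> - u L l \<omega>)}"
    proof (rule finite_measure_mono)
      show "blocks L x \<inter> {\<omega>\<in>space M. u L 0 \<omega> \<le> real B} \<subseteq> {\<omega>\<in>space M. \<exists>n. x + - real B < (\<Sum>l<n. s L l \<omega> - u L l \<omega>)}"
      proof
        fix \<omega> assume "\<omega> \<in> blocks L x \<inter> {\<omega>\<in>space M. u L 0 \<omega> \<le> real B}"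
        then obtain q where q: "\<omega> \<in> space M" "x < s L 0 \<omega> + (\<Sum>l\<in>{0<..q}. s L l \<omega> - u L l \<omega>)" "u L 0 \<omega> \<le> real B"
          unfolding blocks_def by blast
        have "{..<Suc q} = insert 0 {0<..q}" by auto
        then have "(\<Sum>l<Suc q. s L l \<omega> - u L l \<omega>) = s L 0 \<omega> - u L 0 \<omega> + (\<Sum>l\<in>{0<..q}. s L l \<omega> - u L l \<omega>)"
          by simp
        then have "x + - real B < (\<Sum>l<Suc q. s L l \<omega> - u L l \<omega>)" using q by linarith
        then show "\<omega> \<in> {\<omega>\<in>space M. \<exists>n. x + - real B < (\<Sum>l<n. s L l \<omega> - u L l \<omega>)}" using q(1) by blast
      qed
      show "{\<omega>\<in>space M. \<exists>n. x + - real B < (\<Sum>l<n. s L l \<omega> - u L l \<omega>)} \<in> events"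
        using s_measurable[OF L] by measurable
    qed
    also have "\<dots> \<le> k1 * SE.H (x - real B)" using elim(1) by simp
    also have "\<dots> \<le> k1 * (1 / (1 - \<delta>) * SE.H x)" using elim(2) k1p by (intro mult_left_mono) auto
    also have "\<dots> = (k * SE.H x) * (1 - \<delta>)"
      using \<delta> sq[symmetric] by simp
    finally show ?case using \<delta> by (simp add: mult_le_cancel_right)
  qed
qed

end

text \<open>A Bonferroni inequality over ordered pairs: every overlap is counted twice, a harmless
  factor that keeps the double sum symmetric.\<close>

lemma (in prob_space) sum_prob_le_Union:
  assumes "finite I" "\<And>i. i \<in> I \<Longrightarrow> E i \<in> events"
  shows "(\<Sum>i\<in>I. prob (E i)) \<le> prob (\<Union>i\<in>I. E i) + (\<Sum>i\<in>I. \<Sum>k\<in>I - {i}. prob (E i \<inter> E k))"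
  using assms
proof (induction I)
  case (insert i I)
  let ?U = "\<Union>k\<in>I. E k"
  let ?R = "\<lambda>I. \<Sum>i\<in>I. \<Sum>k\<in>I - {i}. prob (E i \<inter> E k)"
  have U: "?U \<in> events" using insert by (intro sets.finite_UN) auto
  have "prob (E i \<inter> ?U) \<le> (\<Sum>k\<in>I. prob (E i \<inter> E k))"
  proof -
    have "prob (\<Union>k\<in>I. E i \<inter> E k) \<le> (\<Sum>k\<in>I. prob (E i \<inter> E k))"
      using insert by (intro finite_measure_subadditive_finite) auto
    then show ?thesis by simp
  qed
  moreover have "prob (E i \<union> ?U) = prob (E i) + prob ?U - prob (E i \<inter> ?U)"
    using insert U by (simp add: measure_Un3 emeasure_eq_measure fmeasurableI)
  moreover have "?R I + (\<Sum>k\<in>I. prob (E i \<inter> E k)) \<le> ?R (insert i I)"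
  proof -
    have "?R (insert i I) = (\<Sum>k\<in>insert i I - {i}. prob (E i \<inter> E k)) + (\<Sum>l\<in>I. \<Sum>k\<in>insert i I - {l}. prob (E l \<inter> E k))"
      using insert by simp
    also have "insert i I - {i} = I" using insert by auto
    finally have "?R (insert i I) = (\<Sum>k\<in>I. prob (E i \<inter> E k)) + (\<Sum>l\<in>I. \<Sum>k\<in>insert i I - {l}. prob (E l \<inter> E k))" .
    moreover have "?R I \<le> (\<Sum>l\<in>I. \<Sum>k\<in>insert i I - {l}. prob (E l \<inter> E k))"
      using insert by (intro sum_mono sum_mono2) auto
    ultimately show ?thesis by linarith
  qed
  moreover have "(\<Sum>k\<in>I. prob (E k)) \<le> prob ?U + ?R I" using insert by auto
  ultimately show ?case using insert by simp
qed simp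

section \<open>Overlapping jumps and the lower bound through big jumps\<close>

context heavy_network
begin

text \<open>Two jumps at different indices are independent, so their joint probability is quadratic
  in \<open>tail F\<close>; two at the same index involve different components and fall under
  \<open>Y_pair_upper\<close>. Summed over all pairs this gives O(H^2) plus a small multiple of H.
  The threshold for \<open>x\<close> is the same for all \<open>E\<close> and \<open>I\<close>, so
  jumps may be intersected with arbitrary events.\<close>

lemma overlap_negligible:
  assumes c: "c > 0" and \<epsilon>: "\<epsilon> > 0"
  shows "\<forall>\<^sub>F x in at_top. \<forall>E I. finite I \<longrightarrow> I \<subseteq> {1..r} \<times> UNIV \<longrightarrow>
    (\<forall>j n. (j, n) \<in> I \<longrightarrow> E (j, n) \<in> events \<and> E (j, n) \<subseteq> {\<omega>\<in>space M. x + real n * c < Y j (- int n) \<omega>}) \<longrightarrow>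
    (\<Sum>i\<in>I. prob (E i)) \<le> prob (\<Union>i\<in>I. E i) + \<epsilon> * SE.H x"
proof -
  define C where "C = dd + 1"
  define k where "k = 1 / c + 1"
  define R where "R = real r * real r"
  \<comment> \<open>Half of \<epsilon> goes to pairs with equal index, as R * \<delta> * k =
    \<epsilon> / 2; the other half covers the quadratic part once \<open>H x\<close> is
    small.\<close>
  define \<delta> where "\<delta> = \<epsilon> / (2 * R * k)"
  have pos: "C > 0" "k > 0" "R > 0" using dd_pos c r_pos by (auto simp: C_def k_def R_def add_pos_pos)
  have \<delta>: "\<delta> > 0" using \<epsilon> pos by (simp add: \<delta>_def)
  obtain x1 where x1: "\<And>x j i. x \<ge> x1 \<Longrightarrow> j \<in> {1..r} \<Longrightarrow> prob {\<omega>\<in>space M. x < Y j i \<omega>} \<le> C * tail F x"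
    using Y_upper unfolding eventually_at_top_linorder C_def by blast
  obtain x2 where x2: "\<And>x j j' i. x \<ge> x2 \<Longrightarrow> j \<in> {1..r} \<Longrightarrow> j' \<in> {1..r} \<Longrightarrow> j \<noteq> j' \<Longrightarrow>
      prob {\<omega>\<in>space M. x < Y j i \<omega> \<and> x < Y j' i \<omega>} \<le> \<delta> * tail F x"
    using Y_pair_upper[OF \<delta>] unfolding eventually_at_top_linorder by blast
  have k: "1 / c < k" by (simp add: k_def)
  have "\<epsilon> / (2 * R * C^2 * k^2) > 0" using \<epsilon> pos by simp
  from SE.I.tail_less[OF this] SE.sum_tail_upper[OF c k] eventually_ge_at_top[of x1] eventually_ge_at_top[of x2]
  show ?thesis
  proof eventually_elim
    case (elim x)
    show ?case
    proof (intro allI impI)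
      fix E :: "nat \<times> nat \<Rightarrow> 'a set" and I
      assume I: "finite I" "I \<subseteq> {1..r} \<times> UNIV"
        and "\<forall>j n. (j, n) \<in> I \<longrightarrow> E (j, n) \<in> events \<and> E (j, n) \<subseteq> {\<omega>\<in>space M. x + real n * c < Y j (- int n) \<omega>}"
      then have E: "\<And>j n. (j, n) \<in> I \<Longrightarrow> E (j, n) \<in> events"
        "\<And>j n. (j, n) \<in> I \<Longrightarrow> E (j, n) \<subseteq> {\<omega>\<in>space M. x + real n * c < Y j (- int n) \<omega>}" by auto
      define t where "t n = tail F (x + real n * c)" for n :: nat
      have t0: "t n \<ge> 0" for n by (simp add: t_def SE.tail_nonneg)
      define W where "W p q = C^2 * (t (snd p) * t (snd q)) + (if snd p = snd q then \<delta> * t (snd p) else 0)" for p q :: "nat \<times> nat"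
      have W0: "W p q \<ge> 0" for p q using \<delta> t0 by (auto simp: W_def intro!: add_nonneg_nonneg mult_nonneg_nonneg)
      have xx: "x + real n * c \<ge> x1" "x + real n * c \<ge> x2" for n :: nat
      proof -
        have "x \<le> x + real n * c" using c by simp
        then show "x + real n * c \<ge> x1" "x + real n * c \<ge> x2" using elim(3,4) by linarith+
      qed
      have pair: "prob (E p \<inter> E q) \<le> W p q" if pq: "p \<in> I" "q \<in> I - {p}" for p q
      proof -
        obtain j n j' n' where p: "p = (j, n)" "q = (j', n')" by (metis surj_pair)
        have j: "j \<in> {1..r}" "j' \<in> {1..r}" using pq I p by auto
        have ev: "{\<omega>\<in>space M. x + real n * c < Y j (- int n) \<omega> \<and> x + real n' * c < Y j' (- int n') \<omega>} \<in> events"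
          by (intro sets.sets_Collect_conj Y_sets j)
        have "prob (E p \<inter> E q) \<le> prob {\<omega>\<in>space M. x + real n * c < Y j (- int n) \<omega> \<and> x + real n' * c < Y j' (- int n') \<omega>}"
          using E(2)[of j n] E(2)[of j' n'] pq p by (intro finite_measure_mono ev) auto
        also have "\<dots> \<le> W p q"
        proof (cases "n = n'")
          case True
          then have "j \<noteq> j'" using pq p by auto
          then have "prob {\<omega>\<in>space M. x + real n * c < Y j (- int n) \<omega> \<and> x + real n * c < Y j' (- int n) \<omega>} \<le> \<delta> * t n"
            unfolding t_def by (intro x2 j xx)
          also have "\<dots> \<le> W p q" using True t0 by (simp add: W_def p)
          finally show ?thesis using True by simp
        next
          case False
          then have "prob {\<omega>\<in>space M. x + real n * c < Y j (- int n) \<omega> \<and> x + real n' * c < Y j' (- int n') \<omega>}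
             = prob {\<omega>\<in>space M. x + real n * c < Y j (- int n) \<omega>} * prob {\<omega>\<in>space M. x + real n' * c < Y j' (- int n') \<omega>}"
            using Y_indep[OF j, of "- int n" "- int n'"] by simp
          also have "\<dots> \<le> (C * t n) * (C * t n')"
            unfolding t_def using pos by (intro mult_mono x1 xx j) (auto simp: SE.tail_nonneg)
          also have "\<dots> = W p q" using False by (simp add: W_def p power2_eq_square)
          finally show ?thesis .
        qed
        finally show ?thesis .
      qed
      define J where "J = snd ` I"
      have J: "finite J" "I \<subseteq> {1..r} \<times> J" using I by (auto simp: J_def rev_image_eqI)
      define S1 where "S1 = (\<Sum>n\<in>J. t n)"
      have S1: "0 \<le> S1" "S1 \<le> k * SE.H x"
        using elim(2) J(1) t0 by (auto simp: S1_def t_def intro!: sum_nonneg SE.tail_nonneg)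
      have "(\<Sum>i\<in>I. \<Sum>q\<in>I - {i}. prob (E i \<inter> E q)) \<le> (\<Sum>i\<in>I. \<Sum>q\<in>I - {i}. W i q)"
        by (intro sum_mono pair)
      also have "\<dots> \<le> (\<Sum>i\<in>I. \<Sum>q\<in>{1..r} \<times> J. W i q)"
        using J by (intro sum_mono sum_mono2) (auto simp: W0)
      also have "\<dots> \<le> (\<Sum>i\<in>{1..r} \<times> J. \<Sum>q\<in>{1..r} \<times> J. W i q)"
        using J by (intro sum_mono2 sum_nonneg) (auto simp: W0)
      also have "\<dots> = R * (C^2 * S1 * S1 + \<delta> * S1)"
      proof -
        have "(\<Sum>q\<in>{1..r} \<times> J. W p q) = real r * (C^2 * t (snd p) * S1 + \<delta> * t (snd p))" if "snd p \<in> J" for p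
        proof -
          have inner: "(\<Sum>n'\<in>J. W p (j', n')) = C^2 * t (snd p) * S1 + \<delta> * t (snd p)" for j'
            using J(1) that by (simp add: W_def sum.distrib S1_def sum_distrib_left mult.assoc)
          have "(\<Sum>q\<in>{1..r} \<times> J. W p q) = (\<Sum>j'\<in>{1..r}. \<Sum>n'\<in>J. W p (j', n'))"
            by (simp add: sum.cartesian_product)
          also have "\<dots> = real r * (C^2 * t (snd p) * S1 + \<delta> * t (snd p))"
            unfolding inner by simp
          finally show ?thesis .
        qed
        then have "(\<Sum>i\<in>{1..r} \<times> J. \<Sum>q\<in>{1..r} \<times> J. W i q) = (\<Sum>i\<in>{1..r} \<times> J. real r * (C^2 * t (snd i) * S1 + \<delta> * t (snd i)))"
          by (intro sum.cong) auto
        also have "\<dots> = (\<Sum>j\<in>{1..r}. \<Sum>n\<in>J. real r * (C^2 * t n * S1 + \<delta> * t n))"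
          unfolding sum.cartesian_product by (simp add: case_prod_beta')
        also have "(\<Sum>n\<in>J. real r * (C^2 * t n * S1 + \<delta> * t n)) = real r * (C^2 * S1 * S1 + \<delta> * S1)"
          by (simp add: S1_def sum_distrib_left[symmetric] sum_distrib_right[symmetric] sum.distrib)
        finally show ?thesis by (simp add: R_def)
      qed
      also have "\<dots> \<le> R * (C^2 * (k * SE.H x) * (k * SE.H x) + \<delta> * (k * SE.H x))"
        using S1 pos \<delta> by (intro mult_left_mono add_mono mult_mono) (auto simp: SE.I.tail_nonneg)
      also have "\<dots> = (R * C^2 * k^2 * SE.H x) * SE.H x + \<epsilon> / 2 * SE.H x"
        using pos by (simp add: \<delta>_def power2_eq_square field_simps)
      also have "\<dots> \<le> \<epsilon> / 2 * SE.H x + \<epsilon> / 2 * SE.H x"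
      proof (intro add_mono mult_right_mono SE.I.tail_nonneg order_refl)
        have "0 < 2 * R * C^2 * k^2" using pos by simp
        then show "R * C^2 * k^2 * SE.H x \<le> \<epsilon> / 2" using elim(1) by (simp add: field_simps)
      qed
      finally have "(\<Sum>i\<in>I. \<Sum>q\<in>I - {i}. prob (E i \<inter> E q)) \<le> \<epsilon> * SE.H x" by simp
      moreover have "(\<Sum>i\<in>I. prob (E i)) \<le> prob (\<Union>i\<in>I. E i) + (\<Sum>i\<in>I. \<Sum>k\<in>I - {i}. prob (E i \<inter> E k))"
        using I(1) by (rule sum_prob_le_Union) (use E(1) in auto)
      ultimately show "(\<Sum>i\<in>I. prob (E i)) \<le> prob (\<Union>i\<in>I. E i) + \<epsilon> * SE.H x" by linarith
    qed
  qed
qed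

text \<open>The dater at -n is a function of the mark there, while the blocks l < i involve only
  marks to the right of -i * L and the gaps leading into them. The single dater stands in for
  \<open>Y\<close>, whose joint law with later marks is not specified.\<close>

lemma single_past_indep:
  assumes L: "L \<ge> 1" and n: "int i * int L \<le> int n"
  shows "prob {\<omega>\<in>space M. y < D0 (- int n) (- int n) \<omega> \<and> B < (\<Sum>l<i. u L (Suc l) \<omega> - s L l \<omega> - c)}
    = prob {\<omega>\<in>space M. y < D0 (- int n) (- int n) \<omega>} * prob {\<omega>\<in>space M. B < (\<Sum>l<i. u L (Suc l) \<omega> - s L l \<omega> - c)}"
proof -
  have iv: "indep_vars (\<lambda>_. mark_space) (mark (-1)) UNIV"
    using mark_iid by (simp add: iid_sequence_def)
  let ?A = "{..- int i * int L}" and ?B = "{- int i * int L + 1..}"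
  have sub: "{first L l..<first L l + int L} \<subseteq> ?B" if "l < i" for l
  proof -
    have "(int l + 1) * int L \<le> int i * int L" using that by (intro mult_right_mono) auto
    then have "- int i * int L + 1 \<le> first L l" unfolding first_def by linarith
    then show ?thesis by auto
  qed
  have sub1: "{- int n..<- int n + int 1} \<subseteq> ?A" using n by auto
  let ?P = "\<lambda>v. y < service 1 (- int n) v"
  let ?Q = "\<lambda>v. B < (\<Sum>l<i. span L (first L l) v - service L (first L l) v - c)"
  have "service 1 (- int n) \<in> borel_measurable (Pi\<^sub>M ?A (\<lambda>_. mark_space))"
    by (rule service_measurable[OF _ sub1]) simp
  then have P: "Measurable.pred (Pi\<^sub>M ?A (\<lambda>_. mark_space)) ?P" by measurable
  have "(\<lambda>v. \<Sum>l<i. span L (first L l) v - service L (first L l) v - c) \<in> borel_measurable (Pi\<^sub>M ?B (\<lambda>_. mark_space))"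
    by (intro borel_measurable_sum borel_measurable_diff borel_measurable_const service_measurable span_measurable L sub) auto
  then have Q: "Measurable.pred (Pi\<^sub>M ?B (\<lambda>_. mark_space)) ?Q" by measurable
  have Pe: "service 1 (- int n) (\<lambda>k\<in>?A. mark (-1) k \<omega>) = D0 (- int n) (- int n) \<omega>" for \<omega>
    unfolding service_mark[OF sub1] by simp
  have Qe: "(\<Sum>l<i. span L (first L l) (\<lambda>k\<in>?B. mark (-1) k \<omega>) - service L (first L l) (\<lambda>k\<in>?B. mark (-1) k \<omega>) - c)
      = (\<Sum>l<i. u L (Suc l) \<omega> - s L l \<omega> - c)" for \<omega>
  proof (rule sum.cong[OF refl])
    fix l assume "l \<in> {..<i}"
    then have l: "l < i" by simp
    have "first L l + - 1 = - int (Suc l) * int L" by (simp add: first_def)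
    then show "span L (first L l) (\<lambda>k\<in>?B. mark (-1) k \<omega>) - service L (first L l) (\<lambda>k\<in>?B. mark (-1) k \<omega>) - c
       = u L (Suc l) \<omega> - s L l \<omega> - c"
      unfolding span_mark[OF sub[OF l]] service_mark[OF sub[OF l]] s_eq u_eq by (simp only:)
  qed
  have "prob {\<omega>\<in>space M. ?P (\<lambda>k\<in>?A. mark (-1) k \<omega>) \<and> ?Q (\<lambda>k\<in>?B. mark (-1) k \<omega>)}
      = prob {\<omega>\<in>space M. ?P (\<lambda>k\<in>?A. mark (-1) k \<omega>)} * prob {\<omega>\<in>space M. ?Q (\<lambda>k\<in>?B. mark (-1) k \<omega>)}"
    by (rule indep_vars_split[OF iv _ P Q]) auto
  then show ?thesis unfolding Pe Qe .
qed

text \<open>Each gap is regrouped with the dater of the block it leads into: the walk at block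
  \<open>i\<close> is the dater of that block minus what drains away between it and 0.\<close>

lemma block_sum_eq:
  "s L 0 \<omega> + (\<Sum>l\<in>{0<..i}. s L l \<omega> - u L l \<omega>) = s L i \<omega> - (\<Sum>l<i. u L (Suc l) \<omega> - s L l \<omega>)"
proof (induction i)
  case (Suc i)
  have "{0<..Suc i} = insert (Suc i) {0<..i}" by auto
  then show ?case using Suc by simp
qed simp

text \<open>A jump of \<open>Y\<close> above the line leads to \<open>blocks L x\<close> unless
  \<open>K\<close> fails, or the dater from -n to the end of its block stays small although the
  single dater is large, or the walk drains too fast afterwards. These exceptions are small
  multiples of the tail by the independence of \<open>K\<close>, by
  \<open>single_large_window_small\<close>, and by \<open>single_past_indep\<close> with the bounded
  supremum. \<open>B\<close> depends on \<open>L\<close> and \<epsilon> only.\<close>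

lemma big_jump_lower:
  assumes L: "L \<ge> 1" and \<epsilon>: "\<epsilon> > 0"
  shows "\<exists>B>0. \<forall>N K. (\<forall>j\<in>{1..r}. \<forall>n x. K j n x \<in> events \<and>
        indep_set {K j n x} (sets (vimage_algebra (space M) (Y j (- int n)) borel))) \<longrightarrow>
      (\<forall>j\<in>{1..r}. \<forall>\<delta>>0. \<forall>\<^sub>F x in at_top. \<forall>n. int n \<ge> N x \<longrightarrow> \<bar>prob (K j n x) - 1\<bar> < \<delta>) \<longrightarrow>
      (\<forall>\<^sub>F x in at_top. \<forall>j\<in>{1..r}. \<forall>n. int n \<ge> N x \<longrightarrow>
        (d j - \<epsilon>) * tail F (x + B + real n * (a - b + \<epsilon>))
          \<le> prob (K j n x \<inter> {\<omega>\<in>space M. x + B + real n * (a - b + \<epsilon>) < Y j (- int n) \<omega>} \<inter> blocks L x))"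
proof -
  define C where "C = dd + 1"
  have C: "C > 0" using dd_pos by (simp add: C_def)
  \<comment> \<open>The loss \<epsilon> is split into \<epsilon> / 2 for the tail of
    \<open>Y\<close>, \<epsilon> / 4 for the window, and \<epsilon> / 8 each for \<open>K\<close>
    and for the drain; the last two arise as \<delta> * C.\<close>
  define \<delta> where "\<delta> = \<epsilon> / (8 * C)"
  have \<delta>: "\<delta> > 0" "\<delta> * C = \<epsilon> / 8" using \<epsilon> C by (auto simp: \<delta>_def)
  \<comment> \<open>The mean drain per customer is a - e L / L. The additional \<epsilon> gives
    \<open>X\<close> a negative drift, and e L / L \<ge> b keeps \<open>m\<close> at or below a - b
    + \<epsilon>.\<close>
  define m where "m = a - e L / real L + \<epsilon>"
  define X where "X l \<omega> = u L (Suc l) \<omega> - s L l \<omega> - real L * m" for l \<omega>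
  have "\<exists>B>0. prob {\<omega>\<in>space M. \<exists>i. B < (\<Sum>l<i. X l \<omega>)} < \<delta>"
  proof (rule iid_walk_bounded_above)
    show "indep_vars (\<lambda>_. borel) X UNIV" unfolding X_def by (rule increments_iid(3)[OF L])
    show "distr M borel (X n) = distr M borel (X 0)" for n unfolding X_def by (rule increments_iid(4)[OF L])
    have i: "integrable M (\<lambda>\<omega>. u L (Suc 0) \<omega> - s L 0 \<omega>)"
      by (intro Bochner_Integration.integrable_diff s_integral u_integral L)
    show "integrable M (X 0)" unfolding X_def by (rule Bochner_Integration.integrable_diff[OF i]) simp
    have "expectation (X 0) = real L * a - e L - real L * m"
    proof -
      have "expectation (X 0) = expectation (\<lambda>\<omega>. u L (Suc 0) \<omega> - s L 0 \<omega>) - real L * m"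
        unfolding X_def by (subst Bochner_Integration.integral_diff[OF i]) (auto simp: prob_space)
      moreover have "expectation (\<lambda>\<omega>. u L (Suc 0) \<omega> - s L 0 \<omega>) = real L * a - e L"
        by (subst Bochner_Integration.integral_diff[OF u_integral(1) s_integral(1)[OF L]])
           (simp add: u_integral s_integral[OF L])
      ultimately show ?thesis by simp
    qed
    also have "\<dots> = - real L * \<epsilon>" using L by (simp add: m_def field_simps)
    finally show "expectation (X 0) < 0" using L \<epsilon> by simp
  qed (rule \<delta>)
  then obtain B where B: "B > 0" "prob {\<omega>\<in>space M. \<exists>i. B < (\<Sum>l<i. X l \<omega>)} < \<delta>" by blast
  have Xm: "(\<lambda>\<omega>. \<Sum>l<i. X l \<omega>) \<in> borel_measurable M" for i
    unfolding X_def using s_measurable[OF L] by measurable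
  have Bi: "prob {\<omega>\<in>space M. B < (\<Sum>l<i. X l \<omega>)} \<le> \<delta>" for i
  proof -
    have "prob {\<omega>\<in>space M. B < (\<Sum>l<i. X l \<omega>)} \<le> prob {\<omega>\<in>space M. \<exists>i. B < (\<Sum>l<i. X l \<omega>)}"
      using Xm by (intro finite_measure_mono) auto
    then show ?thesis using B(2) by simp
  qed
  have slope: "0 < a - b + \<epsilon>" "m \<le> a - b + \<epsilon>" using stable \<epsilon> b_le[OF L] by (auto simp: m_def)
  show ?thesis
  proof (intro exI[of _ B] conjI allI impI B(1))
    fix N :: "real \<Rightarrow> int" and K :: "nat \<Rightarrow> nat \<Rightarrow> real \<Rightarrow> 'a set"
    assume K1: "\<forall>j\<in>{1..r}. \<forall>n x. K j n x \<in> events \<and> indep_set {K j n x} (sets (vimage_algebra (space M) (Y j (- int n)) borel))"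
      and K2: "\<forall>j\<in>{1..r}. \<forall>\<delta>>0. \<forall>\<^sub>F x in at_top. \<forall>n. int n \<ge> N x \<longrightarrow> \<bar>prob (K j n x) - 1\<bar> < \<delta>"
    show "\<forall>\<^sub>F x in at_top. \<forall>j\<in>{1..r}. \<forall>n. int n \<ge> N x \<longrightarrow>
        (d j - \<epsilon>) * tail F (x + B + real n * (a - b + \<epsilon>))
          \<le> prob (K j n x \<inter> {\<omega>\<in>space M. x + B + real n * (a - b + \<epsilon>) < Y j (- int n) \<omega>} \<inter> blocks L x)"
    proof (intro eventually_ball_finite ballI)
      fix j assume j: "j \<in> {1..r}"
      have e2: "\<epsilon> / 2 > 0" "\<epsilon> / 4 > 0" using \<epsilon> by auto
      obtain y1 where y1: "\<And>y i. y \<ge> y1 \<Longrightarrow> prob {\<omega>\<in>space M. y < Y j i \<omega>} \<le> C * tail F y"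
        using Y_upper j unfolding eventually_at_top_linorder C_def by blast
      obtain y2 where y2: "\<And>y i. y \<ge> y2 \<Longrightarrow> (d j - \<epsilon> / 2) * tail F y \<le> prob {\<omega>\<in>space M. y < Y j i \<omega>}"
        using Y_lower[OF j e2(1)] unfolding eventually_at_top_linorder by blast
      obtain y3 where y3: "\<And>y n q. y \<ge> y3 \<Longrightarrow> prob {\<omega>\<in>space M. y < D0 n n \<omega> \<and> D0 n (n + int q) \<omega> \<le> y} \<le> \<epsilon> / 4 * tail F y"
        using single_large_window_small[OF e2(2)] unfolding eventually_at_top_linorder by blast
      have "dd < C" by (simp add: C_def)
      from quotient_upper[OF D0_quotient[of 1] this]
      obtain y4 where y4: "\<And>y. y \<ge> y4 \<Longrightarrow> prob {\<omega>\<in>space M. y < D0 1 1 \<omega>} \<le> C * tail F y"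
        unfolding eventually_at_top_linorder by blast
      have "\<forall>\<^sub>F x in at_top. \<forall>n. int n \<ge> N x \<longrightarrow> \<bar>prob (K j n x) - 1\<bar> < \<delta>" using K2 j \<delta>(1) by blast
      then show "\<forall>\<^sub>F x in at_top. \<forall>n. int n \<ge> N x \<longrightarrow>
        (d j - \<epsilon>) * tail F (x + B + real n * (a - b + \<epsilon>))
          \<le> prob (K j n x \<inter> {\<omega>\<in>space M. x + B + real n * (a - b + \<epsilon>) < Y j (- int n) \<omega>} \<inter> blocks L x)"
        using eventually_ge_at_top[of y1] eventually_ge_at_top[of y2] eventually_ge_at_top[of y3] eventually_ge_at_top[of y4]
      proof eventually_elim
        case (elim x)
        show ?case
        proof (intro allI impI)
          fix n assume n: "int n \<ge> N x"
          define y where "y = x + B + real n * (a - b + \<epsilon>)"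
          have yx: "y \<ge> x" using B(1) slope(1) by (simp add: y_def)
          \<comment> \<open>Index -n lies in block \<open>i\<close>, \<open>q\<close> places before
            the end of that block.\<close>
          define i where "i = n div L"
          define q where "q = n mod L"
          have iq: "int n = int i * int L + int q" "q < L"
            using L div_mult_mod_eq[of n L] by (auto simp: i_def q_def simp flip: of_nat_mult of_nat_add)
          let ?Y = "{\<omega>\<in>space M. y < Y j (- int n) \<omega>}"
          let ?S = "{\<omega>\<in>space M. y < D0 (- int n) (- int n) \<omega> \<and> D0 (- int n) (- int n + int q) \<omega> \<le> y}"
          let ?G = "{\<omega>\<in>space M. y < D0 (- int n) (- int n) \<omega> \<and> B < (\<Sum>l<i. X l \<omega>)}"
          let ?D = "K j n x \<inter> ?Y \<inter> blocks L x"
          have ev: "?Y \<in> events" "K j n x \<in> events" "?S \<in> events" "?G \<in> events" "blocks L x \<in> events"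
            using K1 j Xm by (auto intro!: Y_sets blocks_measurable[OF L])
          have "prob ?Y \<le> prob (?D \<union> (?Y - K j n x) \<union> ?S \<union> ?G)"
          proof (rule finite_measure_mono_AE)
            show "AE \<omega> in M. \<omega> \<in> ?Y \<longrightarrow> \<omega> \<in> ?D \<union> (?Y - K j n x) \<union> ?S \<union> ?G"
              using Y_le_D0_single[OF j, of "- int n"]
            proof eventually_elim
              case (elim \<omega>)
              show ?case
              proof
                assume w: "\<omega> \<in> ?Y"
                then have wM: "\<omega> \<in> space M" and yD: "y < D0 (- int n) (- int n) \<omega>" using elim by auto
                have "\<omega> \<in> blocks L x" if "y < D0 (- int n) (- int n + int q) \<omega>" "(\<Sum>l<i. X l \<omega>) \<le> B"
                proof -
                  have e1: "- int n + int q = - int i * int L" using iq by simp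
                  have "- (int i + 1) * int L + 1 \<le> - int n" using iq by (simp add: algebra_simps)
                  then have "D0 (- int n) (- int i * int L) \<omega> \<le> s L i \<omega>"
                    unfolding s_def using iq
                    by (intro network.dater_mono_start[OF network_at[OF wM] mono_degenerate]) auto
                  then have si: "y < s L i \<omega>" using that(1) unfolding e1 by simp
                  have "(\<Sum>l<i. X l \<omega>) = (\<Sum>l<i. u L (Suc l) \<omega> - s L l \<omega>) - real i * (real L * m)"
                    by (simp add: X_def sum_subtractf)
                  moreover have "real i * (real L * m) \<le> real n * (a - b + \<epsilon>)"
                  proof -
                    have "real i * (real L * m) \<le> (real i * real L) * (a - b + \<epsilon>)"
                      using slope(2) by (simp add: mult.assoc mult_left_mono)
                    also have "\<dots> \<le> real n * (a - b + \<epsilon>)"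
                    proof (rule mult_right_mono)
                      have "i * L \<le> n" by (simp add: i_def)
                      then show "real i * real L \<le> real n" by (metis of_nat_le_iff of_nat_mult)
                    qed (use slope in simp)
                    finally show ?thesis .
                  qed
                  \<comment> \<open>The dater of block \<open>i\<close> exceeds x + B + n(a - b +
                    \<epsilon>), and at most B + n(a - b + \<epsilon>) of it drains away.\<close>
                  ultimately have "x < s L 0 \<omega> + (\<Sum>l\<in>{0<..i}. s L l \<omega> - u L l \<omega>)"
                    unfolding block_sum_eq using si that(2) by (simp add: y_def)
                  then show ?thesis unfolding blocks_def using wM by blast
                qed
                then show "\<omega> \<in> ?D \<union> (?Y - K j n x) \<union> ?S \<union> ?G" using w wM yD by fastforce
              qed
            qed
          qed (use ev in auto)
          also have "\<dots> \<le> prob ?D + prob (?Y - K j n x) + prob ?S + prob ?G"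
          proof -
            have D: "?D \<in> events" "?Y - K j n x \<in> events" using ev by auto
            have "prob (?D \<union> (?Y - K j n x) \<union> ?S \<union> ?G) \<le> prob (?D \<union> (?Y - K j n x) \<union> ?S) + prob ?G"
              by (intro measure_Un_le sets.Un D ev)
            moreover have "prob (?D \<union> (?Y - K j n x) \<union> ?S) \<le> prob (?D \<union> (?Y - K j n x)) + prob ?S"
              by (intro measure_Un_le sets.Un D ev)
            moreover have "prob (?D \<union> (?Y - K j n x)) \<le> prob ?D + prob (?Y - K j n x)"
              by (intro measure_Un_le D)
            ultimately show ?thesis by linarith
          qed
          finally have main: "prob ?Y \<le> prob ?D + prob (?Y - K j n x) + prob ?S + prob ?G" .
          have PY: "prob ?Y \<le> C * tail F y" "(d j - \<epsilon> / 2) * tail F y \<le> prob ?Y"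
            using elim(2,3) yx by (intro y1 y2, linarith)+
          have "prob (?Y - K j n x) \<le> \<epsilon> / 8 * tail F y"
          proof -
            have "prob (K j n x \<inter> ?Y) = prob (K j n x) * prob ?Y"
            proof (rule indep_setD)
              show "indep_set {K j n x} (sets (vimage_algebra (space M) (Y j (- int n)) borel))" using K1 j by blast
              have "?Y = Y j (- int n) -` {y<..} \<inter> space M" by auto
              then show "?Y \<in> sets (vimage_algebra (space M) (Y j (- int n)) borel)"
                by (simp add: in_vimage_algebra)
            qed simp
            then have "prob (?Y - K j n x) = (1 - prob (K j n x)) * prob ?Y"
              using finite_measure_Diff'[OF ev(1,2)] by (simp add: Int_commute algebra_simps)
            also have "\<dots> \<le> \<delta> * (C * tail F y)"
              using elim(1) n PY(1) \<delta> by (intro mult_mono) (auto simp: abs_if split: if_splits)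
            finally show ?thesis using \<delta>(2) by (simp add: mult.assoc[symmetric])
          qed
          moreover have "prob ?S \<le> \<epsilon> / 4 * tail F y" using elim(4) yx by (intro y3) linarith
          moreover have "prob ?G \<le> \<epsilon> / 8 * tail F y"
          proof -
            have "prob ?G = prob {\<omega>\<in>space M. y < D0 (- int n) (- int n) \<omega>} * prob {\<omega>\<in>space M. B < (\<Sum>l<i. X l \<omega>)}"
              unfolding X_def by (rule single_past_indep[OF L]) (use iq in simp)
            also have "\<dots> \<le> (C * tail F y) * \<delta>"
            proof (intro mult_mono Bi)
              show "prob {\<omega>\<in>space M. y < D0 (- int n) (- int n) \<omega>} \<le> C * tail F y"
                using y4[of y] elim(5) yx prob_D0_shift[of 1 1 y "- int n - 1"] by simp
            qed (use C in \<open>auto simp: SE.tail_nonneg\<close>)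
            also have "(C * tail F y) * \<delta> = (\<delta> * C) * tail F y" by (simp only: mult_ac)
            finally show ?thesis unfolding \<delta>(2) .
          qed
          ultimately have "(d j - \<epsilon> / 2) * tail F y \<le> prob ?D + \<epsilon> / 8 * tail F y + \<epsilon> / 4 * tail F y + \<epsilon> / 8 * tail F y"
            using main PY(2) by linarith
          then have "(d j - \<epsilon>) * tail F y \<le> prob ?D" by (simp add: algebra_simps)
          then show "(d j - \<epsilon>) * tail F (x + B + real n * (a - b + \<epsilon>))
            \<le> prob (K j n x \<inter> {\<omega>\<in>space M. x + B + real n * (a - b + \<epsilon>) < Y j (- int n) \<omega>} \<inter> blocks L x)"
            by (simp only: y_def)
        qed
      qed
    qed simp
  qed
qed

end

lemma smallo_imp_asymp_equiv_transfer:
  fixes f g h :: "real \<Rightarrow> real"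
  assumes "(\<lambda>x. f x - g x) \<in> o(h)" "h \<in> O(f)"
  shows "f \<sim>[at_top] g"
proof -
  have "(\<lambda>x. f x - g x) \<in> o(f)" by (rule landau_o.small_big_trans[OF assms])
  then have "(\<lambda>x. g x - f x) \<in> o(f)"
    using landau_o.small.uminus_in_iff[of "\<lambda>x. f x - g x" at_top f] by simp
  then show ?thesis by (rule asymp_equiv_symI[OF smallo_imp_asymp_equiv])
qed

section \<open>The stationary dater: measurability and a lower bound of the right order\<close>

context heavy_network
begin

abbreviation "Zs \<omega> \<equiv> stationary_dater f (\<lambda>k. T k \<omega>) (\<lambda>k. \<zeta> k \<omega>)"

lemma Zs_events: "{\<omega>\<in>space M. ereal x < Zs \<omega>} \<in> events"
proof -
  have m: "(\<lambda>\<omega>. maximal_dater f (- int n) 0 (\<lambda>k. T k \<omega>) (\<lambda>k. \<zeta> k \<omega>)) \<in> borel_measurable M" for n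
    unfolding maximal_dater_def
    by (intro borel_measurable_diff last_activity_measurable[OF network _ _ \<zeta>_measurable] T_measurable) auto
  have "{\<omega>\<in>space M. ereal x < Zs \<omega>} = {\<omega>\<in>space M. \<exists>n. x < maximal_dater f (- int n) 0 (\<lambda>k. T k \<omega>) (\<lambda>k. \<zeta> k \<omega>)}"
    using network.less_stationary_dater_iff[OF network_at T_mono] by auto
  also have "\<dots> \<in> events" using m by measurable
  finally show ?thesis .
qed

text \<open>By Markov's inequality, \<open>T\<^sub>0 - T\<^bsub>-n\<^esub> \<le> 2an\<close> with probability at least 1/2, so a jump above \<open>x + 2an\<close> suffices.\<close>

lemma stationary_tail_lower:
  assumes N: "admissible_threshold F N"
  shows "\<exists>k>0. \<forall>\<^sub>F x in at_top. k * SE.H x \<le> prob {\<omega>\<in>space M. ereal x < Zs \<omega>}"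
proof -
  have "\<exists>j\<in>{1..r}. 0 < d j"
  proof (rule ccontr)
    assume "\<not> (\<exists>j\<in>{1..r}. 0 < d j)"
    then have "dd \<le> 0" unfolding dd_def by (intro sum_nonpos) (meson not_less)
    then show False using dd_pos by simp
  qed
  then obtain j where j: "j \<in> {1..r}" "0 < d j" by blast
  have a: "a > 0" using stable b_nonneg by simp
  define c where "c = 2 * a"
  have c: "c > 0" using a by (simp add: c_def)
  \<comment> \<open>The jump tail d j / 2, the Markov factor 1 / 2 and the Riemann sum 1 / (2 * c)
    multiply to 2 * \<epsilon>; the overlaps take away one \<epsilon>.\<close>
  define \<epsilon> where "\<epsilon> = d j / (16 * c)"
  have \<epsilon>: "\<epsilon> > 0" using j c by (simp add: \<epsilon>_def)
  have "d j / 2 > 0" using j by simp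
  from Y_lower[OF j(1) this] obtain x1 where x1: "\<And>x i. x \<ge> x1 \<Longrightarrow> d j / 2 * tail F x \<le> prob {\<omega>\<in>space M. x < Y j i \<omega>}"
    unfolding eventually_at_top_linorder by auto
  define E where "E x = (\<lambda>(j::nat, n::nat). {\<omega>\<in>space M. x + real n * c < Y j (- int n) \<omega> \<and> T 0 \<omega> - T (- int n) \<omega> \<le> real n * c})" for x
  have half: "prob {\<omega>\<in>space M. T 0 \<omega> - T (- int n) \<omega> \<le> real n * c} \<ge> 1 / 2" for n
  proof (cases "n = 0")
    case True
    then show ?thesis by (simp add: prob_space)
  next
    case False
    have i: "integrable M (\<lambda>\<omega>. T 0 \<omega> - T (- int n) \<omega>)" "expectation (\<lambda>\<omega>. T 0 \<omega> - T (- int n) \<omega>) = real n * a"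
      using expectation_T[of "- int n" n] by simp_all
    have "prob {\<omega>\<in>space M. real n * c \<le> T 0 \<omega> - T (- int n) \<omega>} \<le> expectation (\<lambda>\<omega>. T 0 \<omega> - T (- int n) \<omega>) / (real n * c)"
    proof (rule integral_Markov_inequality_measure[where A="{}", simplified])
      show "AE \<omega> in M. 0 \<le> T 0 \<omega> - T (- int n) \<omega>"
        using monoD[OF T_mono, of _ "- int n" 0] by (intro AE_I2) auto
    qed (use i False c in auto)
    also have "\<dots> = 1 / 2" using False a by (simp add: i(2) c_def)
    finally have 1: "prob {\<omega>\<in>space M. real n * c \<le> T 0 \<omega> - T (- int n) \<omega>} \<le> 1 / 2" .
    have "{\<omega>\<in>space M. T 0 \<omega> - T (- int n) \<omega> \<le> real n * c} \<in> events" by measurable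
    from prob_compl[OF this] have "1 - prob {\<omega>\<in>space M. T 0 \<omega> - T (- int n) \<omega> \<le> real n * c} = prob (space M - {\<omega>\<in>space M. T 0 \<omega> - T (- int n) \<omega> \<le> real n * c})" by simp
    also have "\<dots> \<le> prob {\<omega>\<in>space M. real n * c \<le> T 0 \<omega> - T (- int n) \<omega>}"
      by (rule finite_measure_mono) auto
    finally show ?thesis using 1 by simp
  qed
  have PE: "prob (E x (j, n)) = prob {\<omega>\<in>space M. x + real n * c < Y j (- int n) \<omega>} * prob {\<omega>\<in>space M. T 0 \<omega> - T (- int n) \<omega> \<le> real n * c}" for x n
  proof -
    have ind: "indep_rvs M (Pi\<^sub>M UNIV (\<lambda>_. Pi\<^sub>M {1..r} (\<lambda>_. borel))) (\<lambda>\<omega> i. \<lambda>j\<in>{1..r}. Y j i \<omega>)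
                (Pi\<^sub>M UNIV (\<lambda>_. borel)) (\<lambda>\<omega> n. \<tau> n \<omega>)"
      using AA unfolding assumption_AA_def by blast
    let ?P = "\<lambda>v. x + real n * c < v (- int n) j" and ?Q = "\<lambda>v. (\<Sum>i<n. v (- int n + int i)) \<le> real n * c"
    have "(\<lambda>v. v (- int n) j) \<in> borel_measurable (Pi\<^sub>M UNIV (\<lambda>_. Pi\<^sub>M {1..r} (\<lambda>_. borel :: real measure)))"
    proof (rule measurable_compose[where f="\<lambda>v. v (- int n)" and g="\<lambda>v. v j" and N="Pi\<^sub>M {1..r} (\<lambda>_. borel :: real measure)"])
      show "(\<lambda>v. v (- int n)) \<in> Pi\<^sub>M UNIV (\<lambda>_. Pi\<^sub>M {1..r} (\<lambda>_. borel)) \<rightarrow>\<^sub>M Pi\<^sub>M {1..r} (\<lambda>_. borel :: real measure)"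
        by (rule measurable_component_singleton) simp
      show "(\<lambda>v. v j) \<in> Pi\<^sub>M {1..r} (\<lambda>_. borel) \<rightarrow>\<^sub>M (borel :: real measure)"
        by (rule measurable_component_singleton) (rule j)
    qed
    then have P: "Measurable.pred (Pi\<^sub>M UNIV (\<lambda>_. Pi\<^sub>M {1..r} (\<lambda>_. borel :: real measure))) ?P" by measurable
    have Q: "Measurable.pred (Pi\<^sub>M UNIV (\<lambda>_. borel)) ?Q" by measurable
    have "T 0 \<omega> - T (- int n) \<omega> = (\<Sum>i<n. \<tau> (- int n + int i) \<omega>)" for \<omega>
      unfolding sum_\<tau> by simp
    then show ?thesis
      using indep_rvs_prob_and[OF ind P Q] j(1) by (simp add: E_def)
  qed
  have Ev: "E x (j, n) \<in> events" for x n
    unfolding E_def using Y_sets[OF j(1)] by simp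
  have c': "1 / (2 * c) < 1 / c" using c by (simp add: field_simps)
  show ?thesis
  proof (intro exI[of _ \<epsilon>] conjI \<epsilon>)
    show "\<forall>\<^sub>F x in at_top. \<epsilon> * SE.H x \<le> prob {\<omega>\<in>space M. ereal x < Zs \<omega>}"
      using overlap_negligible[OF c \<epsilon>] SE.sum_tail_lower[OF N c c' order_refl] eventually_ge_at_top[of x1]
    proof eventually_elim
      case (elim x)
      obtain m where m: "1 / (2 * c) * SE.H x \<le> (\<Sum>n\<in>{n. N x \<le> int n \<and> n < m}. tail F (x + 0 + real n * c))"
        using elim(2) by blast
      define I where "I = Pair j ` {n. N x \<le> int n \<and> n < m}"
      have "(\<Sum>i\<in>I. prob (E x i)) \<le> prob (\<Union>i\<in>I. E x i) + \<epsilon> * SE.H x"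
        using Ev j by (intro elim(1)[rule_format]) (auto simp: I_def E_def)
      moreover have "prob (\<Union>i\<in>I. E x i) \<le> prob {\<omega>\<in>space M. ereal x < Zs \<omega>}"
      proof (rule finite_measure_mono_AE[OF _ Zs_events])
        have "AE \<omega> in M. \<forall>n. Y j (- int n) \<omega> \<le> D0 (- int n) 0 \<omega>"
          unfolding AE_all_countable using Y_le_D0[OF j(1)] by blast
        then show "AE \<omega> in M. \<omega> \<in> (\<Union>i\<in>I. E x i) \<longrightarrow> \<omega> \<in> {\<omega>\<in>space M. ereal x < Zs \<omega>}"
        proof eventually_elim
          case (elim \<omega>)
          show ?case
          proof
            assume "\<omega> \<in> (\<Union>i\<in>I. E x i)"
            then obtain n where n: "\<omega> \<in> space M" "x + real n * c < Y j (- int n) \<omega>" "T 0 \<omega> - T (- int n) \<omega> \<le> real n * c"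
              by (auto simp: I_def E_def)
            have "D0 (- int n) 0 \<omega> - (T 0 \<omega> - T (- int n) \<omega>) \<le> maximal_dater f (- int n) 0 (\<lambda>k. T k \<omega>) (\<lambda>k. \<zeta> k \<omega>)"
              by (rule network.dater_ge_degenerate[OF network_at T_mono]) (use n in auto)
            then have "x < maximal_dater f (- int n) 0 (\<lambda>k. T k \<omega>) (\<lambda>k. \<zeta> k \<omega>)"
              using n elim[rule_format, of n] by linarith
            then show "\<omega> \<in> {\<omega>\<in>space M. ereal x < Zs \<omega>}"
              using n(1) network.less_stationary_dater_iff[OF network_at[OF n(1)] T_mono[OF n(1)], of x] by auto
          qed
        qed
      qed
      moreover have "2 * \<epsilon> * SE.H x \<le> (\<Sum>i\<in>I. prob (E x i))"
      proof -
        have "2 * \<epsilon> * SE.H x = d j / 4 * (1 / (2 * c) * SE.H x)" using c by (simp add: \<epsilon>_def)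
        also have "\<dots> \<le> d j / 4 * (\<Sum>n\<in>{n. N x \<le> int n \<and> n < m}. tail F (x + 0 + real n * c))"
          using m j by (intro mult_left_mono) auto
        also have "\<dots> \<le> (\<Sum>n\<in>{n. N x \<le> int n \<and> n < m}. prob (E x (j, n)))"
          unfolding sum_distrib_left
        proof (rule sum_mono)
          fix n
          have "x1 \<le> x + real n * c" using elim(3) c by (simp add: add_increasing2)
          then have "d j / 2 * tail F (x + real n * c) * (1 / 2) \<le> prob (E x (j, n))"
            unfolding PE using half[of n] by (intro mult_mono x1) auto
          then show "d j / 4 * tail F (x + 0 + real n * c) \<le> prob (E x (j, n))" by simp
        qed
        also have "\<dots> = (\<Sum>i\<in>I. prob (E x i))"
          unfolding I_def by (subst sum.reindex) (auto simp: inj_on_def)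
        finally show ?thesis .
      qed
      ultimately show ?case by linarith
    qed
  qed
qed

end

section \<open>The events of the theorem and the probability outside them\<close>

locale big_jump_events = heavy_network M F S f T \<tau> \<zeta> r Y d a b
  for M :: "'a measure" and F S and f :: "nat \<Rightarrow> (nat \<Rightarrow> real) \<times> (nat \<Rightarrow> 'k) \<Rightarrow> real"
    and T \<tau> \<zeta> r Y d a b +
  fixes N :: "real \<Rightarrow> int" and K :: "nat \<Rightarrow> nat \<Rightarrow> real \<Rightarrow> 'a set" and \<eta> :: "nat \<Rightarrow> nat \<Rightarrow> real"
  assumes N: "admissible_threshold F N"
    and K_events: "\<And>j n x. j \<in> {1..r} \<Longrightarrow> K j n x \<in> events"
    and K_indep: "\<And>j n x. j \<in> {1..r} \<Longrightarrow> indep_set {K j n x} (sets (vimage_algebra (space M) (Y j (- int n)) borel))"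
    and K_tendsto: "\<And>j \<epsilon>. j \<in> {1..r} \<Longrightarrow> \<epsilon> > 0 \<Longrightarrow> \<forall>\<^sub>F x in at_top. \<forall>n. int n \<ge> N x \<longrightarrow> \<bar>measure M (K j n x) - 1\<bar> < \<epsilon>"
    and \<eta>_tendsto: "\<And>j. j \<in> {1..r} \<Longrightarrow> \<eta> j \<longlonglongrightarrow> 0"
begin

definition A :: "nat \<Rightarrow> nat \<Rightarrow> real \<Rightarrow> 'a set" where
  "A j n x = K j n x \<inter> {\<omega>\<in>space M. Y j (- int n) \<omega> > x + real n * (a - b + \<eta> j n)}"

definition A1 :: "nat \<Rightarrow> real \<Rightarrow> 'a set" where
  "A1 j x = (\<Union>n\<in>{n. int n \<ge> N x}. A j n x)"

definition A0 :: "real \<Rightarrow> 'a set" where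
  "A0 x = (\<Union>j\<in>{1..r}. A1 j x)"

lemma A_events: "j \<in> {1..r} \<Longrightarrow> A j n x \<in> events"
  unfolding A_def by (intro sets.Int K_events Y_sets)

lemma A1_events: "j \<in> {1..r} \<Longrightarrow> A1 j x \<in> events"
  unfolding A1_def by (intro sets.countable_UN'' A_events) auto

lemma A0_events: "A0 x \<in> events"
  unfolding A0_def by (intro sets.finite_UN A1_events) auto

lemma \<eta>_small:
  assumes "\<epsilon> > 0"
  shows "\<forall>\<^sub>F x in at_top. \<forall>j\<in>{1..r}. \<forall>n. int n \<ge> N x \<longrightarrow> \<bar>\<eta> j n\<bar> < \<epsilon>"
proof (intro eventually_ball_finite ballI)
  fix j assume "j \<in> {1..r}"
  from LIMSEQ_D[OF \<eta>_tendsto[OF this] assms] obtain n0 where n0: "\<And>n. n \<ge> n0 \<Longrightarrow> \<bar>\<eta> j n\<bar> < \<epsilon>" by auto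
  have "filterlim N at_top at_top" using N by (simp add: admissible_threshold_def)
  then have "\<forall>\<^sub>F x in at_top. int n0 \<le> N x" by (simp add: filterlim_at_top)
  then show "\<forall>\<^sub>F x in at_top. \<forall>n. int n \<ge> N x \<longrightarrow> \<bar>\<eta> j n\<bar> < \<epsilon>"
    by eventually_elim (auto intro: n0)
qed simp

text \<open>For large \<open>x\<close> the slope a - b + \<eta> is at most a - b + \<epsilon> from
  \<open>N x\<close> on, so the jumps of \<open>big_jump_lower\<close> belong to \<open>A0\<close>.
  Every component loses \<epsilon> in its constant, and the overlaps cost a further \<epsilon> *
  H.\<close>

lemma blocks_A0_lower:
  assumes L: "L \<ge> 1" and \<epsilon>: "\<epsilon> > 0" "real r * \<epsilon> \<le> dd" and k: "0 \<le> k" "k < 1 / (a - b + \<epsilon>)"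
  shows "\<forall>\<^sub>F x in at_top. ((dd - real r * \<epsilon>) * k - \<epsilon>) * SE.H x \<le> prob (blocks L x \<inter> A0 x)"
proof -
  obtain B where B: "B > 0" "\<forall>N K. (\<forall>j\<in>{1..r}. \<forall>n x. K j n x \<in> events \<and>
        indep_set {K j n x} (sets (vimage_algebra (space M) (Y j (- int n)) borel))) \<longrightarrow>
      (\<forall>j\<in>{1..r}. \<forall>\<delta>>0. \<forall>\<^sub>F x in at_top. \<forall>n. int n \<ge> N x \<longrightarrow> \<bar>prob (K j n x) - 1\<bar> < \<delta>) \<longrightarrow>
      (\<forall>\<^sub>F x in at_top. \<forall>j\<in>{1..r}. \<forall>n. int n \<ge> N x \<longrightarrow>
        (d j - \<epsilon>) * tail F (x + B + real n * (a - b + \<epsilon>))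
          \<le> prob (K j n x \<inter> {\<omega>\<in>space M. x + B + real n * (a - b + \<epsilon>) < Y j (- int n) \<omega>} \<inter> blocks L x))"
    using big_jump_lower[OF L \<epsilon>(1)] by blast
  have ev: "\<forall>\<^sub>F x in at_top. \<forall>j\<in>{1..r}. \<forall>n. int n \<ge> N x \<longrightarrow>
        (d j - \<epsilon>) * tail F (x + B + real n * (a - b + \<epsilon>))
          \<le> prob (K j n x \<inter> {\<omega>\<in>space M. x + B + real n * (a - b + \<epsilon>) < Y j (- int n) \<omega>} \<inter> blocks L x)"
    by (rule B(2)[rule_format]) (use K_events K_indep K_tendsto in auto)
  define c where "c = a - b + \<epsilon>"
  have c: "c > 0" using stable \<epsilon> by (simp add: c_def)
  have B0: "B \<ge> 0" using B(1) by simp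
  have kc: "k < 1 / c" using k by (simp add: c_def)
  show ?thesis
    using ev \<eta>_small[OF \<epsilon>(1)] overlap_negligible[OF c \<epsilon>(1)] SE.sum_tail_lower[OF N c kc B0]
    unfolding c_def[symmetric]
  proof eventually_elim
    case (elim x)
    obtain m where m: "k * SE.H x \<le> (\<Sum>n\<in>{n. N x \<le> int n \<and> n < m}. tail F (x + B + real n * c))"
      using elim(4) by blast
    define J where "J = {n. N x \<le> int n \<and> n < m}"
    define D where "D = (\<lambda>(j, n). K j n x \<inter> {\<omega>\<in>space M. x + B + real n * c < Y j (- int n) \<omega>} \<inter> blocks L x)"
    have fin: "finite J" unfolding J_def by simp
    have ap: "a - b + \<eta> j n \<le> c" if "j \<in> {1..r}" "n \<in> J" for j n
      using elim(2) that by (force simp: J_def c_def)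
    have "(\<Sum>i\<in>{1..r} \<times> J. prob (D i)) \<le> prob (\<Union>i\<in>{1..r} \<times> J. D i) + \<epsilon> * SE.H x"
    proof (rule elim(3)[rule_format])
      fix j n assume jn: "(j, n) \<in> {1..r} \<times> J"
      then show "D (j, n) \<in> events \<and> D (j, n) \<subseteq> {\<omega>\<in>space M. x + real n * c < Y j (- int n) \<omega>}"
        using B(1) by (auto simp: D_def intro!: sets.Int K_events Y_sets blocks_measurable[OF L])
    qed (use fin in auto)
    moreover have "prob (\<Union>i\<in>{1..r} \<times> J. D i) \<le> prob (blocks L x \<inter> A0 x)"
    proof (rule finite_measure_mono)
      show "(\<Union>i\<in>{1..r} \<times> J. D i) \<subseteq> blocks L x \<inter> A0 x"
      proof
        fix \<omega> assume "\<omega> \<in> (\<Union>i\<in>{1..r} \<times> J. D i)"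
        then obtain j n where jn: "j \<in> {1..r}" "n \<in> J" "\<omega> \<in> K j n x" "\<omega> \<in> space M"
          "x + B + real n * c < Y j (- int n) \<omega>" "\<omega> \<in> blocks L x" by (auto simp: D_def)
        have "real n * (a - b + \<eta> j n) \<le> real n * c" using ap[OF jn(1,2)] by (intro mult_left_mono) auto
        then have "\<omega> \<in> A j n x" using jn B0 by (simp add: A_def)
        then show "\<omega> \<in> blocks L x \<inter> A0 x" using jn by (auto simp: A0_def A1_def J_def)
      qed
    qed (intro sets.Int A0_events blocks_measurable[OF L])
    moreover have "(dd - real r * \<epsilon>) * k * SE.H x \<le> (\<Sum>i\<in>{1..r} \<times> J. prob (D i))"
    proof -
      have "(dd - real r * \<epsilon>) * k * SE.H x \<le> (dd - real r * \<epsilon>) * (\<Sum>n\<in>J. tail F (x + B + real n * c))"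
        using m \<epsilon>(2) unfolding mult.assoc J_def by (intro mult_left_mono) auto
      also have "\<dots> = (\<Sum>j\<in>{1..r}. \<Sum>n\<in>J. (d j - \<epsilon>) * tail F (x + B + real n * c))"
        by (simp add: dd_def sum_distrib_left[symmetric] sum_distrib_right[symmetric] sum_subtractf)
      also have "\<dots> \<le> (\<Sum>j\<in>{1..r}. \<Sum>n\<in>J. prob (D (j, n)))"
        using elim(1) by (intro sum_mono) (auto simp: D_def J_def)
      also have "\<dots> = (\<Sum>i\<in>{1..r} \<times> J. prob (D i))" by (simp add: sum.cartesian_product)
      finally show ?thesis .
    qed
    ultimately show ?case by (simp add: left_diff_distrib)
  qed
qed

text \<open>The event outside \<open>A0\<close> is part of \<open>blocks L x\<close> minus
  \<open>A0\<close>. The bounds for P(blocks) and P(blocks and A0) approach the same constant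
  \<open>v\<close> as \<open>L\<close> grows and \<epsilon> tends to 0; \<open>L\<close> and
  \<epsilon> are fixed, depending on \<theta>, before \<open>x\<close> tends to infinity.\<close>

lemma off_jumps_negligible:
  assumes "\<theta> > 0"
  shows "\<forall>\<^sub>F x in at_top. prob ({\<omega>\<in>space M. ereal x < Zs \<omega>} - A0 x) \<le> \<theta> * SE.H x"
proof -
  define v where "v = dd / (a - b)"
  have ab: "a - b > 0" using stable by simp
  \<comment> \<open>Subtracting \<epsilon> in the second factor makes it strictly smaller than 1 /
    (a - b + \<epsilon>), as \<open>blocks_A0_lower\<close> requires.\<close>
  have "((\<lambda>\<epsilon>. (dd - real r * \<epsilon>) * (1 / (a - b + \<epsilon>) - \<epsilon>) - \<epsilon>) \<longlongrightarrow> (dd - real r * 0) * (1 / (a - b + 0) - 0) - 0) (at_right 0)"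
    using ab by (intro tendsto_intros) auto
  then have "\<forall>\<^sub>F \<epsilon> in at_right 0. v - \<theta> / 2 < (dd - real r * \<epsilon>) * (1 / (a - b + \<epsilon>) - \<epsilon>) - \<epsilon>"
    using assms by (intro order_tendstoD(1)) (auto simp: v_def)
  moreover have "\<forall>\<^sub>F \<epsilon> in at_right 0. real r * \<epsilon> < dd"
  proof -
    have "((\<lambda>\<epsilon>. real r * \<epsilon>) \<longlongrightarrow> real r * 0) (at_right 0)" by (intro tendsto_intros)
    then show ?thesis using dd_pos by (intro order_tendstoD(2)) auto
  qed
  moreover have "\<forall>\<^sub>F \<epsilon> in at_right 0. 0 < 1 / (a - b + \<epsilon>) - \<epsilon>"
  proof -
    have "((\<lambda>\<epsilon>. 1 / (a - b + \<epsilon>) - \<epsilon>) \<longlongrightarrow> 1 / (a - b + 0) - 0) (at_right 0)"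
      using ab by (intro tendsto_intros) auto
    then show ?thesis using ab by (intro order_tendstoD(1)) auto
  qed
  moreover have "\<forall>\<^sub>F \<epsilon>::real in at_right 0. 0 < \<epsilon>" by (rule eventually_at_right_less)
  ultimately have "\<forall>\<^sub>F \<epsilon> in at_right 0. v - \<theta> / 2 < (dd - real r * \<epsilon>) * (1 / (a - b + \<epsilon>) - \<epsilon>) - \<epsilon> \<and> real r * \<epsilon> < dd
      \<and> 0 < 1 / (a - b + \<epsilon>) - \<epsilon> \<and> 0 < \<epsilon>"
    by (intro eventually_conj)
  then obtain \<epsilon> where \<epsilon>: "v - \<theta> / 2 < (dd - real r * \<epsilon>) * (1 / (a - b + \<epsilon>) - \<epsilon>) - \<epsilon>" "real r * \<epsilon> < dd"
      "0 < 1 / (a - b + \<epsilon>) - \<epsilon>" "0 < \<epsilon>"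
    using eventually_happens'[OF trivial_limit_at_right_real] by blast
  have "(\<lambda>L. dd / (a - e L / real L)) \<longlonglongrightarrow> dd / (a - b)"
    using ab by (intro tendsto_intros e_tendsto) auto
  then have "\<forall>\<^sub>F L in sequentially. dd / (a - e L / real L) < v + \<theta> / 2"
    using assms by (intro order_tendstoD(2)) (auto simp: v_def)
  moreover have "\<forall>\<^sub>F L in sequentially. e L / real L < a"
    using e_tendsto stable by (rule order_tendstoD)
  ultimately have "\<forall>\<^sub>F L in sequentially. (dd / (a - e L / real L) < v + \<theta> / 2 \<and> e L / real L < a) \<and> L \<ge> 1"
    using eventually_ge_at_top by (intro eventually_conj) auto
  then obtain L where L: "dd / (a - e L / real L) < v + \<theta> / 2" "e L / real L < a" "L \<ge> 1"
    by (auto simp: eventually_sequentially)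
  have "real r * \<epsilon> \<le> dd" "0 \<le> 1 / (a - b + \<epsilon>) - \<epsilon>" "1 / (a - b + \<epsilon>) - \<epsilon> < 1 / (a - b + \<epsilon>)" using \<epsilon> by auto
  from prob_blocks_upper[OF L(3,2,1)] blocks_A0_lower[OF L(3) \<epsilon>(4) this]
  show ?thesis
  proof eventually_elim
    case (elim x)
    have "prob ({\<omega>\<in>space M. ereal x < Zs \<omega>} - A0 x) \<le> prob (blocks L x - A0 x)"
      using stationary_dater_subset_blocks[OF L(3), of x]
      by (intro finite_measure_mono sets.Diff blocks_measurable[OF L(3)] A0_events) auto
    also have "\<dots> = prob (blocks L x) - prob (blocks L x \<inter> A0 x)"
      by (rule finite_measure_Diff'[OF blocks_measurable[OF L(3)] A0_events])
    also have "\<dots> \<le> (v + \<theta> / 2) * SE.H x - ((dd - real r * \<epsilon>) * (1 / (a - b + \<epsilon>) - \<epsilon>) - \<epsilon>) * SE.H x"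
      using elim by (rule diff_mono)
    also have "\<dots> \<le> (v + \<theta> / 2) * SE.H x - (v - \<theta> / 2) * SE.H x"
      using \<epsilon>(1) by (intro diff_left_mono mult_right_mono SE.I.tail_nonneg) auto
    also have "\<dots> = \<theta> * SE.H x" by (simp add: algebra_simps)
    finally show ?case .
  qed
qed

abbreviation total :: "'a set \<Rightarrow> real \<Rightarrow> real" where
  "total E x \<equiv> (\<Sum>j=1..r. \<Sum>\<^sub>\<infinity>n\<in>{n. int n \<ge> N x}. prob (E \<inter> A j n x))"

text \<open>The first two inequalities are subadditivity, and the last one bounds the overlaps. The
  threshold for \<open>x\<close> is the same for all \<open>E\<close>, so the result applies to
  events that vary with \<open>x\<close>.\<close>

lemma decomposition:
  assumes "\<theta> > 0"
  shows "\<forall>\<^sub>F x in at_top. \<forall>E\<in>events. prob (E \<inter> A0 x) \<le> (\<Sum>j=1..r. prob (E \<inter> A1 j x)) \<and>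
    (\<Sum>j=1..r. prob (E \<inter> A1 j x)) \<le> total E x \<and> total E x \<le> prob (E \<inter> A0 x) + \<theta> * SE.H x"
proof -
  \<comment> \<open>Half the slope: once every \<eta> is below \<open>c\<close> in absolute value,
    each jump in \<open>A\<close> exceeds x + n * c.\<close>
  define c where "c = (a - b) / 2"
  have c: "c > 0" using stable by (simp add: c_def)
  show ?thesis
    using overlap_negligible[OF c assms] \<eta>_small[OF c]
  proof eventually_elim
    case (elim x)
    show ?case
    proof
      fix E assume E: "E \<in> events"
      let ?S = "{n. int n \<ge> N x}"
      have EA: "E \<inter> A j n x \<in> events" if "j \<in> {1..r}" for j n using E A_events[OF that] by auto
      have bound: "(\<Sum>j\<in>R. \<Sum>n\<in>J. prob (E \<inter> A j n x)) \<le> prob (E \<inter> A0 x) + \<theta> * SE.H x"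
        if R: "R \<subseteq> {1..r}" and J: "finite J" "J \<subseteq> ?S" for R J
      proof -
        have fR: "finite R" using R finite_subset by blast
        have "(\<Sum>j\<in>R. \<Sum>n\<in>J. prob (E \<inter> A j n x)) = (\<Sum>i\<in>R \<times> J. prob ((\<lambda>(j, n). E \<inter> A j n x) i))"
          by (simp add: sum.cartesian_product case_prod_beta')
        also have "\<dots> \<le> prob (\<Union>i\<in>R \<times> J. (\<lambda>(j, n). E \<inter> A j n x) i) + \<theta> * SE.H x"
        proof (rule elim(1)[rule_format])
          fix j n assume "(j, n) \<in> R \<times> J"
          then have jn: "j \<in> {1..r}" "n \<in> ?S" using R J by auto
          then have "\<bar>\<eta> j n\<bar> < c" using elim(2) by auto
          then have "c \<le> a - b + \<eta> j n" by (auto simp: c_def abs_if split: if_splits)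
          then have "real n * c \<le> real n * (a - b + \<eta> j n)" by (intro mult_left_mono) auto
          then have "A j n x \<subseteq> {\<omega>\<in>space M. x + real n * c < Y j (- int n) \<omega>}" by (auto simp: A_def)
          then show "(case (j, n) of (j, n) \<Rightarrow> E \<inter> A j n x) \<in> events \<and> (case (j, n) of (j, n) \<Rightarrow> E \<inter> A j n x) \<subseteq> {\<omega>\<in>space M. x + real n * c < Y j (- int n) \<omega>}"
            using EA[OF jn(1)] by auto
        qed (use fR R J in auto)
        also have "prob (\<Union>i\<in>R \<times> J. (\<lambda>(j, n). E \<inter> A j n x) i) \<le> prob (E \<inter> A0 x)"
        proof (intro finite_measure_mono sets.Int E A0_events subsetI)
          fix \<omega> assume "\<omega> \<in> (\<Union>i\<in>R \<times> J. (\<lambda>(j, n). E \<inter> A j n x) i)"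
          then obtain j n where "j \<in> R" "n \<in> J" "\<omega> \<in> E" "\<omega> \<in> A j n x" by auto
          then show "\<omega> \<in> E \<inter> A0 x" unfolding A0_def A1_def using R J by blast
        qed
        finally show ?thesis by simp
      qed
      \<comment> \<open>An infinite sum over a non-summable family is 0 by convention; the common
        bound on finite partial sums excludes this case.\<close>
      have summ: "(\<lambda>n. prob (E \<inter> A j n x)) summable_on ?S" if "j \<in> {1..r}" for j
      proof (rule nonneg_bdd_above_summable_on)
        show "bdd_above (sum (\<lambda>n. prob (E \<inter> A j n x)) ` {J. J \<subseteq> ?S \<and> finite J})"
          using bound[of "{j}"] that by (intro bdd_aboveI2[of _ _ "prob (E \<inter> A0 x) + \<theta> * SE.H x"]) auto
      qed simp
      have "prob (E \<inter> A0 x) \<le> (\<Sum>j=1..r. prob (E \<inter> A1 j x))"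
      proof -
        have "E \<inter> A0 x = (\<Union>j\<in>{1..r}. E \<inter> A1 j x)" by (auto simp: A0_def)
        then show ?thesis using E A1_events by (simp only:) (intro finite_measure_subadditive_finite, auto)
      qed
      moreover have "(\<Sum>j=1..r. prob (E \<inter> A1 j x)) \<le> total E x"
      proof (rule sum_mono)
        fix j assume j: "j \<in> {1..r}"
        \<comment> \<open>Filling up with empty sets turns the sum over indices from
          \<open>N x\<close> on into a series over all natural numbers, the form of countable
          subadditivity.\<close>
        define g where "g n = (if n \<in> ?S then E \<inter> A j n x else {})" for n
        have eq: "(\<Sum>\<^sub>\<infinity>n\<in>?S. prob (E \<inter> A j n x)) = (\<Sum>\<^sub>\<infinity>n. prob (g n))"
          by (rule infsum_cong_neutral) (auto simp: g_def)
        have "(\<lambda>n. prob (g n)) summable_on UNIV"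
          by (rule summable_on_cong_neutral[THEN iffD1, OF _ _ _ summ[OF j]]) (auto simp: g_def)
        then have sums: "(\<lambda>n. prob (g n)) sums (\<Sum>\<^sub>\<infinity>n. prob (g n))"
          by (intro has_sum_imp_sums has_sum_infsum)
        have "E \<inter> A1 j x = (\<Union>n. g n)" by (auto simp: A1_def g_def)
        also have "prob \<dots> \<le> (\<Sum>n. prob (g n))"
          using EA[OF j] sums by (intro finite_measure_subadditive_countably) (auto simp: g_def sums_iff)
        finally show "prob (E \<inter> A1 j x) \<le> (\<Sum>\<^sub>\<infinity>n\<in>?S. prob (E \<inter> A j n x))"
          unfolding eq using sums by (simp add: sums_iff)
      qed
      moreover have "total E x \<le> prob (E \<inter> A0 x) + \<theta> * SE.H x"
      proof (rule tendsto_upperbound)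
        show "((\<lambda>J. \<Sum>j\<in>{1..r}. \<Sum>n\<in>J. prob (E \<inter> A j n x)) \<longlongrightarrow> total E x) (finite_subsets_at_top ?S)"
          by (intro tendsto_sum infsum_tendsto summ)
        show "\<forall>\<^sub>F J in finite_subsets_at_top ?S. (\<Sum>j\<in>{1..r}. \<Sum>n\<in>J. prob (E \<inter> A j n x)) \<le> prob (E \<inter> A0 x) + \<theta> * SE.H x"
          by (rule eventually_finite_subsets_at_top_weakI) (rule bound, auto)
      qed simp
      ultimately show "prob (E \<inter> A0 x) \<le> (\<Sum>j=1..r. prob (E \<inter> A1 j x)) \<and>
        (\<Sum>j=1..r. prob (E \<inter> A1 j x)) \<le> total E x \<and> total E x \<le> prob (E \<inter> A0 x) + \<theta> * SE.H x" by blast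
    qed
  qed
qed

text \<open>Almost surely on \<open>E x\<close> the stationary dater exceeds \<open>x\<close>, so
  what \<open>A0\<close> misses of \<open>E x\<close> is at most the off-jump probability; the two
  sums lie between P(E x and A0 x) and the same plus the overlaps.\<close>

lemma decomposition_smallo:
  assumes E: "\<And>x. E x \<in> events" and sub: "\<And>x. AE \<omega> in M. \<omega> \<in> E x \<longrightarrow> ereal x < Zs \<omega>"
  shows "(\<lambda>x. prob (E x) - prob (E x \<inter> A0 x)) \<in> o(SE.H)"
    "(\<lambda>x. prob (E x) - (\<Sum>j=1..r. prob (E x \<inter> A1 j x))) \<in> o(SE.H)"
    "(\<lambda>x. prob (E x) - total (E x) x) \<in> o(SE.H)"
proof -
  have off: "prob (E x) - prob (E x \<inter> A0 x) \<le> prob ({\<omega>\<in>space M. ereal x < Zs \<omega>} - A0 x)" for x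
  proof -
    have "prob (E x) - prob (E x \<inter> A0 x) = prob (E x - A0 x)"
      by (rule finite_measure_Diff'[symmetric, OF E A0_events])
    also have "\<dots> \<le> prob ({\<omega>\<in>space M. ereal x < Zs \<omega>} - A0 x)"
      using sub[of x] sets.sets_into_space[OF E[of x]]
      by (intro finite_measure_mono_AE sets.Diff Zs_events A0_events) (auto elim!: eventually_mono)
    finally show ?thesis .
  qed
  have le: "prob (E x \<inter> A0 x) \<le> prob (E x)" for x
    by (intro finite_measure_mono E) auto
  have "\<forall>\<^sub>F x in at_top. \<bar>prob (E x) - prob (E x \<inter> A0 x)\<bar> \<le> \<theta> * SE.H x \<and>
      \<bar>prob (E x) - (\<Sum>j=1..r. prob (E x \<inter> A1 j x))\<bar> \<le> \<theta> * SE.H x \<and>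
      \<bar>prob (E x) - total (E x) x\<bar> \<le> \<theta> * SE.H x" if \<theta>: "\<theta> > 0" for \<theta>
    using off_jumps_negligible[OF \<theta>] decomposition[OF \<theta>]
  proof eventually_elim
    case (elim x)
    show ?case using elim(1) off[of x] le[of x] elim(2)[rule_format, OF E[of x]] by (auto simp: abs_le_iff)
  qed
  then have ev: "\<forall>\<^sub>F x in at_top. \<bar>prob (E x) - prob (E x \<inter> A0 x)\<bar> \<le> \<theta> * SE.H x"
    "\<forall>\<^sub>F x in at_top. \<bar>prob (E x) - (\<Sum>j=1..r. prob (E x \<inter> A1 j x))\<bar> \<le> \<theta> * SE.H x"
    "\<forall>\<^sub>F x in at_top. \<bar>prob (E x) - total (E x) x\<bar> \<le> \<theta> * SE.H x" if \<theta>: "\<theta> > 0" for \<theta>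
    using that by (auto simp: eventually_conj_iff)
  show "(\<lambda>x. prob (E x) - prob (E x \<inter> A0 x)) \<in> o(SE.H)"
    "(\<lambda>x. prob (E x) - (\<Sum>j=1..r. prob (E x \<inter> A1 j x))) \<in> o(SE.H)"
    "(\<lambda>x. prob (E x) - total (E x) x) \<in> o(SE.H)"
    by (rule landau_o.smallI, unfold real_norm_def abs_of_nonneg[OF SE.I.tail_nonneg], erule ev)+
qed

text \<open>All three expressions differ from P(E x) by o(H), hence by o(P(E x)) when
  \<open>H\<close> is O(P(E x)).\<close>

lemma decomposition_asymp_equiv:
  assumes E: "\<And>x. E x \<in> events" and sub: "\<And>x. AE \<omega> in M. \<omega> \<in> E x \<longrightarrow> ereal x < Zs \<omega>"
    and big: "SE.H \<in> O(\<lambda>x. prob (E x))"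
  shows "(\<lambda>x. prob (E x)) \<sim>[at_top] (\<lambda>x. prob (E x \<inter> A0 x))"
    "(\<lambda>x. prob (E x \<inter> A0 x)) \<sim>[at_top] (\<lambda>x. \<Sum>j=1..r. prob (E x \<inter> A1 j x))"
    "(\<lambda>x. \<Sum>j=1..r. prob (E x \<inter> A1 j x)) \<sim>[at_top] (\<lambda>x. total (E x) x)"
proof -
  note q = decomposition_smallo[OF E sub, THEN smallo_imp_asymp_equiv_transfer[OF _ big]]
  show "(\<lambda>x. prob (E x)) \<sim>[at_top] (\<lambda>x. prob (E x \<inter> A0 x))" by (rule q(1))
  show "(\<lambda>x. prob (E x \<inter> A0 x)) \<sim>[at_top] (\<lambda>x. \<Sum>j=1..r. prob (E x \<inter> A1 j x))"
    by (rule asymp_equiv_trans[OF asymp_equiv_symI[OF q(1)] q(2)])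
  show "(\<lambda>x. \<Sum>j=1..r. prob (E x \<inter> A1 j x)) \<sim>[at_top] (\<lambda>x. total (E x) x)"
    by (rule asymp_equiv_trans[OF asymp_equiv_symI[OF q(2)] q(3)])
qed

lemma stationary_tail_bigo: "SE.H \<in> O(\<lambda>x. prob {\<omega>\<in>space M. ereal x < Zs \<omega>})"
proof -
  obtain k where k: "k > 0" "\<forall>\<^sub>F x in at_top. k * SE.H x \<le> prob {\<omega>\<in>space M. ereal x < Zs \<omega>}"
    using stationary_tail_lower[OF N] by blast
  from k(2) have "\<forall>\<^sub>F x in at_top. norm (SE.H x) \<le> (1 / k) * norm (prob {\<omega>\<in>space M. ereal x < Zs \<omega>})"
    by eventually_elim (use k(1) SE.I.tail_nonneg in \<open>simp add: field_simps\<close>)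
  then show ?thesis by (rule bigoI)
qed

end
theorem theorem8:
  fixes M :: "'a measure" and S :: "'k measure"
    and f :: "nat \<Rightarrow> (nat \<Rightarrow> real) \<times> (nat \<Rightarrow> 'k) \<Rightarrow> real"
    and T \<tau> :: "int \<Rightarrow> 'a \<Rightarrow> real" and \<zeta> :: "int \<Rightarrow> 'a \<Rightarrow> 'k"
    and r :: nat and Y :: "nat \<Rightarrow> int \<Rightarrow> 'a \<Rightarrow> real"
    and F :: "real \<Rightarrow> real" and d :: "nat \<Rightarrow> real" and a b :: real
    and N :: "real \<Rightarrow> int" and Z :: "'a \<Rightarrow> ereal"
    and K A :: "nat \<Rightarrow> nat \<Rightarrow> real \<Rightarrow> 'a set" and \<eta> :: "nat \<Rightarrow> nat \<Rightarrow> real"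
    and A1 :: "nat \<Rightarrow> real \<Rightarrow> 'a set" and A0 :: "real \<Rightarrow> 'a set"
  assumes "prob_space M"
    \<comment> \<open>the network and its input\<close>
    and "measurable_network S f"
    and "\<And>\<omega>. \<omega> \<in> space M \<Longrightarrow> monotone_separable f (\<lambda>n. \<zeta> n \<omega>)"
    and "\<And>n. T n \<in> borel_measurable M"
    and "\<And>\<omega>. \<omega> \<in> space M \<Longrightarrow> mono (\<lambda>n. T n \<omega>)"
    and "\<And>n. \<tau> n = (\<lambda>\<omega>. T (n + 1) \<omega> - T n \<omega>)"
    and "stationary_ergodic M (borel \<Otimes>\<^sub>M S) (\<lambda>n \<omega>. (\<tau> n \<omega>, \<zeta> n \<omega>))"
    and "\<And>n. integrable M (\<tau> n)" and "\<And>n. (\<integral>\<omega>. \<tau> n \<omega> \<partial>M) = a"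
    and "\<And>n. integrable M (\<lambda>\<omega>. maximal_dater f n n (\<lambda>k. T k \<omega>) (\<lambda>k. \<zeta> k \<omega>))"
    and "b = gamma0 M f \<zeta>" and "b < a"
    and "\<And>\<omega>. Z \<omega> = stationary_dater f (\<lambda>k. T k \<omega>) (\<lambda>k. \<zeta> k \<omega>)"
    \<comment> \<open>distributional assumptions\<close>
    and "r \<ge> 1"
    and "assumption_IA M S \<zeta> \<tau>"
    and "assumption_AA M f \<zeta> \<tau> r Y"
    and "assumption_SE M r Y F d"
    and "assumption_H M r Y F d"
    and "admissible_threshold F N"
    \<comment> \<open>the events\<close>
    and "\<And>j n x. j \<in> {1..r} \<Longrightarrow> K j n x \<in> sets M"
    and "\<And>j n x. j \<in> {1..r} \<Longrightarrow>
           prob_space.indep_set M {K j n x} (sets (vimage_algebra (space M) (Y j (- int n)) borel))"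
    and "\<And>j \<epsilon>. j \<in> {1..r} \<Longrightarrow> \<epsilon> > 0 \<Longrightarrow>
           \<forall>\<^sub>F x in at_top. \<forall>n. int n \<ge> N x \<longrightarrow> \<bar>measure M (K j n x) - 1\<bar> < \<epsilon>"
    and "\<And>j. j \<in> {1..r} \<Longrightarrow> \<eta> j \<longlonglongrightarrow> 0"
    and "\<And>j n x. A j n x = K j n x \<inter>
           {\<omega>\<in>space M. Y j (- int n) \<omega> > x + real n * (a - b + \<eta> j n)}"
    and "\<And>j x. A1 j x = (\<Union>n\<in>{n. int n \<ge> N x}. A j n x)"
    and "\<And>x. A0 x = (\<Union>j\<in>{1..r}. A1 j x)"
  shows
    "((\<lambda>x. \<P>(\<omega> in M. Z \<omega> > ereal x))
        \<sim>[at_top] (\<lambda>x. \<P>(\<omega> in M. Z \<omega> > ereal x \<and> \<omega> \<in> A0 x)) \<and>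
      (\<lambda>x. \<P>(\<omega> in M. Z \<omega> > ereal x \<and> \<omega> \<in> A0 x))
        \<sim>[at_top] (\<lambda>x. \<Sum>j=1..r. \<P>(\<omega> in M. Z \<omega> > ereal x \<and> \<omega> \<in> A1 j x)) \<and>
      (\<lambda>x. \<Sum>j=1..r. \<P>(\<omega> in M. Z \<omega> > ereal x \<and> \<omega> \<in> A1 j x))
        \<sim>[at_top] (\<lambda>x. \<Sum>j=1..r. \<Sum>\<^sub>\<infinity>n\<in>{n. int n \<ge> N x}. \<P>(\<omega> in M. Z \<omega> > ereal x \<and> \<omega> \<in> A j n x)))
     \<and>
     (\<forall>Zt \<in> borel_measurable M. (AE \<omega> in M. ereal (Zt \<omega>) \<le> Z \<omega>) \<longrightarrow>
       ((\<lambda>x. \<P>(\<omega> in M. Zt \<omega> > x) - \<P>(\<omega> in M. Zt \<omega> > x \<and> \<omega> \<in> A0 x))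
          \<in> o(tail (integrated_tail F)) \<and>
        (\<lambda>x. \<P>(\<omega> in M. Zt \<omega> > x) - (\<Sum>j=1..r. \<P>(\<omega> in M. Zt \<omega> > x \<and> \<omega> \<in> A1 j x)))
          \<in> o(tail (integrated_tail F)) \<and>
        (\<lambda>x. \<P>(\<omega> in M. Zt \<omega> > x) -
             (\<Sum>j=1..r. \<Sum>\<^sub>\<infinity>n\<in>{n. int n \<ge> N x}. \<P>(\<omega> in M. Zt \<omega> > x \<and> \<omega> \<in> A j n x)))
          \<in> o(tail (integrated_tail F)))
       \<and>
       ((\<lambda>x. \<P>(\<omega> in M. Zt \<omega> > x)) \<in> \<Theta>(tail (integrated_tail F)) \<longrightarrow>
         (\<lambda>x. \<P>(\<omega> in M. Zt \<omega> > x))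
           \<sim>[at_top] (\<lambda>x. \<P>(\<omega> in M. Zt \<omega> > x \<and> \<omega> \<in> A0 x)) \<and>
         (\<lambda>x. \<P>(\<omega> in M. Zt \<omega> > x \<and> \<omega> \<in> A0 x))
           \<sim>[at_top] (\<lambda>x. \<Sum>j=1..r. \<P>(\<omega> in M. Zt \<omega> > x \<and> \<omega> \<in> A1 j x)) \<and>
         (\<lambda>x. \<Sum>j=1..r. \<P>(\<omega> in M. Zt \<omega> > x \<and> \<omega> \<in> A1 j x))
           \<sim>[at_top] (\<lambda>x. \<Sum>j=1..r. \<Sum>\<^sub>\<infinity>n\<in>{n. int n \<ge> N x}. \<P>(\<omega> in M. Zt \<omega> > x \<and> \<omega> \<in> A j n x))))"
proof -
  interpret prob_space M by (rule assms(1))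
  have SE: "subexponential F" "subexponential (integrated_tail F)"
    using assms(17) by (auto simp: assumption_SE_def)
  interpret J: big_jump_events M F S f T \<tau> \<zeta> r Y d a b N K \<eta>
    by (intro big_jump_events.intro heavy_network.intro subexponential_integrated.intro
          subexponential_distribution.intro heavy_network_axioms.intro big_jump_events_axioms.intro;
        fact SE assms)
  have A: "A j n x = J.A j n x" for j n x unfolding J.A_def by (rule assms(24))
  have A1: "A1 j x = J.A1 j x" for j x unfolding J.A1_def assms(25) A ..
  have A0: "A0 x = J.A0 x" for x unfolding J.A0_def assms(26) A1 ..
  have split: "{\<omega>\<in>space M. P \<omega> \<and> \<omega> \<in> X} = {\<omega>\<in>space M. P \<omega>} \<inter> X" for P X by auto
  have Z: "(\<lambda>x. \<P>(\<omega> in M. Z \<omega> > ereal x)) \<sim>[at_top] (\<lambda>x. \<P>(\<omega> in M. Z \<omega> > ereal x \<and> \<omega> \<in> A0 x))"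
    "(\<lambda>x. \<P>(\<omega> in M. Z \<omega> > ereal x \<and> \<omega> \<in> A0 x))
      \<sim>[at_top] (\<lambda>x. \<Sum>j=1..r. \<P>(\<omega> in M. Z \<omega> > ereal x \<and> \<omega> \<in> A1 j x))"
    "(\<lambda>x. \<Sum>j=1..r. \<P>(\<omega> in M. Z \<omega> > ereal x \<and> \<omega> \<in> A1 j x))
      \<sim>[at_top] (\<lambda>x. \<Sum>j=1..r. \<Sum>\<^sub>\<infinity>n\<in>{n. int n \<ge> N x}. \<P>(\<omega> in M. Z \<omega> > ereal x \<and> \<omega> \<in> A j n x))"
    unfolding split A A1 A0 assms(13)
    by (rule J.decomposition_asymp_equiv[OF J.Zs_events _ J.stationary_tail_bigo], simp)+
  show ?thesis
  proof (intro conjI ballI impI Z)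
    fix Zt assume Zt: "Zt \<in> borel_measurable M" "AE \<omega> in M. ereal (Zt \<omega>) \<le> Z \<omega>"
    have ev: "{\<omega>\<in>space M. x < Zt \<omega>} \<in> events" for x using Zt(1) by measurable
    have sub: "AE \<omega> in M. \<omega> \<in> {\<omega>\<in>space M. x < Zt \<omega>} \<longrightarrow> ereal x < J.Zs \<omega>" for x
      using Zt(2) unfolding assms(13)
      by eventually_elim (auto intro: less_le_trans[where y="ereal _"])
    show "(\<lambda>x. \<P>(\<omega> in M. Zt \<omega> > x) - \<P>(\<omega> in M. Zt \<omega> > x \<and> \<omega> \<in> A0 x)) \<in> o(tail (integrated_tail F))"
      "(\<lambda>x. \<P>(\<omega> in M. Zt \<omega> > x) - (\<Sum>j=1..r. \<P>(\<omega> in M. Zt \<omega> > x \<and> \<omega> \<in> A1 j x))) \<in> o(tail (integrated_tail F))"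
      "(\<lambda>x. \<P>(\<omega> in M. Zt \<omega> > x) -
           (\<Sum>j=1..r. \<Sum>\<^sub>\<infinity>n\<in>{n. int n \<ge> N x}. \<P>(\<omega> in M. Zt \<omega> > x \<and> \<omega> \<in> A j n x))) \<in> o(tail (integrated_tail F))"
      unfolding split A A1 A0 by (rule J.decomposition_smallo[OF ev sub])+
    assume "(\<lambda>x. \<P>(\<omega> in M. Zt \<omega> > x)) \<in> \<Theta>(tail (integrated_tail F))"
    then have big: "tail (integrated_tail F) \<in> O(\<lambda>x. \<P>(\<omega> in M. Zt \<omega> > x))"
      by (metis bigtheta_sym bigthetaD1)
    show "(\<lambda>x. \<P>(\<omega> in M. Zt \<omega> > x)) \<sim>[at_top] (\<lambda>x. \<P>(\<omega> in M. Zt \<omega> > x \<and> \<omega> \<in> A0 x))"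
      "(\<lambda>x. \<P>(\<omega> in M. Zt \<omega> > x \<and> \<omega> \<in> A0 x))
        \<sim>[at_top] (\<lambda>x. \<Sum>j=1..r. \<P>(\<omega> in M. Zt \<omega> > x \<and> \<omega> \<in> A1 j x))"
      "(\<lambda>x. \<Sum>j=1..r. \<P>(\<omega> in M. Zt \<omega> > x \<and> \<omega> \<in> A1 j x))
        \<sim>[at_top] (\<lambda>x. \<Sum>j=1..r. \<Sum>\<^sub>\<infinity>n\<in>{n. int n \<ge> N x}. \<P>(\<omega> in M. Zt \<omega> > x \<and> \<omega> \<in> A j n x))"
      unfolding split A A1 A0 by (rule J.decomposition_asymp_equiv[OF ev sub big])+
  qed
qed

end
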